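(* Let $n\geq 1$ and let $\varphi$ be an analytic selfmap of $\mathbb{B}_n$ such that $C_\varphi$ is bounded on $H^2$. If $C_\varphi$ can be written in the form $C_\varphi=T_f+K$ for some $f\in L^\infty(\mathbb{S}_n,d\sigma)$ and some compact operator $K$ on $H^2$, then either $C_\varphi$ is compact or $C_\varphi$ is the identity operator.
   Context: $\mathbb{B}_n$ is the open unit ball and $\mathbb{S}_n$ the unit sphere of $\mathbb{C}^n$; $\sigma$ is the normalized surface measure on $\mathbb{S}_n$ ($\sigma(\mathbb{S}_n)=1$). The Hardy space $H^2$ consists of all analytic $h$ on $\mathbb{B}_n$ with $\|h\|^2=\sup_{0<r<1}\int_{\mathbb{S}_n}|h(r\zeta)|^2\,d\sigma(\zeta)<\infty$; via radial boundary limits (which exist a.e.) it is identified with a closed subspace of $L^2(\mathbb{S}_n,d\sigma)$, and $P$ is the orthogonal projection of $L^2(\mathbb{S}_n,d\sigma)$ onto $H^2$. For $f\in L^\infty(\mathbb{S}_n,d\sigma)$ the Toeplitz operator is $T_f h=P(fh)$, $h\in H^2$. For an analytic map $\varphi:\mathbb{B}_n\to\mathbb{B}_n$ (an analytic selfmap of $\mathbb{B}_n$), the composition operator is $C_\varphi h=h\circ\varphi$. *)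

theory Defs
  imports "HOL-Analysis.Analysis"
begin

text \<open>
  Normalized surface measure on the unit sphere of \<open>\<complex>\<^sup>n\<close>, as the cone measure: a Borel set
  \<open>A\<close> of the sphere gets the proportion of the volume of the unit ball that is taken up by the cone
  \<open>{r \<zeta>. \<zeta> \<in> A, 0 < r < 1}\<close>. (\<open>sgn x = x / |x|\<close>; the origin is a null set.)
\<close>

definition sphere_measure :: "(complex ^ 'n) measure" where
  "sphere_measure =
     restrict_space (distr (uniform_measure lborel (ball 0 1)) borel sgn) (sphere 0 1)"

lemma space_sphere_measure [simp]:
  "space (sphere_measure :: (complex ^ 'n) measure) = sphere 0 1"
  by (simp add: sphere_measure_def space_restrict_space)

lemma sets_sphere_measure [simp, measurable_cong]:
  "sets (sphere_measure :: (complex ^ 'n) measure) = sets (restrict_space borel (sphere 0 1))"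
  unfolding sphere_measure_def by (intro sets_restrict_space_cong) simp

lemma emeasure_sphere_measure:
  fixes A :: "(complex ^ 'n) set"
  assumes A: "A \<in> sets borel" "A \<subseteq> sphere 0 1"
  shows "emeasure sphere_measure A =
    emeasure lborel {x \<in> ball 0 1. sgn x \<in> A} / emeasure lborel (ball (0 :: complex ^ 'n) 1)"
proof -
  have [measurable]: "(sgn :: complex ^ 'n \<Rightarrow> _) \<in> borel_measurable borel"
    unfolding sgn_div_norm[abs_def] by measurable
  have [measurable]: "A \<in> sets borel" by fact
  have sg: "sgn -` A \<in> sets (borel :: (complex ^ 'n) measure)"
    using measurable_sets[of sgn borel borel A] by simp
  have "emeasure sphere_measure A =
        emeasure (distr (uniform_measure lborel (ball (0 :: complex ^ 'n) 1)) borel sgn) A"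
    unfolding sphere_measure_def using A by (intro emeasure_restrict_space) auto
  also have "\<dots> = emeasure (uniform_measure lborel (ball (0 :: complex ^ 'n) 1)) (sgn -` A)"
    by (subst emeasure_distr) auto
  also have "\<dots> = emeasure lborel (ball 0 1 \<inter> sgn -` A) / emeasure lborel (ball (0 :: complex ^ 'n) 1)"
    using sg by (intro emeasure_uniform_measure) auto
  also have "ball 0 1 \<inter> sgn -` A = {x \<in> ball 0 1. sgn x \<in> A}" by auto
  finally show ?thesis .
qed

lemma emeasure_sphere_measure_sphere:
  "emeasure sphere_measure (sphere (0 :: complex ^ 'n) 1) = 1"
proof -
  let ?B = "ball (0 :: complex ^ 'n) 1"
  have "{x \<in> ?B. sgn x \<in> sphere 0 1} = ?B - {0}"
    by (auto simp: norm_sgn)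
  moreover have "emeasure lborel (?B - {0}) = emeasure lborel ?B"
    by (rule emeasure_Diff_null_set) (auto simp: null_sets_def)
  moreover have "emeasure lborel ?B \<noteq> 0" "emeasure lborel ?B \<noteq> top"
    using emeasure_lborel_ball_finite[of "0 :: complex ^ 'n" 1]
    by (auto simp: emeasure_ball unit_ball_vol_pos less_imp_neq[symmetric] simp del: not_gr_zero)
  ultimately show ?thesis
    by (subst emeasure_sphere_measure) (auto simp: less_top ennreal_divide_self)
qed

text \<open>Complex differentiability in several variables; \<open>U\<close> is meant to be open.\<close>

definition holomorphic_fun_on :: "(complex ^ 'n \<Rightarrow> complex) \<Rightarrow> (complex ^ 'n) set \<Rightarrow> bool" where
  "holomorphic_fun_on h U \<longleftrightarrow>
     (\<forall>z\<in>U. \<exists>D. (h has_derivative D) (at z) \<and> (\<forall>c v. D (c *s v) = c * D v))"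

definition analytic_selfmap :: "(complex ^ 'n \<Rightarrow> complex ^ 'n) \<Rightarrow> bool" where
  "analytic_selfmap \<phi> \<longleftrightarrow>
     \<phi> ` ball 0 1 \<subseteq> ball 0 1 \<and> (\<forall>i. holomorphic_fun_on (\<lambda>z. \<phi> z $ i) (ball 0 1))"

text \<open>
  An element of the Hardy space is a function on the ball. It is represented by the total function
  that vanishes off the ball, so that equality of elements is equality of HOL functions.
\<close>

definition Hardy2 :: "(complex ^ 'n \<Rightarrow> complex) set" where
  "Hardy2 = {h. holomorphic_fun_on h (ball 0 1) \<and> (\<forall>z. z \<notin> ball 0 1 \<longrightarrow> h z = 0) \<and>
     bdd_above ((\<lambda>r. \<integral>\<zeta>. (cmod (h (r *\<^sub>R \<zeta>)))\<^sup>2 \<partial>sphere_measure) ` {0<..<1})}"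

definition Hardy2_norm :: "(complex ^ 'n \<Rightarrow> complex) \<Rightarrow> real" where
  "Hardy2_norm h = sqrt (SUP r\<in>{0<..<1}. \<integral>\<zeta>. (cmod (h (r *\<^sub>R \<zeta>)))\<^sup>2 \<partial>sphere_measure)"

text \<open>Where the radial limit does not exist (a null set), the value is an unspecified constant.\<close>

definition boundary_fun :: "(complex ^ 'n \<Rightarrow> complex) \<Rightarrow> complex ^ 'n \<Rightarrow> complex" where
  "boundary_fun h \<zeta> = Lim (at_left 1) (\<lambda>r. h (r *\<^sub>R \<zeta>))"

definition L2_inner :: "(complex ^ 'n \<Rightarrow> complex) \<Rightarrow> (complex ^ 'n \<Rightarrow> complex) \<Rightarrow> complex" where
  "L2_inner g k = (\<integral>\<zeta>. g \<zeta> * cnj (k \<zeta>) \<partial>sphere_measure)"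

text \<open>
  For square integrable \<open>g\<close>, the element of the Hardy space whose boundary function is the
  orthogonal projection of \<open>g\<close> to the closed subspace of boundary functions.
\<close>

definition Hardy2_proj :: "(complex ^ 'n \<Rightarrow> complex) \<Rightarrow> complex ^ 'n \<Rightarrow> complex" where
  "Hardy2_proj g = (THE h. h \<in> Hardy2 \<and>
     (\<forall>k\<in>Hardy2. L2_inner (\<lambda>\<zeta>. g \<zeta> - boundary_fun h \<zeta>) (boundary_fun k) = 0))"

definition Linfty_sphere :: "(complex ^ 'n \<Rightarrow> complex) set" where
  "Linfty_sphere = {f \<in> borel_measurable sphere_measure.
     \<exists>B. AE \<zeta> in sphere_measure. cmod (f \<zeta>) \<le> B}"

definition toeplitz ::
  "(complex ^ 'n \<Rightarrow> complex) \<Rightarrow> (complex ^ 'n \<Rightarrow> complex) \<Rightarrow> complex ^ 'n \<Rightarrow> complex" where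
  "toeplitz f h = Hardy2_proj (\<lambda>\<zeta>. f \<zeta> * boundary_fun h \<zeta>)"

definition comp_op ::
  "(complex ^ 'n \<Rightarrow> complex ^ 'n) \<Rightarrow> (complex ^ 'n \<Rightarrow> complex) \<Rightarrow> complex ^ 'n \<Rightarrow> complex" where
  "comp_op \<phi> h = (\<lambda>z. if z \<in> ball 0 1 then h (\<phi> z) else 0)"

text \<open>Operators on the Hardy space are HOL functions of which only the values on \<open>Hardy2\<close> matter.\<close>

definition linear_op_Hardy2 ::
  "((complex ^ 'n \<Rightarrow> complex) \<Rightarrow> (complex ^ 'n \<Rightarrow> complex)) \<Rightarrow> bool" where
  "linear_op_Hardy2 T \<longleftrightarrow> T ` Hardy2 \<subseteq> Hardy2 \<and>
     (\<forall>g\<in>Hardy2. \<forall>h\<in>Hardy2. \<forall>a b. T (\<lambda>z. a * g z + b * h z) = (\<lambda>z. a * T g z + b * T h z))"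

definition bounded_op_Hardy2 ::
  "((complex ^ 'n \<Rightarrow> complex) \<Rightarrow> (complex ^ 'n \<Rightarrow> complex)) \<Rightarrow> bool" where
  "bounded_op_Hardy2 T \<longleftrightarrow> linear_op_Hardy2 T \<and>
     (\<exists>B. \<forall>h\<in>Hardy2. Hardy2_norm (T h) \<le> B * Hardy2_norm h)"

definition compact_op_Hardy2 ::
  "((complex ^ 'n \<Rightarrow> complex) \<Rightarrow> (complex ^ 'n \<Rightarrow> complex)) \<Rightarrow> bool" where
  "compact_op_Hardy2 T \<longleftrightarrow> linear_op_Hardy2 T \<and>
     (\<forall>u :: nat \<Rightarrow> _. (\<forall>m. u m \<in> Hardy2) \<and> bdd_above (range (\<lambda>m. Hardy2_norm (u m))) \<longrightarrow>
        (\<exists>g\<in>Hardy2. \<exists>s. strict_mono s \<and>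
           (\<lambda>m. Hardy2_norm (\<lambda>z. T (u (s m)) z - g z)) \<longlonglongrightarrow> 0))"

end

theory Submission
  imports Defs "HOL-Complex_Analysis.Conformal_Mappings"
begin

text \<open>
  To a sesquilinear form \<open>S\<close> on the Hardy space associate the form
  \<open>(h, k) \<mapsto> \<Sum>j. S (z\<^sub>j h) (z\<^sub>j k)\<close>, where \<open>z\<^sub>j\<close> are the coordinate functions, and iterate.
  The three terms of \<open>C\<^sub>\<phi> = T\<^sub>f + K\<close> react to this in different ways.  Write \<open>\<phi>*\<close> and \<open>h*\<close> for
  radial boundary values.

  \<^item> The form \<open>\<integral> f h* cnj k*\<close> of \<open>T\<^sub>f\<close> does not change, because \<open>\<Sum>j. |\<zeta>\<^sub>j|\<^sup>2 = 1\<close> on the sphere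
    (\<open>toeplitz_form\<close>).
  \<^item> The form of \<open>C\<^sub>\<phi>\<close> acquires a factor \<open>q = \<Sum>j. \<phi>*\<^sub>j cnj \<zeta>\<^sub>j\<close> under the integral at each step,
    because \<open>C\<^sub>\<phi> (z\<^sub>j h) = \<phi>\<^sub>j C\<^sub>\<phi> h\<close> (\<open>composition_form\<close>).
  \<^item> The form of \<open>K\<close> tends to zero, because after \<open>m\<close> steps \<open>K\<close> acts on functions that vanish to
    order \<open>m\<close> at the origin (\<open>compact_op_small_on_vanishing\<close>, \<open>iterated_form_small\<close>).

  Hence \<open>\<integral> q\<^sup>m (C\<^sub>\<phi> h)* cnj k*\<close> tends to \<open>\<integral> f h* cnj k*\<close>.  Here \<open>|q| \<le> 1\<close>, and \<open>q(\<zeta>) = 1\<close> holds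
  exactly where \<open>\<phi>*(\<zeta>) = \<zeta>\<close>.  If this set is null, then the arithmetic means of \<open>q\<^sup>m\<close> tend to zero
  almost everywhere, the limit is zero for all \<open>h\<close> and \<open>k\<close>, so \<open>T\<^sub>f = 0\<close> and \<open>C\<^sub>\<phi> = K\<close> is compact
  (\<open>toeplitz_eq_0_if_no_fixed_points\<close>).  Otherwise the bounded functions \<open>\<phi>\<^sub>j - z\<^sub>j\<close> have radial
  limit zero on a set of positive measure, so they vanish and \<open>\<phi>\<close> is the identity
  (\<open>selfmap_eq_id_if_fixed_points\<close>).

  The argument rests on four facts about the Hardy space of the ball.
  Radial limits exist almost everywhere: this follows from a maximal inequality for averages over
  arcs of the circles \<open>e\<^sup>i\<^sup>t \<zeta>\<close>, which is an instance of the maximal ergodic theorem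
  (\<open>arc_maximal_inequality\<close>, \<open>Hardy2_radial_limits\<close>).
  The Hardy norm is the \<open>L\<^sup>2\<close> norm of the boundary function: dilations act diagonally on the
  homogeneous components, which are orthogonal by circle invariance (\<open>parseval\<close>,
  \<open>Hardy2_norm_boundary\<close>).
  The Hardy space is complete, so the projection and with it \<open>T\<^sub>f\<close> are given by a unique element
  (\<open>Hardy2_complete\<close>, \<open>Hardy2_projection_ex1\<close>).
  A bounded holomorphic function whose radial limits vanish on a set of positive measure is zero:
  on discs this is the subharmonicity of \<open>|f|\<^bsup>1/n\<^esup>\<close> for all \<open>n\<close>, and Tonelli's theorem for the circle
  action carries it over to the ball (\<open>bounded_radial_uniqueness_ball\<close>).
\<close>

section \<open>Rotation invariance of volume and surface measure\<close>

lemma norm_vector_smult: "norm (c *s (x :: complex ^ 'n)) = cmod c * norm x"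
  by (simp add: norm_vec_def norm_mult L2_set_right_distrib)

lemma vector_smult_assoc_complex: "a *s (b *s x) = (a * b) *s (x :: complex ^ 'n)"
  by (simp add: vec_eq_iff)

lemma vector_smult_of_real: "of_real r *s x = r *\<^sub>R (x :: complex ^ 'n)"
  by (simp add: vec_eq_iff scaleR_conv_of_real[where 'a = complex])

lemma vector_smult_scaleR: "c *s (r *\<^sub>R x) = r *\<^sub>R (c *s (x :: complex ^ 'n))"
  by (simp add: vec_eq_iff)

lemma bounded_linear_smult_right: "bounded_linear (\<lambda>x :: complex ^ 'n. c *s x)"
  by (rule bounded_linear_intro[where K = "cmod c"])
     (auto simp: vec_eq_iff algebra_simps norm_vector_smult)

lemma bounded_linear_smult_left: "bounded_linear (\<lambda>c. c *s (x :: complex ^ 'n))"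
  by (rule bounded_linear_intro[where K = "norm x"])
     (auto simp: vec_eq_iff algebra_simps norm_vector_smult)

lemma continuous_on_smult [continuous_intros]:
  fixes g :: "'a :: topological_space \<Rightarrow> complex ^ 'n"
  assumes "continuous_on A f" "continuous_on A g"
  shows "continuous_on A (\<lambda>x. f x *s g x)"
  unfolding vector_scalar_mult_def
  by (intro continuous_on_vec_lambda continuous_intros assms
      bounded_linear.continuous_on[OF bounded_linear_vec_nth])

lemma borel_measurable_smult [measurable]:
  fixes g :: "'a \<Rightarrow> complex ^ 'n"
  assumes [measurable]: "f \<in> borel_measurable M" "g \<in> borel_measurable M"
  shows "(\<lambda>x. f x *s g x) \<in> borel_measurable M"
proof -
  have "continuous_on UNIV (\<lambda>p :: complex \<times> (complex ^ 'n). fst p *s snd p)"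
    by (intro continuous_intros)
  then have "(\<lambda>p :: complex \<times> (complex ^ 'n). fst p *s snd p) \<in> borel_measurable borel"
    by (rule borel_measurable_continuous_onI)
  from measurable_compose[OF _ this, of "\<lambda>x. (f x, g x)" M] show ?thesis
    by simp
qed

lemma borel_measurable_sgn_vec [measurable]: "(sgn :: complex ^ 'n \<Rightarrow> _) \<in> borel_measurable borel"
  unfolding sgn_div_norm[abs_def] by measurable

lemma nn_integral_lborel_translate:
  fixes f :: "'a :: euclidean_space \<Rightarrow> ennreal"
  assumes [measurable]: "f \<in> borel_measurable borel"
  shows "(\<integral>\<^sup>+x. f (c + x) \<partial>lborel) = (\<integral>\<^sup>+x. f x \<partial>lborel)"
proof -
  have "(\<integral>\<^sup>+x. f x \<partial>lborel) = (\<integral>\<^sup>+x. f x \<partial>distr lborel borel ((+) c))"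
    by (simp add: lborel_distr_plus)
  also have "\<dots> = (\<integral>\<^sup>+x. f (c + x) \<partial>lborel)"
    by (subst nn_integral_distr) auto
  finally show ?thesis by simp
qed

lemma emeasure_ball_pos_finite:
  fixes x :: "complex ^ 'n"
  assumes "0 < r"
  shows "emeasure lborel (ball x r) \<noteq> 0" "emeasure lborel (ball x r) \<noteq> \<infinity>"
proof -
  show "emeasure lborel (ball x r) \<noteq> 0"
    using emeasure_lborel_ball_finite[of x r] assms
    by (simp add: emeasure_ball less_imp_le unit_ball_vol_pos less_imp_neq[symmetric])
  show "emeasure lborel (ball x r) \<noteq> \<infinity>"
    using emeasure_lborel_ball_finite[of x r] by auto
qed

text \<open>
  Uniqueness of Haar measure: the image of Lebesgue measure under a rotation is translation
  invariant and gives the unit ball its old volume.  Evaluating the double integral of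
  \<open>1\<^sub>A(x) 1\<^sub>B(T y - x)\<close> in both orders compares the two measures on any Borel set \<open>A\<close>.
\<close>

lemma distr_lborel_smult:
  assumes c: "cmod c = 1"
  shows "distr lborel borel (\<lambda>x. c *s x) = (lborel :: (complex ^ 'n) measure)"
proof (rule measure_eqI)
  fix A :: "(complex ^ 'n) set"
  assume "A \<in> sets (distr lborel borel (\<lambda>x. c *s x))"
  then have [measurable]: "A \<in> sets borel" by simp
  define B where "B = ball (0 :: complex ^ 'n) 1"
  have [measurable]: "B \<in> sets borel" by (simp add: B_def)
  have cc: "c * inverse c = 1" using c by (metis norm_eq_zero right_inverse zero_neq_one)
  have shift: "(\<integral>\<^sup>+y. f (u + c *s y) \<partial>lborel) = (\<integral>\<^sup>+y. f (c *s y) \<partial>lborel)"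
    if [measurable]: "f \<in> borel_measurable borel" for f :: "complex ^ 'n \<Rightarrow> ennreal" and u
  proof -
    have "(\<integral>\<^sup>+y. f (c *s (inverse c *s u + y)) \<partial>lborel) = (\<integral>\<^sup>+y. f (c *s y) \<partial>lborel)"
      by (rule nn_integral_lborel_translate) measurable
    then show ?thesis
      by (simp add: linear_add[OF bounded_linear.linear[OF bounded_linear_smult_right]] cc)
  qed
  have "emeasure lborel A * emeasure lborel B =
    (\<integral>\<^sup>+x. indicator A x * (\<integral>\<^sup>+y. indicator B (- x + c *s y) \<partial>lborel) \<partial>lborel)"
  proof -
    have "(\<integral>\<^sup>+y. indicator B (- x + c *s y) \<partial>lborel) = emeasure lborel B" for x
    proof -
      have "(\<integral>\<^sup>+y. indicator B (- x + c *s y) \<partial>lborel) = (\<integral>\<^sup>+y. indicator B (c *s y) \<partial>lborel)"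
        by (rule shift) measurable
      also have "(\<lambda>y. indicator B (c *s y) :: ennreal) = indicator B"
        by (auto simp: B_def indicator_def norm_vector_smult c fun_eq_iff)
      finally show ?thesis by simp
    qed
    then show ?thesis by (simp add: nn_integral_multc)
  qed
  also have "\<dots> = (\<integral>\<^sup>+x. (\<integral>\<^sup>+y. indicator A x * indicator B (- x + c *s y) \<partial>lborel) \<partial>lborel)"
    by (subst nn_integral_cmult) auto
  also have "\<dots> = (\<integral>\<^sup>+y. (\<integral>\<^sup>+x. indicator A x * indicator B (- x + c *s y) \<partial>lborel) \<partial>lborel)"
    by (rule lborel_pair.Fubini') measurable
  also have "\<dots> = (\<integral>\<^sup>+y. (\<integral>\<^sup>+u. indicator A (u + c *s y) * indicator B u \<partial>lborel) \<partial>lborel)"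
  proof (rule nn_integral_cong)
    fix y :: "complex ^ 'n"
    have "(\<integral>\<^sup>+x. indicator A x * indicator B (- x + c *s y) \<partial>lborel) =
      (\<integral>\<^sup>+u. indicator A (c *s y + u) * indicator B (- (c *s y + u) + c *s y) \<partial>(lborel :: (complex ^ 'n) measure))"
      by (rule nn_integral_lborel_translate[symmetric]) measurable
    also have "\<dots> = (\<integral>\<^sup>+u. indicator A (u + c *s y) * indicator B u \<partial>lborel)"
      by (intro nn_integral_cong) (auto simp: B_def indicator_def add.commute)
    finally show "(\<integral>\<^sup>+x. indicator A x * indicator B (- x + c *s y) \<partial>lborel) =
      (\<integral>\<^sup>+u. indicator A (u + c *s y) * indicator B u \<partial>lborel :: ennreal)" .
  qed
  also have "\<dots> = (\<integral>\<^sup>+u. (\<integral>\<^sup>+y. indicator A (u + c *s y) * indicator B u \<partial>lborel) \<partial>lborel)"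
    by (rule lborel_pair.Fubini') measurable
  also have "\<dots> = (\<integral>\<^sup>+u. (\<integral>\<^sup>+y. indicator A (u + c *s y) \<partial>lborel) * indicator B u \<partial>lborel)"
    by (simp add: nn_integral_multc)
  also have "\<dots> = (\<integral>\<^sup>+u. (\<integral>\<^sup>+y. indicator A (c *s y) \<partial>lborel) * indicator B u \<partial>lborel)"
    by (subst shift) auto
  also have "\<dots> = (\<integral>\<^sup>+y. indicator A (c *s y) \<partial>lborel) * emeasure lborel B"
    by (subst nn_integral_cmult) auto
  also have "(\<integral>\<^sup>+y. indicator A (c *s y) \<partial>lborel) = emeasure (distr lborel borel (\<lambda>x. c *s x)) A"
    by (subst nn_integral_distr[symmetric, of "\<lambda>x. c *s x" lborel borel "indicator A"]) (auto simp del: nn_integral_indicator intro!: nn_integral_indicator)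
  finally have "emeasure lborel A * emeasure lborel B = emeasure (distr lborel borel (\<lambda>x. c *s x)) A * emeasure lborel B" .
  moreover have "emeasure lborel B \<noteq> 0" "emeasure lborel B \<noteq> top"
    using emeasure_ball_pos_finite[of 1 "0 :: complex ^ 'n"] by (simp_all add: B_def)
  ultimately show "emeasure (distr lborel borel (\<lambda>x. c *s x)) A = emeasure lborel A"
    by (metis ennreal_mult_divide_eq)
qed simp

text \<open>
  The circle action \<open>x \<mapsto> c x\<close> is the symmetry behind Parseval's identity, which serves below both on
  the sphere and on the ball.  The \<open>\<sigma>\<close>-algebra of \<open>\<mu>\<close> may live on a subset of the space, whence the
  condition that the identity is measurable: it makes Borel functions \<open>\<mu>\<close>-measurable.
\<close>

definition circle_invariant :: "(complex ^ 'n) measure \<Rightarrow> bool" where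
  "circle_invariant \<mu> \<longleftrightarrow> finite_measure \<mu> \<and> (\<lambda>x. x) \<in> \<mu> \<rightarrow>\<^sub>M borel \<and>
     (\<forall>c. cmod c = 1 \<longrightarrow> (\<lambda>x. c *s x) \<in> \<mu> \<rightarrow>\<^sub>M \<mu> \<and> distr \<mu> \<mu> (\<lambda>x. c *s x) = \<mu>)"

lemma circle_invariant_integral:
  fixes f :: "complex ^ 'n \<Rightarrow> 'a :: {banach, second_countable_topology}"
  assumes "circle_invariant \<mu>" "cmod c = 1" "f \<in> borel_measurable \<mu>"
  shows "(\<integral>x. f (c *s x) \<partial>\<mu>) = (\<integral>x. f x \<partial>\<mu>)"
  using integral_distr[of "\<lambda>x. c *s x" \<mu> \<mu> f] assms by (auto simp: circle_invariant_def)

lemma circle_invariant_nn_integral: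
  assumes "circle_invariant \<mu>" "cmod c = 1" "f \<in> borel_measurable \<mu>"
  shows "(\<integral>\<^sup>+x. f (c *s x) \<partial>\<mu>) = (\<integral>\<^sup>+x. f x \<partial>\<mu>)"
  using nn_integral_distr[of "\<lambda>x. c *s x" \<mu> \<mu> f] assms by (auto simp: circle_invariant_def)

lemma circle_invariant_uniform_ball:
  assumes r: "0 < r"
  shows "circle_invariant (uniform_measure lborel (ball (0 :: complex ^ 'n) r))"
proof -
  let ?B = "ball (0 :: complex ^ 'n) r"
  let ?U = "uniform_measure lborel ?B"
  have "emeasure lborel ?B / emeasure lborel ?B = 1"
    using emeasure_ball_pos_finite[OF r, of 0] by (intro ennreal_divide_self) (auto simp: less_top)
  then have fin: "finite_measure ?U"
    by (intro finite_measureI) (simp add: emeasure_uniform_measure)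
  have "distr ?U ?U (\<lambda>x. c *s x) = ?U" if c: "cmod c = 1" for c
  proof (rule measure_eqI)
    fix A assume "A \<in> sets (distr ?U ?U (\<lambda>x. c *s x))"
    then have A[measurable]: "A \<in> sets borel" by simp
    have [measurable]: "(\<lambda>x. c *s x) -` A \<in> sets (borel :: (complex ^ 'n) measure)"
      using measurable_sets[of "\<lambda>x :: complex ^ 'n. c *s x" borel borel A] by simp
    have "emeasure (distr ?U ?U (\<lambda>x. c *s x)) A = emeasure ?U ((\<lambda>x. c *s x) -` A)"
      by (subst emeasure_distr) auto
    also have "\<dots> = emeasure lborel (?B \<inter> (\<lambda>x. c *s x) -` A) / emeasure lborel ?B"
      by (intro emeasure_uniform_measure) auto
    also have "?B \<inter> (\<lambda>x. c *s x) -` A = (\<lambda>x. c *s x) -` (?B \<inter> A)"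
      by (auto simp: norm_vector_smult c)
    also have "emeasure lborel \<dots> = emeasure (distr lborel borel (\<lambda>x. c *s x)) (?B \<inter> A)"
      by (subst emeasure_distr) auto
    also have "\<dots> / emeasure lborel ?B = emeasure ?U A"
      by (simp add: distr_lborel_smult[OF c])
    finally show "emeasure (distr ?U ?U (\<lambda>x. c *s x)) A = emeasure ?U A" .
  qed simp
  with fin show ?thesis
    by (auto simp: circle_invariant_def)
qed

lemma finite_measure_sphere: "finite_measure (sphere_measure :: (complex ^ 'n) measure)"
  by (rule finite_measureI) (simp add: emeasure_sphere_measure_sphere)

lemma borel_measurable_sphere_measureI:
  "f \<in> borel \<rightarrow>\<^sub>M N \<Longrightarrow> f \<in> (sphere_measure :: (complex ^ 'n) measure) \<rightarrow>\<^sub>M N"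
  unfolding measurable_cong_sets[OF sets_sphere_measure refl] by (rule measurable_restrict_space1)

lemma borel_measurable_sphere_measure_continuous:
  fixes f :: "complex ^ 'n \<Rightarrow> 'b :: topological_space"
  shows "continuous_on (sphere 0 1) f \<Longrightarrow> f \<in> borel_measurable sphere_measure"
  unfolding measurable_cong_sets[OF sets_sphere_measure refl]
  by (rule borel_measurable_continuous_on_restrict)

lemma sets_sphere_measure_iff:
  "A \<in> sets (sphere_measure :: (complex ^ 'n) measure) \<longleftrightarrow> A \<in> sets borel \<and> A \<subseteq> sphere 0 1"
  by (auto simp: sets_restrict_space_iff)

lemma sgn_smult: "cmod c = 1 \<Longrightarrow> sgn (c *s x) = c *s sgn (x :: complex ^ 'n)"
  by (simp add: sgn_div_norm norm_vector_smult vector_smult_scaleR)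

lemma smult_measurable_sphere [measurable]:
  assumes c: "cmod c = 1"
  shows "(\<lambda>x. c *s x) \<in> (sphere_measure :: (complex ^ 'n) measure) \<rightarrow>\<^sub>M sphere_measure"
  unfolding measurable_cong_sets[OF sets_sphere_measure sets_sphere_measure]
  by (rule measurable_restrict_space3) (auto simp: norm_vector_smult c)

lemma circle_invariant_sphere_measure: "circle_invariant (sphere_measure :: (complex ^ 'n) measure)"
proof -
  let ?B = "ball (0 :: complex ^ 'n) 1"
  have "distr sphere_measure sphere_measure (\<lambda>x. c *s x) = (sphere_measure :: (complex ^ 'n) measure)"
    if c: "cmod c = 1" for c
  proof (rule measure_eqI)
    fix A :: "(complex ^ 'n) set" assume "A \<in> sets (distr sphere_measure sphere_measure (\<lambda>x. c *s x))"
    then have A: "A \<in> sets borel" "A \<subseteq> sphere 0 1" by (auto simp: sets_restrict_space_iff)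
    note [measurable] = A(1)
    let ?A = "(\<lambda>x. c *s x) -` A"
    have A'[measurable]: "?A \<in> sets borel"
      using measurable_sets[of "\<lambda>x :: complex ^ 'n. c *s x" borel borel A] by simp
    have sub: "?A \<subseteq> sphere 0 1"
      using A(2) by (auto simp: norm_vector_smult c dest!: subsetD)
    have "emeasure (distr sphere_measure sphere_measure (\<lambda>x. c *s x)) A = emeasure sphere_measure (?A \<inter> sphere 0 1)"
      using smult_measurable_sphere[OF c] A by (subst emeasure_distr) (auto simp: sets_restrict_space_iff)
    also have "?A \<inter> sphere 0 1 = ?A" using sub by auto
    also have "emeasure sphere_measure ?A = emeasure lborel {x \<in> ?B. sgn x \<in> ?A} / emeasure lborel ?B"
      by (rule emeasure_sphere_measure[OF A' sub])
    also have "{x \<in> ?B. sgn x \<in> ?A} = (\<lambda>x. c *s x) -` {x \<in> ?B. sgn x \<in> A}"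
      by (auto simp: norm_vector_smult c sgn_smult)
    also have "emeasure lborel \<dots> = emeasure (distr lborel borel (\<lambda>x. c *s x)) {x \<in> ?B. sgn x \<in> A}"
    proof (subst emeasure_distr)
      have "{x \<in> ?B. sgn x \<in> A} = ?B \<inter> sgn -` A" by auto
      also have "\<dots> \<in> sets borel"
        using measurable_sets[OF borel_measurable_sgn_vec A(1)] by (intro sets.Int) auto
      finally show "{x \<in> ?B. sgn x \<in> A} \<in> sets borel" .
    qed auto
    also have "\<dots> / emeasure lborel ?B = emeasure sphere_measure A"
      unfolding distr_lborel_smult[OF c] by (rule emeasure_sphere_measure[OF A, symmetric])
    finally show "emeasure (distr sphere_measure sphere_measure (\<lambda>x. c *s x)) A = emeasure sphere_measure A" .
  qed simp
  then show ?thesis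
    by (auto simp: circle_invariant_def finite_measure_sphere borel_measurable_sphere_measureI)
qed

text \<open>
  Immediate from the description of the surface measure as a cone measure, up to the origin: there
  \<open>sgn\<close> leaves the sphere, but a point is a null set.
\<close>

lemma integral_sphere_measure_cone:
  fixes F :: "complex ^ 'n \<Rightarrow> 'a :: {banach, second_countable_topology}"
  assumes [measurable]: "F \<in> borel_measurable borel"
  shows "(\<integral>x. F x \<partial>sphere_measure) = (\<integral>x. F (sgn x) \<partial>uniform_measure lborel (ball 0 1))"
proof -
  let ?U = "uniform_measure lborel (ball (0 :: complex ^ 'n) 1)"
  define S where "S = sphere (0 :: complex ^ 'n) 1"
  have [measurable]: "S \<in> sets borel" by (simp add: S_def)
  have [measurable]: "(\<lambda>x. F (sgn x)) \<in> borel_measurable ?U"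
    "(\<lambda>x. indicator S (sgn x) *\<^sub>R F (sgn x)) \<in> borel_measurable ?U" "sgn \<in> borel_measurable ?U"
    unfolding measurable_cong_sets[OF sets_uniform_measure refl] by measurable
  have "(\<integral>x. F x \<partial>sphere_measure) = (\<integral>x. indicator S x *\<^sub>R F x \<partial>distr ?U borel sgn)"
    unfolding sphere_measure_def by (subst integral_restrict_space) (auto simp: S_def)
  also have "\<dots> = (\<integral>x. indicator S (sgn x) *\<^sub>R F (sgn x) \<partial>?U)"
    by (subst integral_distr) measurable
  also have "\<dots> = (\<integral>x. F (sgn x) \<partial>?U)"
  proof (rule integral_cong_AE)
    have "AE x in (lborel :: (complex ^ 'n) measure). x \<noteq> 0"
      by (rule AE_lborel_singleton)
    then have "AE x in ?U. x \<noteq> 0"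
      by (rule AE_uniform_measureI[rotated, OF AE_mp]) auto
    then show "AE x in ?U. indicator S (sgn x) *\<^sub>R F (sgn x) = F (sgn x)"
      by eventually_elim (auto simp: norm_sgn S_def)
  qed measurable
  finally show ?thesis .
qed

section \<open>Holomorphic functions of several variables and their homogeneous expansions\<close>

lemma holomorphic_fun_onD:
  assumes "holomorphic_fun_on h U" "z \<in> U"
  obtains D where "(h has_derivative D) (at z)" "\<And>c v. D (c *s v) = c * D v"
  using assms unfolding holomorphic_fun_on_def by blast

lemma holomorphic_fun_on_continuous_at: "holomorphic_fun_on h U \<Longrightarrow> z \<in> U \<Longrightarrow> isCont h z"
  by (metis holomorphic_fun_onD has_derivative_continuous)

lemma holomorphic_fun_on_imp_continuous_on: "holomorphic_fun_on h U \<Longrightarrow> continuous_on U h"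
  by (simp add: continuous_at_imp_continuous_on holomorphic_fun_on_continuous_at)

lemma holomorphic_fun_on_cong:
  assumes "holomorphic_fun_on h U" "open U" "\<And>z. z \<in> U \<Longrightarrow> h z = g z"
  shows "holomorphic_fun_on g U"
  unfolding holomorphic_fun_on_def
proof
  fix z assume z: "z \<in> U"
  obtain D where D: "(h has_derivative D) (at z)" "\<And>c v. D (c *s v) = c * D v"
    using holomorphic_fun_onD[OF assms(1) z] by blast
  from D(1) have "(g has_derivative D) (at z)"
    by (rule has_derivative_transform_within_open[OF _ assms(2) z]) (rule assms(3))
  with D show "\<exists>D. (g has_derivative D) (at z) \<and> (\<forall>c v. D (c *s v) = c * D v)" by blast
qed

lemma holomorphic_fun_on_const: "holomorphic_fun_on (\<lambda>_. c) U"
  unfolding holomorphic_fun_on_def by (intro ballI exI[of _ "\<lambda>_. 0"]) auto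

lemma holomorphic_fun_on_nth: "holomorphic_fun_on (\<lambda>z. z $ i) U"
  unfolding holomorphic_fun_on_def
  by (intro ballI exI[of _ "\<lambda>v. v $ i"]) (auto intro: bounded_linear_imp_has_derivative bounded_linear_vec_nth)

lemma holomorphic_fun_on_add:
  assumes "holomorphic_fun_on f U" "holomorphic_fun_on g U"
  shows "holomorphic_fun_on (\<lambda>z. f z + g z) U"
  unfolding holomorphic_fun_on_def
proof
  fix z assume z: "z \<in> U"
  obtain D where D: "(f has_derivative D) (at z)" "\<And>c v. D (c *s v) = c * D v"
    using holomorphic_fun_onD[OF assms(1) z] by blast
  obtain E where E: "(g has_derivative E) (at z)" "\<And>c v. E (c *s v) = c * E v"
    using holomorphic_fun_onD[OF assms(2) z] by blast
  show "\<exists>D. ((\<lambda>z. f z + g z) has_derivative D) (at z) \<and> (\<forall>c v. D (c *s v) = c * D v)"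
    using D E by (intro exI[of _ "\<lambda>v. D v + E v"]) (auto intro!: has_derivative_add simp: algebra_simps)
qed

lemma holomorphic_fun_on_mult:
  assumes "holomorphic_fun_on f U" "holomorphic_fun_on g U"
  shows "holomorphic_fun_on (\<lambda>z. f z * g z) U"
  unfolding holomorphic_fun_on_def
proof
  fix z assume z: "z \<in> U"
  obtain D where D: "(f has_derivative D) (at z)" "\<And>c v. D (c *s v) = c * D v"
    using holomorphic_fun_onD[OF assms(1) z] by blast
  obtain E where E: "(g has_derivative E) (at z)" "\<And>c v. E (c *s v) = c * E v"
    using holomorphic_fun_onD[OF assms(2) z] by blast
  show "\<exists>D. ((\<lambda>z. f z * g z) has_derivative D) (at z) \<and> (\<forall>c v. D (c *s v) = c * D v)"
    using has_derivative_mult[OF D(1) E(1)] D E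
    by (intro exI[of _ "\<lambda>v. f z * E v + D v * g z"]) (simp add: algebra_simps)
qed

lemma holomorphic_fun_on_cmult: "holomorphic_fun_on f U \<Longrightarrow> holomorphic_fun_on (\<lambda>z. c * f z) U"
  by (intro holomorphic_fun_on_mult holomorphic_fun_on_const)

lemma holomorphic_fun_on_lincomb:
  "holomorphic_fun_on f U \<Longrightarrow> holomorphic_fun_on g U \<Longrightarrow> holomorphic_fun_on (\<lambda>z. a * f z + b * g z) U"
  by (intro holomorphic_fun_on_add holomorphic_fun_on_cmult)

lemma holomorphic_fun_on_affine:
  assumes "holomorphic_fun_on f U" "\<And>z. z \<in> V \<Longrightarrow> a + c *s z \<in> U"
  shows "holomorphic_fun_on (\<lambda>z. f (a + c *s z)) V"
  unfolding holomorphic_fun_on_def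
proof
  fix z assume z: "z \<in> V"
  obtain D where D: "(f has_derivative D) (at (a + c *s z))" "\<And>c v. D (c *s v) = c * D v"
    using holomorphic_fun_onD[OF assms(1) assms(2)[OF z]] by blast
  have "((\<lambda>z. a + c *s z) has_derivative (\<lambda>v. c *s v)) (at z)"
    by (auto intro!: derivative_eq_intros bounded_linear_imp_has_derivative bounded_linear_smult_right)
  from has_derivative_compose[OF this D(1)]
  have "((\<lambda>z. f (a + c *s z)) has_derivative (\<lambda>v. D (c *s v))) (at z)" .
  then show "\<exists>D. ((\<lambda>z. f (a + c *s z)) has_derivative D) (at z) \<and> (\<forall>c v. D (c *s v) = c * D v)"
    using D(2) by (intro exI[of _ "\<lambda>v. D (c *s v)"]) (auto simp: algebra_simps)
qed

lemma slice_has_field_derivative: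
  fixes a b :: "complex ^ 'n"
  assumes "(h has_derivative D) (at (a + l *s b))" "\<And>c v. D (c *s v) = c * D v"
  shows "((\<lambda>l. h (a + l *s b)) has_field_derivative D b) (at l)"
proof -
  have "((\<lambda>l. a + l *s b) has_derivative (\<lambda>l. l *s b)) (at l)"
    using has_derivative_add[OF has_derivative_const[of a] bounded_linear_imp_has_derivative[OF bounded_linear_smult_left[of b]]]
    by simp
  from has_derivative_compose[OF this assms(1)]
  have "((\<lambda>l. h (a + l *s b)) has_derivative (\<lambda>l. D (l *s b))) (at l)" .
  moreover have "(\<lambda>l. D (l *s b)) = (*) (D b)" by (auto simp: assms(2) mult.commute)
  ultimately show ?thesis by (simp add: has_field_derivative_def)
qed

lemma open_slice: "open U \<Longrightarrow> open {l. a + l *s b \<in> U}" for U :: "(complex ^ 'n) set"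
  by (rule open_vimage[unfolded vimage_def]) (auto intro!: continuous_intros)

lemma slice_holomorphic:
  assumes "holomorphic_fun_on h U" "open U"
  shows "(\<lambda>l. h (a + l *s b)) holomorphic_on {l. a + l *s b \<in> U}"
  unfolding holomorphic_on_def
proof
  fix l assume "l \<in> {l. a + l *s b \<in> U}"
  then have l: "a + l *s b \<in> U" by simp
  obtain D where "(h has_derivative D) (at (a + l *s b))" "\<And>c v. D (c *s v) = c * D v"
    using holomorphic_fun_onD[OF assms(1) l] by blast
  from slice_has_field_derivative[OF this]
  show "(\<lambda>l. h (a + l *s b)) field_differentiable at l within {l. a + l *s b \<in> U}"
    using field_differentiable_at_within field_differentiable_def by blast
qed

text \<open>
  The homogeneous component of degree \<open>k\<close> of the expansion at the origin, obtained as a Taylor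
  coefficient of the restriction of \<open>h\<close> to the complex line through \<open>z\<close>; this dispenses with
  multi-indices.
\<close>

definition hcoeff :: "(complex ^ 'n \<Rightarrow> complex) \<Rightarrow> nat \<Rightarrow> complex ^ 'n \<Rightarrow> complex" where
  "hcoeff h k z = (deriv ^^ k) (\<lambda>l. h (l *s z)) 0 / fact k"

lemma central_slice_holomorphic:
  assumes "holomorphic_fun_on h (ball 0 R)"
  shows "(\<lambda>l. h (l *s b)) holomorphic_on {l. l *s b \<in> ball 0 R}"
  using slice_holomorphic[OF assms open_ball, of 0 b] by simp

lemma open_central_slice: "open {l. l *s b \<in> ball 0 R}" for b :: "complex ^ 'n"
  using open_slice[OF open_ball, of 0 b 0 R] by simp

lemma hcoeff_sums:
  assumes h: "holomorphic_fun_on h (ball 0 R)" and w: "cmod w * norm z < R"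
  shows "(\<lambda>k. hcoeff h k z * w ^ k) sums h (w *s z)"
proof -
  obtain r where r: "cmod w < r" "r * norm z \<le> R"
  proof (cases "z = 0")
    case True
    then show ?thesis using w that[of "cmod w + 1"] by auto
  next
    case False
    then show ?thesis using w that[of "R / norm z"] by (auto simp: field_simps)
  qed
  have "ball 0 r \<subseteq> {l. l *s z \<in> ball 0 R}"
  proof
    fix l assume l: "l \<in> ball (0 :: complex) r"
    show "l \<in> {l. l *s z \<in> ball 0 R}"
    proof (cases "z = 0")
      case True then show ?thesis using w by auto
    next
      case False
      then have "cmod l * norm z < r * norm z" using l by auto
      with r show ?thesis by (simp add: norm_vector_smult)
    qed
  qed
  from holomorphic_on_subset[OF central_slice_holomorphic[OF h] this]
  have "(\<lambda>k. (deriv ^^ k) (\<lambda>l. h (l *s z)) 0 / fact k * (w - 0) ^ k) sums h (w *s z)"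
    by (rule holomorphic_power_series) (use r in auto)
  then show ?thesis by (simp add: hcoeff_def)
qed

lemma hcoeff_sums_1:
  assumes h: "holomorphic_fun_on h (ball 0 R)" and z: "norm z < R"
  shows "(\<lambda>k. hcoeff h k z) sums h z"
  using hcoeff_sums[OF h, of 1 z] z by simp

lemma hcoeff_smult:
  assumes h: "holomorphic_fun_on h (ball 0 R)" and R: "R > 0"
  shows "hcoeff h k (c *s z) = c ^ k * hcoeff h k z"
proof -
  have "(deriv ^^ k) (\<lambda>w. (\<lambda>l. h (l *s z)) (c * w)) 0 = c ^ k * (deriv ^^ k) (\<lambda>l. h (l *s z)) (c * 0)"
    by (rule higher_deriv_compose_linear[OF central_slice_holomorphic[OF h] open_central_slice[of "c *s z" R] open_central_slice])
       (use R in \<open>auto simp: vector_smult_assoc_complex mult.commute\<close>)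
  then show ?thesis by (simp add: hcoeff_def vector_smult_assoc_complex mult.commute)
qed

lemma hcoeff_dilate:
  "hcoeff (\<lambda>z. h (c *s z)) k z = hcoeff h k (c *s z)"
  by (simp add: hcoeff_def vector_smult_assoc_complex mult.commute)

lemma hcoeff_bound:
  assumes h: "holomorphic_fun_on h (ball 0 R)" and \<rho>: "0 < \<rho>" "\<rho> * norm z < R"
    and B: "\<And>l. cmod l = \<rho> \<Longrightarrow> cmod (h (l *s z)) \<le> B"
  shows "cmod (hcoeff h k z) \<le> B / \<rho> ^ k"
proof -
  have sub: "cball 0 \<rho> \<subseteq> {l. l *s z \<in> ball 0 R}"
    using \<rho> by (auto simp: norm_vector_smult) (meson le_less_trans mult_right_mono norm_ge_zero)
  have hol: "(\<lambda>l. h (l *s z)) holomorphic_on cball 0 \<rho>"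
    by (rule holomorphic_on_subset[OF central_slice_holomorphic[OF h] sub])
  have "cmod ((deriv ^^ k) (\<lambda>l. h (l *s z)) 0) \<le> fact k * B / \<rho> ^ k"
    by (rule Cauchy_inequality)
       (use hol \<rho> B in \<open>auto intro: holomorphic_on_subset holomorphic_on_imp_continuous_on\<close>)
  then show ?thesis by (simp add: hcoeff_def norm_divide field_simps)
qed

text \<open>
  A Taylor coefficient of a slice is the limit of difference quotients that involve \<open>h\<close> and the
  coefficients of lower degree, so measurability is inherited from degree to degree.
\<close>

lemma hcoeff_measurable:
  fixes h :: "complex ^ 'n \<Rightarrow> complex"
  assumes h: "holomorphic_fun_on h (ball 0 R)" and R: "R > 0"
  shows "hcoeff h k \<in> borel_measurable borel"
proof (induction k rule: less_induct)
  case (less k)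
  \<comment> \<open>the quotients below are evaluated on the whole space, hence the extension by zero\<close>
  define G where "G z = (if z \<in> ball 0 R then h z else 0)" for z
  have G[measurable]: "G \<in> borel_measurable borel"
    unfolding G_def[abs_def]
    by (rule borel_measurable_continuous_on_if) (use holomorphic_fun_on_imp_continuous_on[OF h] in auto)
  define F where "F m z = (G (z /\<^sub>R real (Suc m)) - (\<Sum>j<k. hcoeff h j z / of_nat (Suc m) ^ j)) * of_nat (Suc m) ^ k" for m z
  have F[measurable]: "F m \<in> borel_measurable borel" for m
    unfolding F_def[abs_def] using less.IH[THEN measurable_compose[of "\<lambda>x. x", rotated]]
    by (intro borel_measurable_times borel_measurable_diff borel_measurable_sum borel_measurable_divide)
       (auto)
  show ?case
  proof (rule borel_measurable_LIMSEQ_metric[where f = F])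
    fix z :: "complex ^ 'n"
    define s where "s = R / (norm z + 1)"
    have s: "s > 0" using R by (auto simp: s_def add_nonneg_pos)
    have small: "cmod w * norm z < R" if "cmod w < s" for w
    proof -
      have "cmod w * norm z \<le> cmod w * (norm z + 1)" by (simp add: mult_left_mono)
      also have "\<dots> < R" using that by (simp add: s_def pos_less_divide_eq add_nonneg_pos)
      finally show ?thesis .
    qed
    define f where "f w = (h (w *s z) - (\<Sum>j<k. hcoeff h j z * w ^ j)) / w ^ k" for w
    have "(\<lambda>n. hcoeff h (n + k) z * w ^ n) sums f w" if w: "cmod w < s" "w \<noteq> 0" for w
    proof -
      have "(\<lambda>n. hcoeff h n z * w ^ n) sums h (w *s z)"
        by (rule hcoeff_sums[OF h small[OF w(1)]])
      then have "(\<lambda>n. hcoeff h (n + k) z * w ^ (n + k)) sums (h (w *s z) - (\<Sum>j<k. hcoeff h j z * w ^ j))"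
        by (rule sums_split_initial_segment)
      from sums_divide[OF this, of "w ^ k"] show ?thesis
        using w by (simp add: f_def power_add)
    qed
    then have "(f \<longlongrightarrow> hcoeff h (0 + k) z) (at 0)"
      by (intro powser_limit_0_strong[OF s, where a = "\<lambda>n. hcoeff h (n + k) z"]) auto
    moreover have inv: "filterlim (\<lambda>m. 1 / of_nat (Suc m) :: complex) (at 0) sequentially"
      unfolding filterlim_at using lim_1_over_n[where 'a = complex, THEN LIMSEQ_Suc] by (auto simp del: of_nat_Suc)
    ultimately have lim: "(\<lambda>m. f (1 / of_nat (Suc m))) \<longlonglongrightarrow> hcoeff h k z"
      using filterlim_compose by fastforce
    have "eventually (\<lambda>m. cmod (1 / of_nat (Suc m)) < s) sequentially"
      using inv s unfolding filterlim_at by (auto dest!: tendstoD[of _ _ _ s])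
    then have "eventually (\<lambda>m. f (1 / of_nat (Suc m)) = F m z) sequentially"
    proof eventually_elim
      case (elim m)
      have e: "(1 / of_nat (Suc m)) *s z = z /\<^sub>R real (Suc m)"
        by (simp add: vec_eq_iff scaleR_conv_of_real[where 'a = complex] divide_inverse)
      show ?case
        using small[OF elim] unfolding f_def F_def e
        by (simp add: G_def norm_divide power_divide divide_inverse mult.commute norm_inverse del: of_nat_Suc flip: power_inverse)
    qed
    from Lim_transform_eventually[OF lim this] show "(\<lambda>m. F m z) \<longlonglongrightarrow> hcoeff h k z" .
  qed measurable
qed

lemma borel_measurable_cnj [measurable]: "f \<in> borel_measurable M \<Longrightarrow> (\<lambda>x. cnj (f x)) \<in> borel_measurable M"
  by (rule measurable_compose[OF _ borel_measurable_continuous_onI[OF continuous_on_cnj[OF continuous_on_id]]])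

lemma (in finite_measure) sums_integral_dominated:
  fixes f :: "nat \<Rightarrow> 'a \<Rightarrow> complex"
  assumes [measurable]: "\<And>i. f i \<in> borel_measurable M" "F \<in> borel_measurable M"
    and B: "AE x in M. \<forall>i. cmod (f i x) \<le> B i" "summable B"
    and F: "AE x in M. (\<lambda>i. f i x) sums F x"
  shows "(\<lambda>i. \<integral>x. f i x \<partial>M) sums (\<integral>x. F x \<partial>M)"
proof -
  have int: "integrable M (f i)" for i
    by (rule integrable_const_bound[where B = "B i"]) (use B(1) in \<open>auto elim: eventually_mono\<close>)
  have "(\<lambda>i. \<integral>x. f i x \<partial>M) sums (\<integral>x. (\<Sum>i. f i x) \<partial>M)"
  proof (rule sums_integral)
    show "AE x in M. summable (\<lambda>i. norm (f i x))"
      using B(1) by eventually_elim (rule summable_comparison_test'[OF B(2)], simp)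
    show "summable (\<lambda>i. \<integral>x. norm (f i x) \<partial>M)"
    proof (rule summable_comparison_test')
      show "summable (\<lambda>i. B i * measure M (space M))"
        by (intro summable_mult2 B(2))
      fix i
      have "(\<integral>x. norm (f i x) \<partial>M) \<le> (\<integral>x. B i \<partial>M)"
        by (rule integral_mono_AE) (use B(1) int in \<open>auto elim: eventually_mono\<close>)
      then show "norm (\<integral>x. norm (f i x) \<partial>M) \<le> B i * measure M (space M)"
        by (simp add: mult.commute)
    qed
  qed (fact int)
  also have "(\<integral>x. (\<Sum>i. f i x) \<partial>M) = (\<integral>x. F x \<partial>M)"
    by (rule integral_cong_AE) (use F in \<open>auto elim!: eventually_mono simp: sums_unique[symmetric]\<close>)
  finally show ?thesis .
qed

lemma cis_orthogonal_phase:
  assumes "k \<noteq> (l :: nat)"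
  obtains c where "cmod c = 1" "c ^ k * cnj c ^ l = -1"
proof
  let ?t = "pi / (real k - real l)"
  show "cmod (cis ?t) = 1" by simp
  have "cis ?t ^ k * cnj (cis ?t) ^ l = cis (real k * ?t - real l * ?t)"
    by (simp add: Complex.DeMoivre cis_cnj cis_mult)
  also have "real k * ?t - real l * ?t = pi"
    unfolding left_diff_distrib[symmetric] using assms by simp
  finally show "cis ?t ^ k * cnj (cis ?t) ^ l = -1" by simp
qed

text \<open>
  Homogeneous components of different degree are orthogonal, because a rotation multiplies their
  inner product by a number that can be made \<open>-1\<close>.
\<close>

lemma hcoeff_orthogonal:
  assumes ci: "circle_invariant \<mu>" and R: "R > 0"
    and g: "holomorphic_fun_on g (ball 0 R)" and h: "holomorphic_fun_on h (ball 0 R)"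
    and kl: "k \<noteq> l"
  shows "(\<integral>x. hcoeff g k x * cnj (hcoeff h l x) \<partial>\<mu>) = 0"
proof -
  obtain c where c: "cmod c = 1" "c ^ k * cnj c ^ l = -1"
    using cis_orthogonal_phase[OF kl] by blast
  have id: "(\<lambda>x. x) \<in> \<mu> \<rightarrow>\<^sub>M borel" using ci by (simp add: circle_invariant_def)
  have [measurable]: "hcoeff g k \<in> borel_measurable \<mu>" "hcoeff h l \<in> borel_measurable \<mu>"
    using measurable_compose[OF id hcoeff_measurable[OF g R]] measurable_compose[OF id hcoeff_measurable[OF h R]] by auto
  have "(\<integral>x. hcoeff g k x * cnj (hcoeff h l x) \<partial>\<mu>) = (\<integral>x. hcoeff g k (c *s x) * cnj (hcoeff h l (c *s x)) \<partial>\<mu>)"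
    by (rule circle_invariant_integral[OF ci c(1), symmetric]) measurable
  also have "\<dots> = (\<integral>x. (c ^ k * cnj c ^ l) * (hcoeff g k x * cnj (hcoeff h l x)) \<partial>\<mu>)"
    by (simp add: hcoeff_smult[OF g R] hcoeff_smult[OF h R] mult_ac)
  also have "\<dots> = - (\<integral>x. hcoeff g k x * cnj (hcoeff h l x) \<partial>\<mu>)"
    by (simp add: c(2))
  finally show ?thesis by (simp add: equal_neg_zero)
qed

text \<open>
  Cauchy's estimate, with one constant for all slices.  For \<open>\<rho> > 1\<close> the homogeneous expansion is
  dominated on the ball of radius \<open>s\<close> by a convergent geometric series.
\<close>

lemma hcoeff_geometric_bound:
  fixes h :: "complex ^ 'n \<Rightarrow> complex"
  assumes h: "holomorphic_fun_on h (ball 0 R)" and \<rho>: "0 < \<rho>" "\<rho> * s < R"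
  obtains B where "B \<ge> 0" "\<And>x k. norm x \<le> s \<Longrightarrow> cmod (hcoeff h k x) \<le> B / \<rho> ^ k"
proof -
  have "cball 0 (\<rho> * s) \<subseteq> ball (0 :: complex ^ 'n) R" using \<rho> by auto
  then have "compact (h ` cball 0 (\<rho> * s))"
    by (intro compact_continuous_image continuous_on_subset[OF holomorphic_fun_on_imp_continuous_on[OF h]]) auto
  then obtain B where B: "B > 0" "\<And>x. x \<in> cball 0 (\<rho> * s) \<Longrightarrow> cmod (h x) \<le> B"
    using compact_imp_bounded[THEN bounded_pos[THEN iffD1]] by (metis imageI)
  have "cmod (hcoeff h k x) \<le> B / \<rho> ^ k" if x: "norm x \<le> s" for x k
  proof (rule hcoeff_bound[OF h \<rho>(1)])
    have le: "\<rho> * norm x \<le> \<rho> * s" using x \<rho> by simp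
    then show "\<rho> * norm x < R" using \<rho>(2) by linarith
    show "cmod (h (l *s x)) \<le> B" if "cmod l = \<rho>" for l
      using le that by (intro B(2)) (simp add: norm_vector_smult)
  qed
  with B(1) show ?thesis by (intro that[of B]) auto
qed

text \<open>
  Components of different degree are orthogonal, and the geometric bound for some \<open>\<rho> > 1\<close> allows
  both expansions to be integrated term by term, first that of \<open>h\<close> against a fixed component of \<open>g\<close>
  and then that of \<open>g\<close>.
\<close>

lemma parseval:
  fixes g h :: "complex ^ 'n \<Rightarrow> complex"
  assumes ci: "circle_invariant \<mu>" and s: "0 \<le> s" "s < R" and AE_s: "AE x in \<mu>. norm x \<le> s"
    and g: "holomorphic_fun_on g (ball 0 R)" and h: "holomorphic_fun_on h (ball 0 R)"
    and [measurable]: "g \<in> borel_measurable \<mu>" "h \<in> borel_measurable \<mu>"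
  shows "(\<lambda>k. \<integral>x. hcoeff g k x * cnj (hcoeff h k x) \<partial>\<mu>) sums (\<integral>x. g x * cnj (h x) \<partial>\<mu>)"
proof -
  interpret finite_measure \<mu> using ci by (simp add: circle_invariant_def)
  have R: "R > 0" using s by linarith
  have id: "(\<lambda>x. x) \<in> \<mu> \<rightarrow>\<^sub>M borel" using ci by (simp add: circle_invariant_def)
  have [measurable]: "hcoeff g k \<in> borel_measurable \<mu>" "hcoeff h k \<in> borel_measurable \<mu>" for k
    using measurable_compose[OF id hcoeff_measurable[OF g R]] measurable_compose[OF id hcoeff_measurable[OF h R]] by auto
  obtain \<rho> where \<rho>: "1 < \<rho>" "\<rho> * s < R"
  proof (cases "s = 0")
    case True then show ?thesis using R that[of 2] by auto
  next
    case False
    then obtain t where "1 < t" "t < R / s" using dense[of 1 "R / s"] s by (auto simp: less_divide_eq)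
    then show ?thesis using False s by (intro that[of t]) (auto simp: field_simps)
  qed
  have \<rho>0: "0 < \<rho>" using \<rho> by simp
  obtain A where A: "A \<ge> 0" "\<And>x k. norm x \<le> s \<Longrightarrow> cmod (hcoeff g k x) \<le> A / \<rho> ^ k"
    using hcoeff_geometric_bound[OF g \<rho>0 \<rho>(2)] by blast
  obtain B where B: "B \<ge> 0" "\<And>x k. norm x \<le> s \<Longrightarrow> cmod (hcoeff h k x) \<le> B / \<rho> ^ k"
    using hcoeff_geometric_bound[OF h \<rho>0 \<rho>(2)] by blast
  have \<rho>1: "X / \<rho> ^ k \<le> X" if "X \<ge> 0" for X k
    using divide_left_mono[of 1 "\<rho> ^ k" X] that \<rho> by (simp add: one_le_power)
  have sum: "summable (\<lambda>k. X / \<rho> ^ k)" for X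
    using summable_mult[OF summable_geometric[of "1 / \<rho>"], of X] \<rho> by (simp add: power_divide)
  have hb: "cmod (h x) \<le> (\<Sum>k. B / \<rho> ^ k)" if "norm x \<le> s" for x
  proof -
    have "(\<lambda>k. hcoeff h k x) sums h x" using hcoeff_sums_1[OF h] that s by simp
    then have "h x = (\<Sum>k. hcoeff h k x)" by (simp add: sums_iff)
    also have "cmod \<dots> \<le> (\<Sum>k. B / \<rho> ^ k)"
      by (rule norm_suminf_le) (use B that sum in auto)
    finally show ?thesis .
  qed
  \<comment> \<open>only the component of degree \<open>k\<close> of \<open>h\<close> contributes\<close>
  have step1: "(\<integral>x. hcoeff g k x * cnj (h x) \<partial>\<mu>) = (\<integral>x. hcoeff g k x * cnj (hcoeff h k x) \<partial>\<mu>)" for k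
  proof -
    have "(\<lambda>l. \<integral>x. hcoeff g k x * cnj (hcoeff h l x) \<partial>\<mu>) sums (\<integral>x. hcoeff g k x * cnj (h x) \<partial>\<mu>)"
    proof (rule sums_integral_dominated[where B = "\<lambda>l. A * (B / \<rho> ^ l)"])
      show "AE x in \<mu>. \<forall>l. cmod (hcoeff g k x * cnj (hcoeff h l x)) \<le> A * (B / \<rho> ^ l)"
        using AE_s
      proof eventually_elim
        case (elim x)
        show ?case
          using order_trans[OF A(2)[OF elim, of k] \<rho>1[OF A(1), of k]] B(2)[OF elim] A(1)
          by (simp only: norm_mult complex_mod_cnj) (intro allI mult_mono, auto)
      qed
      show "AE x in \<mu>. (\<lambda>l. hcoeff g k x * cnj (hcoeff h l x)) sums (hcoeff g k x * cnj (h x))"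
        using AE_s by eventually_elim (intro sums_mult sums_cnj[THEN iffD2] hcoeff_sums_1[OF h], use s in simp)
    qed (use summable_mult[OF sum] in auto)
    moreover have "(\<lambda>l. \<integral>x. hcoeff g k x * cnj (hcoeff h l x) \<partial>\<mu>) =
        (\<lambda>l. if l = k then \<integral>x. hcoeff g k x * cnj (hcoeff h k x) \<partial>\<mu> else 0)"
      using hcoeff_orthogonal[OF ci R g h] by auto
    ultimately show ?thesis
      using sums_unique2[OF _ sums_single[of k "\<lambda>_. \<integral>x. hcoeff g k x * cnj (hcoeff h k x) \<partial>\<mu>"]] by auto
  qed
  have "(\<lambda>k. \<integral>x. hcoeff g k x * cnj (h x) \<partial>\<mu>) sums (\<integral>x. g x * cnj (h x) \<partial>\<mu>)"
  proof (rule sums_integral_dominated[where B = "\<lambda>k. A / \<rho> ^ k * (\<Sum>k. B / \<rho> ^ k)"])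
    show "AE x in \<mu>. \<forall>k. cmod (hcoeff g k x * cnj (h x)) \<le> A / \<rho> ^ k * (\<Sum>k. B / \<rho> ^ k)"
      using AE_s
    proof eventually_elim
      case (elim x)
      show ?case
        using A(2)[OF elim] hb[OF elim] A(1) \<rho>0
        by (simp only: norm_mult complex_mod_cnj) (intro allI mult_mono, auto)
    qed
    show "AE x in \<mu>. (\<lambda>k. hcoeff g k x * cnj (h x)) sums (g x * cnj (h x))"
      using AE_s by eventually_elim (intro sums_mult2 hcoeff_sums_1[OF g], use s in simp)
  qed (use summable_mult2[OF sum] in auto)
  then show ?thesis by (simp add: step1)
qed

lemma parseval_norm:
  fixes h :: "complex ^ 'n \<Rightarrow> complex"
  assumes ci: "circle_invariant \<mu>" and s: "0 \<le> s" "s < R" and AE_s: "AE x in \<mu>. norm x \<le> s"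
    and h: "holomorphic_fun_on h (ball 0 R)" and m: "h \<in> borel_measurable \<mu>"
  shows "(\<lambda>k. \<integral>x. (cmod (hcoeff h k x))\<^sup>2 \<partial>\<mu>) sums (\<integral>x. (cmod (h x))\<^sup>2 \<partial>\<mu>)"
proof -
  have sq: "(\<lambda>x. f x * cnj (f x)) = (\<lambda>x. complex_of_real ((cmod (f x))\<^sup>2))" for f :: "complex ^ 'n \<Rightarrow> complex"
    by (simp only: complex_norm_square)
  from parseval[OF ci s AE_s h h m m]
  have "(\<lambda>k. complex_of_real (\<integral>x. (cmod (hcoeff h k x))\<^sup>2 \<partial>\<mu>)) sums complex_of_real (\<integral>x. (cmod (h x))\<^sup>2 \<partial>\<mu>)"
    by (simp add: sq integral_complex_of_real del: of_real_power)
  then show ?thesis by (simp only: sums_of_real_iff)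
qed

section \<open>Poisson integrals and averages over arcs\<close>

definition poisson :: "real \<Rightarrow> real \<Rightarrow> real" where
  "poisson r s = (1 - r\<^sup>2) / (1 - 2 * r * cos s + r\<^sup>2)"

lemma poisson_denominator_pos:
  fixes r s :: real
  assumes "0 \<le> r" "r < 1"
  shows "0 < 1 - 2 * r * cos s + r\<^sup>2"
proof -
  have "2 * r * cos s \<le> 2 * r * 1" using assms by (intro mult_left_mono) auto
  moreover have "0 < (1 - r)\<^sup>2" using assms by simp
  ultimately show ?thesis unfolding power2_diff by simp
qed

lemma poisson_nonneg: "0 \<le> r \<Longrightarrow> r < 1 \<Longrightarrow> 0 \<le> poisson r s"
  using poisson_denominator_pos[of r s] by (simp add: poisson_def abs_square_le_1)

lemma poisson_decreasing:
  assumes r: "0 \<le> r" "r < 1" and s: "0 \<le> s" "s \<le> t" "t \<le> pi"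
  shows "poisson r t \<le> poisson r s"
proof -
  have "cos t \<le> cos s" using s by (intro cos_monotone_0_pi_le) auto
  then have "2 * r * cos t \<le> 2 * r * cos s" using r by (intro mult_left_mono) auto
  then show ?thesis
    unfolding poisson_def using poisson_denominator_pos[OF r, of s] r
    by (intro divide_left_mono) (auto simp: abs_square_le_1 poisson_denominator_pos)
qed

lemma continuous_on_poisson: "0 \<le> r \<Longrightarrow> r < 1 \<Longrightarrow> continuous_on A (poisson r)"
  unfolding poisson_def using poisson_denominator_pos[of r]
  by (intro continuous_intros) (metis less_irrefl)

text \<open>
  The Poisson formula is Cauchy's formula at the point \<open>r\<close> for the function
  \<open>F z (1 - r\<^sup>2) / (1 - r z)\<close>, which has the value \<open>F r\<close> there.
\<close>

lemma poisson_formula: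
  assumes F: "F holomorphic_on ball 0 R" "R > 1" and r: "0 \<le> r" "r < 1"
  shows "((\<lambda>s. F (cis s) * of_real (poisson r s)) has_integral 2 * of_real pi * F (of_real r)) {0..2 * pi}"
proof -
  define G where "G z = F z * ((1 - of_real r ^ 2) / (1 - of_real r * z))" for z :: complex
  have nz: "1 - of_real r * z \<noteq> 0" if "z \<in> cball 0 1" for z :: complex
  proof
    assume "1 - of_real r * z = 0"
    then have "cmod (of_real r * z) = 1" by simp
    moreover have "cmod (of_real r * z) \<le> r"
      using that r by (simp add: norm_mult mult_left_le)
    ultimately show False using r by simp
  qed
  have holF: "F holomorphic_on cball 0 1" by (rule holomorphic_on_subset[OF F(1)]) (use F(2) in auto)
  have holG: "G holomorphic_on cball 0 1"
    unfolding G_def[abs_def] by (intro holomorphic_intros holF nz)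
  have "((\<lambda>u. G u / (u - of_real r)) has_contour_integral (2 * of_real pi * \<i> * G (of_real r))) (circlepath 0 1)"
    by (rule Cauchy_integral_circlepath)
       (use r in \<open>auto intro!: holomorphic_on_imp_continuous_on holG holomorphic_on_subset[OF holG]\<close>)
  then have "((\<lambda>t. G (cis t) / (cis t - of_real r) * \<i> * cis t) has_integral (2 * of_real pi * \<i> * G (of_real r))) {0..2 * pi}"
    unfolding circlepath_def by (subst (asm) has_contour_integral_part_circlepath_iff) auto
  then have "((\<lambda>t. - \<i> * (G (cis t) / (cis t - of_real r) * \<i> * cis t)) has_integral (- \<i> * (2 * of_real pi * \<i> * G (of_real r)))) {0..2 * pi}"
    by (rule has_integral_mult_right)
  moreover have "- \<i> * (G (cis t) / (cis t - of_real r) * \<i> * cis t) = F (cis t) * of_real (poisson r t)" for t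
  proof -
    have "complex_of_real (1 - 2 * r * cos t + r\<^sup>2) * cis t = (1 - of_real r * cis t) * (cis t - of_real r)"
      by (auto simp: complex_eq_iff algebra_simps power2_eq_square)
        (simp add: sin_squared_eq flip: power2_eq_square, simp add: algebra_simps power2_eq_square)+
    moreover have "complex_of_real (1 - 2 * r * cos t + r\<^sup>2) \<noteq> 0"
      using poisson_denominator_pos[OF r, of t] by (metis less_irrefl of_real_eq_0_iff)
    ultimately have "(1 - of_real r ^ 2) / (1 - of_real r * cis t) / (cis t - of_real r) * cis t = (1 - of_real r ^ 2) / complex_of_real (1 - 2 * r * cos t + r\<^sup>2)"
      by (metis cis_neq_zero divide_divide_eq_left' mult_divide_mult_cancel_right mult.commute times_divide_eq_left)
    note eq = this
    have "G (cis t) / (cis t - of_real r) * cis t = F (cis t) * ((1 - of_real r ^ 2) / (1 - of_real r * cis t) / (cis t - of_real r) * cis t)"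
      by (simp add: G_def)
    also have "\<dots> = F (cis t) * of_real (poisson r t)"
      unfolding eq by (simp add: poisson_def)
    finally have "G (cis t) / (cis t - of_real r) * cis t = F (cis t) * of_real (poisson r t)" .
    moreover have "- \<i> * (a * \<i> * b) = a * b" for a b :: complex
      by (simp add: complex_eq_iff)
    ultimately show ?thesis by (simp only:)
  qed
  moreover have "- \<i> * (2 * of_real pi * \<i> * G (of_real r)) = 2 * of_real pi * F (of_real r)"
  proof -
    have "r * r < 1" using r by (metis mult_left_le mult_less_cancel_left2 less_eq_real_def mult_zero_left not_less order_le_less_trans)
    then have "(1 :: complex) - of_real r ^ 2 \<noteq> 0"
      by (metis eq_iff_diff_eq_0 of_real_1 of_real_eq_iff of_real_power power2_eq_square less_irrefl)
    then show ?thesis by (simp add: G_def power2_eq_square)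
  qed
  ultimately show ?thesis by (simp only:)
qed

lemma poisson_integral:
  assumes "0 \<le> r" "r < 1"
  shows "(poisson r has_integral 2 * pi) {0..2 * pi}"
proof -
  have "((\<lambda>s. 1 * complex_of_real (poisson r s)) has_integral 2 * of_real pi * 1) {0..2 * pi}"
    by (rule poisson_formula[of "\<lambda>_. 1" 2]) (use assms in auto)
  from has_integral_linear[OF this bounded_linear_Re] show ?thesis by (simp add: o_def)
qed

text \<open>
  By the second mean value theorem, integrating against a decreasing weight amounts to averaging
  over initial intervals.
\<close>

lemma decreasing_weight_integral_le:
  fixes f p :: "real \<Rightarrow> real"
  assumes a: "0 \<le> a" and f: "f integrable_on {0..a}" and p: "continuous_on {0..a} p"
    and dec: "\<And>x y. 0 \<le> x \<Longrightarrow> x \<le> y \<Longrightarrow> y \<le> a \<Longrightarrow> p y \<le> p x" and pos: "0 \<le> p a"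
    and avg: "\<And>t. 0 \<le> t \<Longrightarrow> t \<le> a \<Longrightarrow> integral {0..t} f \<le> l * t"
  shows "(\<lambda>x. p x * f x) integrable_on {0..a}"
    and "integral {0..a} (\<lambda>x. p x * f x) \<le> l * integral {0..a} p"
proof -
  define g where "g x = f x - l" for x
  have fs: "f integrable_on {0..t}" if "0 \<le> t" "t \<le> a" for t
    by (rule integrable_on_subinterval[OF f]) (use that in auto)
  have g: "g integrable_on {0..a}" unfolding g_def[abs_def] by (intro integrable_diff f) auto
  have g_avg: "integral {0..t} g \<le> 0" if "0 \<le> t" "t \<le> a" for t
    using avg[OF that] that unfolding g_def[abs_def] by (subst integral_diff) (auto simp: fs mult.commute)
  obtain c where c: "c \<in> {0..a}" and
    I: "((\<lambda>x. - p x * g x) has_integral (- p 0 * integral {0..c} g + - p a * integral {c..a} g)) {0..a}"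
    using second_mean_value_theorem_full[of g 0 a "\<lambda>x. - p x"] g a dec by auto
  have split: "integral {0..c} g + integral {c..a} g = integral {0..a} g"
    using c by (intro Henstock_Kurzweil_Integration.integral_combine g) auto
  from has_integral_neg[OF I]
  have J: "((\<lambda>x. p x * g x) has_integral (p 0 * integral {0..c} g + p a * integral {c..a} g)) {0..a}"
    by (simp add: add.commute)
  have "p 0 * integral {0..c} g + p a * integral {c..a} g = (p 0 - p a) * integral {0..c} g + p a * integral {0..a} g"
    unfolding split[symmetric] by (simp add: algebra_simps)
  also have "\<dots> \<le> 0"
    using g_avg[of c] g_avg[of a] c a dec[of 0 a] pos
    by (intro add_nonpos_nonpos mult_nonneg_nonpos) auto
  finally have le: "p 0 * integral {0..c} g + p a * integral {c..a} g \<le> 0" .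
  have pI: "(p has_integral integral {0..a} p) {0..a}"
    using p by (intro integrable_integral integrable_continuous_real)
  have "((\<lambda>x. p x * g x + l * p x) has_integral ((p 0 * integral {0..c} g + p a * integral {c..a} g) + l * integral {0..a} p)) {0..a}"
    by (intro has_integral_add J has_integral_mult_right pI)
  moreover have "(\<lambda>x. p x * g x + l * p x) = (\<lambda>x. p x * f x)" by (auto simp: g_def algebra_simps)
  ultimately have *: "((\<lambda>x. p x * f x) has_integral ((p 0 * integral {0..c} g + p a * integral {c..a} g) + l * integral {0..a} p)) {0..a}"
    by simp
  then show "(\<lambda>x. p x * f x) integrable_on {0..a}" by blast
  show "integral {0..a} (\<lambda>x. p x * f x) \<le> l * integral {0..a} p"
    using integral_unique[OF *] le by simp
qed

text \<open>
  With the symmetry of the Poisson kernel, this turns the upper and the lower half circle into two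
  integrals over \<open>{0..pi}\<close> in which the kernel decreases.
\<close>

lemma integral_second_half_circle:
  fixes f :: "real \<Rightarrow> real"
  shows "integral {pi..2 * pi} f = integral {0..pi} (\<lambda>s. f (2 * pi - s))"
proof -
  have "integral {pi..2 * pi} f = integral {pi - 2 * pi..2 * pi - 2 * pi} (\<lambda>x. f (x + 2 * pi))"
    by (rule integral_shift_real_ivl[symmetric])
  also have "\<dots> = integral {- pi..- 0} (\<lambda>x. f (x + 2 * pi))" by simp
  also have "\<dots> = integral {- pi..- 0} (\<lambda>x. (\<lambda>y. f (2 * pi - y)) (- x))" by (simp add: add.commute)
  also have "\<dots> = integral {0..pi} (\<lambda>s. f (2 * pi - s))"
    by (rule Henstock_Kurzweil_Integration.integral_reflect_real)
  finally show ?thesis .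
qed

lemma cis_2pi_minus: "cis (2 * pi - s) = cis (- s)"
  by (simp add: complex_eq_iff cos_diff sin_diff)

text \<open>
  One-sided averages of \<open>|F|\<^sup>2\<close> over arcs starting at \<open>1\<close> control \<open>F\<close> on the radius that ends at
  \<open>1\<close>, because \<open>F\<^sup>2\<close> is a Poisson integral and the Poisson kernel decreases away from \<open>1\<close>.
\<close>

lemma radial_bound_by_arc_averages:
  assumes F: "F holomorphic_on ball 0 R" "R > 1" and r: "0 \<le> r" "r < 1"
    and avg1: "\<And>t. 0 \<le> t \<Longrightarrow> t \<le> pi \<Longrightarrow> integral {0..t} (\<lambda>s. (cmod (F (cis s)))\<^sup>2) \<le> l * t"
    and avg2: "\<And>t. 0 \<le> t \<Longrightarrow> t \<le> pi \<Longrightarrow> integral {0..t} (\<lambda>s. (cmod (F (cis (- s))))\<^sup>2) \<le> l * t"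
  shows "(cmod (F (of_real r)))\<^sup>2 \<le> l"
proof -
  have cont: "continuous_on A (\<lambda>s. F (cis (u s)))" if "continuous_on A u" for A and u :: "real \<Rightarrow> real"
    by (rule continuous_on_compose2[OF holomorphic_on_imp_continuous_on[OF F(1)]])
       (use F(2) in \<open>auto intro!: continuous_intros that\<close>)
  define w where "w s = (cmod (F (cis s)))\<^sup>2" for s
  have w_cont: "continuous_on A w" for A
    unfolding w_def[abs_def] by (intro continuous_intros cont)
  have p: "continuous_on A (poisson r)" for A by (rule continuous_on_poisson[OF r])
  have "((\<lambda>s. (F (cis s))\<^sup>2 * of_real (poisson r s)) has_integral 2 * of_real pi * (F (of_real r))\<^sup>2) {0..2 * pi}"
    by (rule poisson_formula[of "\<lambda>z. (F z)\<^sup>2"]) (use F r in \<open>auto intro!: holomorphic_intros\<close>)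
  then have "2 * of_real pi * (F (of_real r))\<^sup>2 = integral {0..2 * pi} (\<lambda>s. (F (cis s))\<^sup>2 * of_real (poisson r s))"
    by (simp add: integral_unique)
  also have "cmod \<dots> \<le> integral {0..2 * pi} (\<lambda>s. poisson r s * w s)"
    by (rule Henstock_Kurzweil_Integration.integral_norm_bound_integral)
       (auto intro!: integrable_continuous_real continuous_intros p w_cont cont
          simp: w_def norm_mult norm_power poisson_nonneg[OF r])
  finally have "cmod (2 * of_real pi * (F (of_real r))\<^sup>2) \<le> integral {0..2 * pi} (\<lambda>s. poisson r s * w s)" .
  also have "\<dots> = integral {0..pi} (\<lambda>s. poisson r s * w s) + integral {pi..2 * pi} (\<lambda>s. poisson r s * w s)"
    by (rule Henstock_Kurzweil_Integration.integral_combine[symmetric])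
       (auto intro!: integrable_continuous_real continuous_intros p w_cont)
  also have "integral {pi..2 * pi} (\<lambda>s. poisson r s * w s) = integral {0..pi} (\<lambda>s. poisson r s * (cmod (F (cis (- s))))\<^sup>2)"
    unfolding integral_second_half_circle w_def cis_2pi_minus by (simp add: poisson_def cos_diff)
  also have "integral {0..pi} (\<lambda>s. poisson r s * w s) \<le> l * integral {0..pi} (poisson r)"
    by (rule decreasing_weight_integral_le)
       (use avg1 in \<open>auto simp: w_def[symmetric] intro!: integrable_continuous_real w_cont p poisson_decreasing r poisson_nonneg\<close>)
  also have "integral {0..pi} (\<lambda>s. poisson r s * (cmod (F (cis (- s))))\<^sup>2) \<le> l * integral {0..pi} (poisson r)"
    by (rule decreasing_weight_integral_le)
       (use avg2 in \<open>auto intro!: integrable_continuous_real continuous_intros cont p poisson_decreasing r poisson_nonneg\<close>)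
  also have "l * integral {0..pi} (poisson r) + l * integral {0..pi} (poisson r) = l * integral {0..2 * pi} (poisson r)"
  proof -
    have "integral {0..2 * pi} (poisson r) = integral {0..pi} (poisson r) + integral {pi..2 * pi} (poisson r)"
      by (rule Henstock_Kurzweil_Integration.integral_combine[symmetric])
         (auto intro!: integrable_continuous_real p)
    also have "integral {pi..2 * pi} (poisson r) = integral {0..pi} (poisson r)"
      unfolding integral_second_half_circle by (simp add: poisson_def[abs_def] cos_diff)
    finally show ?thesis by (simp add: algebra_simps)
  qed
  also have "integral {0..2 * pi} (poisson r) = 2 * pi"
    by (rule integral_unique[OF poisson_integral[OF r]])
  finally show ?thesis by (simp add: norm_mult norm_power)
qed

section \<open>Maximal inequalities for arcs of circles\<close>

text \<open>
  The maximum of the ergodic sums \<open>f x + \<dots> + f (T\<^bsup>n - 1\<^esup> x)\<close> of length \<open>n \<le> N\<close>, the empty sum included,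
  in the recursive form on which Garsia's argument is based.
\<close>

fun max_ergodic_sum :: "('a \<Rightarrow> 'a) \<Rightarrow> ('a \<Rightarrow> real) \<Rightarrow> nat \<Rightarrow> 'a \<Rightarrow> real" where
  "max_ergodic_sum T f 0 x = 0"
| "max_ergodic_sum T f (Suc N) x = max 0 (f x + max_ergodic_sum T f N (T x))"

lemma max_ergodic_sum_nonneg: "0 \<le> max_ergodic_sum T f N x"
  by (cases N) auto

lemma max_ergodic_sum_mono: "max_ergodic_sum T f N x \<le> max_ergodic_sum T f (Suc N) x"
  by (induction N arbitrary: x) (simp, metis (no_types, lifting) max.mono add_left_mono max_ergodic_sum.simps(2) order_refl)

lemma ergodic_sum_le_max: "n \<le> N \<Longrightarrow> (\<Sum>k<n. f ((T ^^ k) x)) \<le> max_ergodic_sum T f N x"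
proof (induction n arbitrary: N x)
  case 0
  show ?case by (simp add: max_ergodic_sum_nonneg)
next
  case (Suc n)
  then obtain M where M: "N = Suc M" "n \<le> M" by (cases N) auto
  have "(\<Sum>k<Suc n. f ((T ^^ k) x)) = f x + (\<Sum>k<n. f ((T ^^ k) (T x)))"
    by (simp only: sum.lessThan_Suc_shift funpow_0 funpow_Suc_right comp_apply)
  with Suc.IH[OF M(2), of "T x"] M(1) show ?case by simp
qed

text \<open>
  Garsia's proof of the maximal ergodic theorem: on the set where the maximal sum \<open>m\<close> is positive
  it satisfies \<open>m \<le> f + m \<circ> T\<close>, and \<open>m\<close> and \<open>m \<circ> T\<close> have the same integral.
\<close>

lemma maximal_ergodic:
  assumes T: "T \<in> M \<rightarrow>\<^sub>M M" "distr M M T = M" and f: "integrable M f"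
  shows "max_ergodic_sum T f N \<in> borel_measurable M"
    and "0 \<le> (\<integral>x. indicator {x. 0 < max_ergodic_sum T f N x} x * f x \<partial>M)"
proof -
  let ?m = "max_ergodic_sum T f"
  have comp: "integrable M (\<lambda>x. g (T x))" if "integrable M g" for g :: "'a \<Rightarrow> real"
    using integrable_distr[OF T(1), of g] that T(2) by simp
  have int: "integrable M (?m N)" for N
  proof (induction N)
    case (Suc N)
    have "integrable M (\<lambda>x. max 0 (f x + ?m N (T x)))"
      by (intro integrable_max integrable_zero Bochner_Integration.integrable_add f comp Suc)
    then show ?case by simp
  qed auto
  then show meas: "?m N \<in> borel_measurable M" by blast
  have mle: "?m N x - ?m N (T x) \<le> indicator {x. 0 < ?m N x} x * f x" for x
  proof (cases "0 < ?m N x")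
    case True
    then obtain K where K: "N = Suc K" by (cases N) auto
    with True have "?m N x = f x + ?m K (T x)" by auto
    also have "\<dots> \<le> f x + ?m N (T x)" unfolding K using max_ergodic_sum_mono by (intro add_left_mono)
    finally show ?thesis using True by simp
  next
    case False
    then show ?thesis using max_ergodic_sum_nonneg[of T f N x] max_ergodic_sum_nonneg[of T f N "T x"] by auto
  qed
  have "(\<integral>x. ?m N (T x) \<partial>M) = (\<integral>x. ?m N x \<partial>M)"
    using integral_distr[OF T(1), of "?m N"] T(2) meas by simp
  then have "0 = (\<integral>x. ?m N x - ?m N (T x) \<partial>M)"
    by (simp add: Bochner_Integration.integral_diff int comp)
  also have "\<dots> \<le> (\<integral>x. indicator {x. 0 < ?m N x} x * f x \<partial>M)"
  proof (rule integral_mono)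
    have [measurable]: "f \<in> borel_measurable M" using f by auto
    note [measurable] = meas
    show "integrable M (\<lambda>x. indicator {x. 0 < ?m N x} x * f x)"
      by (rule Bochner_Integration.integrable_bound[OF f]) (auto simp: indicator_def)
  qed (auto simp: mle int comp)
  finally show "0 \<le> (\<integral>x. indicator {x. 0 < ?m N x} x * f x \<partial>M)" .
qed

abbreviation \<sigma> :: "(complex ^ 'n) measure" where "\<sigma> \<equiv> sphere_measure"

interpretation sphere: finite_measure \<sigma>
  by (rule finite_measure_sphere)

text \<open>
  For \<open>e = 1\<close> and \<open>e = -1\<close> this is the integral over the arc of length \<open>t\<close> that leaves \<open>\<zeta>\<close> in the
  positive or in the negative direction.
\<close>

definition arc_integral :: "(complex ^ 'n \<Rightarrow> real) \<Rightarrow> real \<Rightarrow> real \<Rightarrow> complex ^ 'n \<Rightarrow> real" where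
  "arc_integral g e t \<zeta> = integral {0..t} (\<lambda>s. g (cis (e * s) *s \<zeta>))"

lemma continuous_on_arc:
  fixes g :: "complex ^ 'n \<Rightarrow> real"
  assumes "continuous_on (sphere 0 1) g" "\<zeta> \<in> sphere 0 1"
  shows "continuous_on A (\<lambda>s. g (cis (e * s) *s \<zeta>))"
  by (rule continuous_on_compose2[OF assms(1)])
     (use assms(2) in \<open>auto intro!: continuous_intros simp: norm_vector_smult\<close>)

lemma continuous_on_arc_integral:
  fixes g :: "complex ^ 'n \<Rightarrow> real"
  assumes g: "continuous_on (sphere 0 1) g"
  shows "continuous_on (sphere 0 1) (arc_integral g e t)"
proof -
  have "continuous_on (sphere 0 1 \<times> cbox 0 t) (\<lambda>(\<zeta>, s). g (cis (e * s) *s \<zeta>))"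
    unfolding split_beta
    by (rule continuous_on_compose2[OF g])
       (auto intro!: continuous_intros simp: norm_vector_smult)
  from integral_continuous_on_param[OF this] show ?thesis
    unfolding arc_integral_def[abs_def] by simp
qed

text \<open>
  The integral over a long arc is an ergodic sum of integrals over short arcs, for the rotation by
  the angle \<open>e a\<close>.
\<close>

lemma arc_integral_additive:
  fixes g :: "complex ^ 'n \<Rightarrow> real"
  assumes g: "continuous_on (sphere 0 1) g" and \<zeta>: "\<zeta> \<in> sphere 0 1" and a: "0 \<le> a"
  shows "arc_integral g e (real n * a) \<zeta> = (\<Sum>k<n. arc_integral g e a ((((*s) (cis (e * a))) ^^ k) \<zeta>))"
proof (induction n)
  case 0
  show ?case by (simp add: arc_integral_def)
next
  case (Suc n)
  have pow: "(((*s) (cis (e * a))) ^^ k) \<zeta> = cis (e * (real k * a)) *s \<zeta>" for k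
    by (induction k) (auto simp: vector_smult_assoc_complex cis_mult algebra_simps)
  have "arc_integral g e (real (Suc n) * a) \<zeta> = arc_integral g e (real n * a) \<zeta> + integral {real n * a..real (Suc n) * a} (\<lambda>s. g (cis (e * s) *s \<zeta>))"
    unfolding arc_integral_def
    by (rule Henstock_Kurzweil_Integration.integral_combine[symmetric])
       (use a in \<open>auto intro!: integrable_continuous_real continuous_on_arc g \<zeta> simp: mult_right_mono\<close>)
  also have "integral {real n * a..real (Suc n) * a} (\<lambda>s. g (cis (e * s) *s \<zeta>)) =
      integral {real n * a - real n * a..real (Suc n) * a - real n * a} (\<lambda>s. g (cis (e * (s + real n * a)) *s \<zeta>))"
    by (rule integral_shift_real_ivl[symmetric])
  also have "\<dots> = arc_integral g e a (cis (e * (real n * a)) *s \<zeta>)"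
    by (simp add: arc_integral_def vector_smult_assoc_complex cis_mult algebra_simps)
  finally show ?case by (simp add: Suc pow)
qed

lemma rotation_measurable_pair:
  "(\<lambda>p :: (complex ^ 'n) \<times> real. cis (e * snd p) *s fst p) \<in> \<sigma> \<Otimes>\<^sub>M lborel \<rightarrow>\<^sub>M \<sigma>"
proof -
  have id: "(\<lambda>x :: complex ^ 'n. x) \<in> \<sigma> \<rightarrow>\<^sub>M borel"
    by (rule borel_measurable_sphere_measureI) simp
  have [measurable]: "(\<lambda>p :: (complex ^ 'n) \<times> real. fst p) \<in> \<sigma> \<Otimes>\<^sub>M lborel \<rightarrow>\<^sub>M borel"
    by (rule measurable_compose[OF measurable_fst id])
  have "(\<lambda>p :: (complex ^ 'n) \<times> real. cis (e * snd p) *s fst p) \<in> \<sigma> \<Otimes>\<^sub>M lborel \<rightarrow>\<^sub>M restrict_space borel (sphere 0 1)"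
  proof (rule measurable_restrict_space2)
    have "(cis :: real \<Rightarrow> complex) \<in> borel_measurable borel" by (intro borel_measurable_continuous_onI continuous_intros)
    note [measurable] = measurable_compose[OF _ this]
    show "(\<lambda>p :: (complex ^ 'n) \<times> real. cis (e * snd p) *s fst p) \<in> borel_measurable (\<sigma> \<Otimes>\<^sub>M lborel)"
      by measurable
  qed (auto simp: space_pair_measure norm_vector_smult)
  then show ?thesis by (simp add: measurable_cong_sets[OF refl sets_sphere_measure])
qed

text \<open>
  Tonelli's theorem, as every rotation preserves the surface measure.
\<close>

lemma integral_arc_integral:
  fixes g :: "complex ^ 'n \<Rightarrow> real"
  assumes g: "continuous_on (sphere 0 1) g" and nonneg: "\<And>x. 0 \<le> g x" and a: "0 \<le> a"
  shows "(\<integral>\<zeta>. arc_integral g e a \<zeta> \<partial>\<sigma>) = a * (\<integral>\<zeta>. g \<zeta> \<partial>\<sigma>)"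
proof -
  have gm[measurable]: "g \<in> borel_measurable \<sigma>" by (rule borel_measurable_sphere_measure_continuous[OF g])
  have Jm: "arc_integral g e a \<in> borel_measurable \<sigma>"
    by (rule borel_measurable_sphere_measure_continuous[OF continuous_on_arc_integral[OF g]])
  interpret pair_sigma_finite \<sigma> "lborel :: real measure" ..
  from measurable_compose[OF rotation_measurable_pair gm]
  have [measurable]: "(\<lambda>p. g (cis (e * snd p) *s fst p)) \<in> borel_measurable (\<sigma> \<Otimes>\<^sub>M lborel)" .
  have J: "(\<integral>\<^sup>+s. ennreal (g (cis (e * s) *s \<zeta>)) * indicator {0..a} s \<partial>lborel) = ennreal (arc_integral g e a \<zeta>)"
    if "\<zeta> \<in> space \<sigma>" for \<zeta>
    unfolding arc_integral_def
    by (rule nn_integral_has_integral_lebesgue')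
       (use that in \<open>auto intro!: nonneg integrable_integral integrable_continuous_real continuous_on_arc g\<close>)
  have Jpos: "0 \<le> arc_integral g e a \<zeta>" for \<zeta>
    unfolding arc_integral_def by (cases "(\<lambda>s. g (cis (e * s) *s \<zeta>)) integrable_on {0..a}")
      (auto intro!: Henstock_Kurzweil_Integration.integral_nonneg nonneg simp: not_integrable_integral)
  have int_g: "integrable \<sigma> g"
  proof -
    have "compact (g ` sphere 0 1)" by (intro compact_continuous_image g) auto
    then obtain B where "\<forall>x\<in>sphere 0 1. norm (g x) \<le> B" using compact_imp_bounded bounded_iff by (metis imageI)
    then show ?thesis by (intro sphere.integrable_const_bound[where B = B]) auto
  qed
  have "(\<integral>\<^sup>+\<zeta>. ennreal (arc_integral g e a \<zeta>) \<partial>\<sigma>) = (\<integral>\<^sup>+\<zeta>. (\<integral>\<^sup>+s. ennreal (g (cis (e * s) *s \<zeta>)) * indicator {0..a} s \<partial>lborel) \<partial>\<sigma>)"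
    by (intro nn_integral_cong) (simp add: J)
  also have "\<dots> = (\<integral>\<^sup>+s. (\<integral>\<^sup>+\<zeta>. ennreal (g (cis (e * s) *s \<zeta>)) * indicator {0..a} s \<partial>\<sigma>) \<partial>lborel)"
    by (rule Fubini'[symmetric]) (simp add: split_beta)
  also have "\<dots> = (\<integral>\<^sup>+s. ennreal (\<integral>\<zeta>. g \<zeta> \<partial>\<sigma>) * indicator {0..a} s \<partial>lborel)"
  proof (intro nn_integral_cong)
    fix s :: real
    have "(\<integral>\<^sup>+\<zeta>. ennreal (g (cis (e * s) *s \<zeta>)) * indicator {0..a} s \<partial>\<sigma>) = (\<integral>\<^sup>+\<zeta>. ennreal (g \<zeta>) * indicator {0..a} s \<partial>\<sigma>)"
      by (rule circle_invariant_nn_integral[OF circle_invariant_sphere_measure, of "cis (e * s)" "\<lambda>\<zeta>. ennreal (g \<zeta>) * indicator {0..a} s"]) auto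
    also have "\<dots> = ennreal (\<integral>\<zeta>. g \<zeta> \<partial>\<sigma>) * indicator {0..a} s"
      by (subst nn_integral_multc) (auto simp: nn_integral_eq_integral[OF int_g] nonneg)
    finally show "(\<integral>\<^sup>+\<zeta>. ennreal (g (cis (e * s) *s \<zeta>)) * indicator {0..a} s \<partial>\<sigma>) = ennreal (\<integral>\<zeta>. g \<zeta> \<partial>\<sigma>) * indicator {0..a} s" .
  qed
  also have "\<dots> = ennreal (a * (\<integral>\<zeta>. g \<zeta> \<partial>\<sigma>))"
    using a by (simp add: nn_integral_cmult ennreal_mult' nonneg mult.commute integral_nonneg)
  finally show ?thesis
    using integral_eq_nn_integral[OF Jm] Jpos a by (simp add: nonneg)
qed

text \<open>
  The maximal ergodic theorem, applied to integrals over short arcs of length \<open>pi / 2 ^ m\<close>, gives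
  a weak type inequality for averages over arcs whose length is a multiple of \<open>pi / 2 ^ m\<close>.  The
  exceptional sets increase with \<open>m\<close>, and their union accounts for arcs of any length, because arc
  integrals depend continuously on the length.
\<close>

lemma arc_maximal_inequality:
  fixes g :: "complex ^ 'n \<Rightarrow> real"
  assumes g: "continuous_on (sphere 0 1) g" and nonneg: "\<And>x. 0 \<le> g x" and l: "0 < l"
  shows "{\<zeta> \<in> sphere 0 1. \<exists>t\<in>{0..pi}. l * t < arc_integral g e t \<zeta>} \<in> sets \<sigma>"
    and "measure \<sigma> {\<zeta> \<in> sphere 0 1. \<exists>t\<in>{0..pi}. l * t < arc_integral g e t \<zeta>} \<le> (\<integral>\<zeta>. g \<zeta> \<partial>\<sigma>) / l"
proof -
  define a where "a m = pi / 2 ^ m" for m :: nat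
  have a: "a m > 0" for m by (simp add: a_def)
  define E where "E m = {\<zeta> \<in> sphere 0 1. \<exists>n\<in>{..2 ^ m}. l * (real n * a m) < arc_integral g e (real n * a m) \<zeta>}" for m
  have gm[measurable]: "g \<in> borel_measurable \<sigma>" by (rule borel_measurable_sphere_measure_continuous[OF g])
  have Jm[measurable]: "arc_integral g e t \<in> borel_measurable \<sigma>" for t
    by (rule borel_measurable_sphere_measure_continuous[OF continuous_on_arc_integral[OF g]])
  have Em: "E m \<in> sets \<sigma>" for m
  proof -
    have "E m = {\<zeta> \<in> space \<sigma>. \<exists>n\<in>{..2 ^ m}. l * (real n * a m) < arc_integral g e (real n * a m) \<zeta>}"
      by (simp add: E_def)
    also have "\<dots> \<in> sets \<sigma>" by measurable
    finally show ?thesis .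
  qed
  have bound: "measure \<sigma> (E m) \<le> (\<integral>\<zeta>. g \<zeta> \<partial>\<sigma>) / l" for m
  proof -
    let ?T = "(*s) (cis (e * a m)) :: complex ^ 'n \<Rightarrow> _"
    let ?f = "\<lambda>\<zeta>. arc_integral g e (a m) \<zeta> - l * a m"
    have T: "?T \<in> \<sigma> \<rightarrow>\<^sub>M \<sigma>" "distr \<sigma> \<sigma> ?T = \<sigma>"
      using circle_invariant_sphere_measure[unfolded circle_invariant_def, THEN conjunct2, THEN conjunct2, rule_format, of "cis (e * a m)"] by auto
    have J_int: "integrable \<sigma> (arc_integral g e (a m))"
    proof -
      have "compact (arc_integral g e (a m) ` sphere 0 1)" by (intro compact_continuous_image continuous_on_arc_integral g) auto
      then obtain B where "\<forall>x\<in>sphere 0 1. norm (arc_integral g e (a m) x) \<le> B" using compact_imp_bounded bounded_iff by (metis imageI)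
      then show ?thesis by (intro sphere.integrable_const_bound[where B = B]) auto
    qed
    have Jpos: "0 \<le> arc_integral g e t \<zeta>" for t \<zeta>
      unfolding arc_integral_def by (cases "(\<lambda>s. g (cis (e * s) *s \<zeta>)) integrable_on {0..t}")
        (auto intro!: Henstock_Kurzweil_Integration.integral_nonneg nonneg simp: not_integrable_integral)
    have f: "integrable \<sigma> ?f" using J_int by auto
    define P where "P = {\<zeta> \<in> space \<sigma>. 0 < max_ergodic_sum ?T ?f (2 ^ m) \<zeta>}"
    note [measurable] = maximal_ergodic(1)[OF T f, of "2 ^ m"]
    have P[measurable]: "P \<in> sets \<sigma>" unfolding P_def by measurable
    have EP: "E m \<subseteq> P"
    proof
      fix \<zeta> assume "\<zeta> \<in> E m"
      then obtain n where \<zeta>: "\<zeta> \<in> sphere 0 1" and n: "n \<le> 2 ^ m" "l * (real n * a m) < arc_integral g e (real n * a m) \<zeta>"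
        by (auto simp: E_def)
      have "0 < arc_integral g e (real n * a m) \<zeta> - l * (real n * a m)" using n by simp
      also have "\<dots> = (\<Sum>k<n. ?f ((?T ^^ k) \<zeta>))"
        unfolding arc_integral_additive[OF g \<zeta> less_imp_le[OF a]] by (simp add: sum_subtractf)
      also have "\<dots> \<le> max_ergodic_sum ?T ?f (2 ^ m) \<zeta>" by (rule ergodic_sum_le_max[OF n(1)])
      finally show "\<zeta> \<in> P" using \<zeta> by (simp add: P_def)
    qed
    have "0 \<le> (\<integral>\<zeta>. indicator {\<zeta>. 0 < max_ergodic_sum ?T ?f (2 ^ m) \<zeta>} \<zeta> * ?f \<zeta> \<partial>\<sigma>)"
      by (rule maximal_ergodic(2)[OF T f])
    also have "\<dots> = (\<integral>\<zeta>. indicator P \<zeta> * arc_integral g e (a m) \<zeta> - (l * a m) * indicator P \<zeta> \<partial>\<sigma>)"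
      by (rule Bochner_Integration.integral_cong) (auto simp: P_def indicator_def algebra_simps)
    also have "\<dots> = (\<integral>\<zeta>. indicator P \<zeta> * arc_integral g e (a m) \<zeta> \<partial>\<sigma>) - l * a m * measure \<sigma> P"
    proof (subst Bochner_Integration.integral_diff)
      show "integrable \<sigma> (\<lambda>\<zeta>. indicator P \<zeta> * arc_integral g e (a m) \<zeta>)"
        by (rule Bochner_Integration.integrable_bound[OF J_int]) (auto simp: indicator_def)
      have "integrable \<sigma> (indicator P :: _ \<Rightarrow> real)"
        by (rule sphere.integrable_const_bound[where B = 1]) (auto simp: indicator_def)
      then show "integrable \<sigma> (\<lambda>\<zeta>. l * a m * indicator P \<zeta>)" by simp
      have "P \<inter> space \<sigma> = P" by (auto simp: P_def)
      then show "(\<integral>\<zeta>. indicator P \<zeta> * arc_integral g e (a m) \<zeta> \<partial>\<sigma>) - (\<integral>\<zeta>. l * a m * indicator P \<zeta> \<partial>\<sigma>) =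
        (\<integral>\<zeta>. indicator P \<zeta> * arc_integral g e (a m) \<zeta> \<partial>\<sigma>) - l * a m * measure \<sigma> P"
        using Bochner_Integration.integral_indicator[of \<sigma> P] by (simp del: Bochner_Integration.integral_indicator)
    qed
    also have "(\<integral>\<zeta>. indicator P \<zeta> * arc_integral g e (a m) \<zeta> \<partial>\<sigma>) \<le> (\<integral>\<zeta>. arc_integral g e (a m) \<zeta> \<partial>\<sigma>)"
      by (rule integral_mono_AE') (use J_int Jpos in \<open>auto simp: indicator_def\<close>)
    also have "\<dots> = a m * (\<integral>\<zeta>. g \<zeta> \<partial>\<sigma>)"
      by (rule integral_arc_integral[OF g nonneg less_imp_le[OF a]])
    finally have "l * measure \<sigma> P * a m \<le> (\<integral>\<zeta>. g \<zeta> \<partial>\<sigma>) * a m" by (simp add: mult_ac)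
    then have "measure \<sigma> P \<le> (\<integral>\<zeta>. g \<zeta> \<partial>\<sigma>) / l" using a[of m] l by (simp add: field_simps)
    with sphere.finite_measure_mono[OF EP P] show ?thesis by linarith
  qed
  have inc: "incseq E"
  proof (rule incseq_SucI, rule subsetI)
    fix m \<zeta> assume "\<zeta> \<in> E m"
    then obtain n where \<zeta>: "\<zeta> \<in> sphere 0 1" and n: "n \<le> 2 ^ m" "l * (real n * a m) < arc_integral g e (real n * a m) \<zeta>"
      by (auto simp: E_def)
    have "real n * a m = real (2 * n) * a (Suc m)" by (simp add: a_def)
    with n show "\<zeta> \<in> E (Suc m)" using \<zeta> by (auto simp: E_def intro!: bexI[of _ "2 * n"])
  qed
  have UE: "{\<zeta> \<in> sphere 0 1. \<exists>t\<in>{0..pi}. l * t < arc_integral g e t \<zeta>} = (\<Union>m. E m)"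
  proof (intro equalityI subsetI)
    fix \<zeta> assume "\<zeta> \<in> (\<Union>m. E m)"
    then obtain m n where \<zeta>: "\<zeta> \<in> sphere 0 1" and n: "n \<le> 2 ^ m" "l * (real n * a m) < arc_integral g e (real n * a m) \<zeta>"
      by (auto simp: E_def)
    have "real n * a m \<le> 2 ^ m * a m" using n(1) less_imp_le[OF a[of m]]
      by (intro mult_right_mono) (metis of_nat_le_iff of_nat_numeral of_nat_power)
    then have "real n * a m \<in> {0..pi}" using a[of m] by (simp add: a_def)
    with n \<zeta> show "\<zeta> \<in> {\<zeta> \<in> sphere 0 1. \<exists>t\<in>{0..pi}. l * t < arc_integral g e t \<zeta>}" by blast
  next
    fix \<zeta> assume "\<zeta> \<in> {\<zeta> \<in> sphere 0 1. \<exists>t\<in>{0..pi}. l * t < arc_integral g e t \<zeta>}"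
    then obtain t where \<zeta>: "\<zeta> \<in> sphere 0 1" and t: "0 \<le> t" "t \<le> pi" "l * t < arc_integral g e t \<zeta>" by auto
    define n where "n m = nat \<lfloor>t / a m\<rfloor>" for m
    have fl: "real (n m) = of_int \<lfloor>t / a m\<rfloor>" for m
      unfolding n_def using t a[of m] by (simp add: le_floor_iff)
    have n1: "real (n m) * a m \<le> t" for m
      using of_int_floor_le[of "t / a m"] unfolding fl pos_le_divide_eq[OF a] .
    have n2: "t - a m < real (n m) * a m" for m
    proof -
      have "t / a m < real (n m) + 1" unfolding fl by linarith
      then show ?thesis using a[of m] by (simp add: pos_divide_less_eq algebra_simps)
    qed
    have a0: "a \<longlonglongrightarrow> 0"
      unfolding a_def using tendsto_mult_right_zero[OF LIMSEQ_power_zero[of "1 / 2 :: real"], of pi] by (simp add: power_divide)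
    have lim: "(\<lambda>m. real (n m) * a m) \<longlonglongrightarrow> t"
    proof (rule tendsto_sandwich)
      show "(\<lambda>m. t - a m) \<longlonglongrightarrow> t" using tendsto_diff[OF tendsto_const a0, of t] by simp
      show "eventually (\<lambda>m. t - a m \<le> real (n m) * a m) sequentially"
        by (intro always_eventually allI less_imp_le n2)
      show "eventually (\<lambda>m. real (n m) * a m \<le> t) sequentially"
        by (intro always_eventually allI n1)
    qed simp
    have "continuous_on {0..t} (\<lambda>u. integral {0..u} (\<lambda>s. g (cis (e * s) *s \<zeta>)))"
      by (rule indefinite_integral_continuous_1) (intro integrable_continuous_real continuous_on_arc g \<zeta>)
    then have "continuous_on {0..t} (\<lambda>u. arc_integral g e u \<zeta> - l * u)"
      unfolding arc_integral_def by (intro continuous_intros)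
    from continuous_on_tendsto_compose[OF this lim]
    have "(\<lambda>m. arc_integral g e (real (n m) * a m) \<zeta> - l * (real (n m) * a m)) \<longlonglongrightarrow> arc_integral g e t \<zeta> - l * t"
      using t n1 less_imp_le[OF a] by (auto intro!: always_eventually)
    then have "eventually (\<lambda>m. 0 < arc_integral g e (real (n m) * a m) \<zeta> - l * (real (n m) * a m)) sequentially"
      by (rule order_tendstoD) (use t in auto)
    then obtain m where m: "0 < arc_integral g e (real (n m) * a m) \<zeta> - l * (real (n m) * a m)"
      using eventually_happens by fastforce
    have "real (n m) \<le> 2 ^ m"
    proof (rule mult_right_le_imp_le[OF _ a])
      show "real (n m) * a m \<le> 2 ^ m * a m"
        using order_trans[OF n1[of m] t(2)] by (simp add: a_def)
    qed
    then have "n m \<le> 2 ^ m" by (metis of_nat_le_iff of_nat_numeral of_nat_power)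
    with m \<zeta> show "\<zeta> \<in> (\<Union>m. E m)" by (auto simp: E_def intro!: exI[of _ m] bexI[of _ "n m"])
  qed
  show "{\<zeta> \<in> sphere 0 1. \<exists>t\<in>{0..pi}. l * t < arc_integral g e t \<zeta>} \<in> sets \<sigma>"
    unfolding UE using Em by auto
  have "(\<lambda>m. measure \<sigma> (E m)) \<longlonglongrightarrow> measure \<sigma> (\<Union>m. E m)"
    by (rule sphere.finite_Lim_measure_incseq[OF _ inc]) (use Em in auto)
  then show "measure \<sigma> {\<zeta> \<in> sphere 0 1. \<exists>t\<in>{0..pi}. l * t < arc_integral g e t \<zeta>} \<le> (\<integral>\<zeta>. g \<zeta> \<partial>\<sigma>) / l"
    unfolding UE by (rule LIMSEQ_le_const2) (use bound in auto)
qed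

section \<open>Dilations and the coefficient form of the Hardy norm\<close>

text \<open>
  Where the averages of \<open>|g|\<^sup>2\<close> over the arcs in both directions are at most \<open>l\<close>, the values of
  \<open>|g|\<^sup>2\<close> on the radius are at most \<open>l\<close>.  The two directions account for the factor \<open>2\<close>.
\<close>

lemma radial_maximal_inequality:
  fixes g :: "complex ^ 'n \<Rightarrow> complex"
  assumes g: "holomorphic_fun_on g (ball 0 R)" "R > 1" and l: "0 < l"
  shows "{\<zeta> \<in> sphere 0 1. \<exists>r\<in>{0..<1}. l < (cmod (g (r *\<^sub>R \<zeta>)))\<^sup>2} \<in> sets \<sigma>" (is "?X \<in> _")
    and "measure \<sigma> {\<zeta> \<in> sphere 0 1. \<exists>r\<in>{0..<1}. l < (cmod (g (r *\<^sub>R \<zeta>)))\<^sup>2}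
          \<le> 2 * (\<integral>\<zeta>. (cmod (g \<zeta>))\<^sup>2 \<partial>\<sigma>) / l"
proof -
  let ?g = "\<lambda>\<zeta>. (cmod (g \<zeta>))\<^sup>2"
  define E where "E e = {\<zeta> \<in> sphere 0 1. \<exists>t\<in>{0..pi}. l * t < arc_integral ?g e t \<zeta>}" for e
  have gc: "continuous_on (ball 0 R) g" by (rule holomorphic_fun_on_imp_continuous_on[OF g(1)])
  have cont: "continuous_on (sphere 0 1) ?g"
    by (intro continuous_intros continuous_on_subset[OF gc]) (use g(2) in auto)
  note E = arc_maximal_inequality[OF cont _ l, folded E_def]
  have X_eq: "?X = sphere 0 1 \<inter> (\<Union>r\<in>{0..<1}. {z \<in> ball 0 R. l < (cmod (g (r *\<^sub>R z)))\<^sup>2})"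
    using g(2) by auto
  have "open {z \<in> ball 0 R. l < (cmod (g (r *\<^sub>R z)))\<^sup>2}" if "r \<in> {0..<1}" for r
  proof -
    have "continuous_on (ball 0 R) (\<lambda>z. g (r *\<^sub>R z))"
    proof (rule continuous_on_compose2[OF gc])
      show "(*\<^sub>R) r ` ball (0 :: complex ^ 'n) R \<subseteq> ball 0 R"
      proof (intro image_subsetI)
        fix z :: "complex ^ 'n" assume "z \<in> ball 0 R"
        then have "norm z < R" by simp
        moreover have "r * norm z \<le> 1 * norm z" using that by (intro mult_right_mono) auto
        ultimately show "r *\<^sub>R z \<in> ball 0 R" using that by simp
      qed
    qed (intro continuous_intros)
    then have "continuous_on (ball 0 R) (\<lambda>z. (cmod (g (r *\<^sub>R z)))\<^sup>2)" by (intro continuous_intros)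
    from continuous_open_preimage[OF this open_ball, of "{l<..}"] show ?thesis
      by (simp add: vimage_def Int_def)
  qed
  then have op: "open (\<Union>r\<in>{0..<1}. {z \<in> ball 0 R. l < (cmod (g (r *\<^sub>R z)))\<^sup>2})" by blast
  show X: "?X \<in> sets \<sigma>"
    unfolding X_eq sets_sphere_measure_iff
    by (intro conjI sets.Int[OF borel_closed[OF closed_sphere] borel_open[OF op]]) auto
  have sub: "?X \<subseteq> E 1 \<union> E (- 1)"
  proof (rule ccontr)
    assume "\<not> ?X \<subseteq> E 1 \<union> E (- 1)"
    then obtain \<zeta> where X: "\<zeta> \<in> ?X" and E1: "\<zeta> \<notin> E 1" and E2: "\<zeta> \<notin> E (- 1)" by blast
    from X obtain r where \<zeta>: "\<zeta> \<in> sphere 0 1" and r: "0 \<le> r" "r < 1" "l < ?g (r *\<^sub>R \<zeta>)" by auto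
    have "{x. x *s \<zeta> \<in> ball 0 R} = ball 0 R" using \<zeta> by (auto simp: norm_vector_smult)
    then have hol: "(\<lambda>x. g (x *s \<zeta>)) holomorphic_on ball 0 R"
      using central_slice_holomorphic[OF g(1), of \<zeta>] by simp
    have "(cmod (g (of_real r *s \<zeta>)))\<^sup>2 \<le> l"
    proof (rule radial_bound_by_arc_averages[OF hol g(2) r(1,2)])
      fix t assume t: "0 \<le> t" "t \<le> pi"
      have "arc_integral ?g 1 t \<zeta> \<le> l * t" using E1 \<zeta> t by (auto simp: E_def not_less)
      then show "integral {0..t} (\<lambda>s. (cmod (g (cis s *s \<zeta>)))\<^sup>2) \<le> l * t" by (simp add: arc_integral_def)
      have "arc_integral ?g (- 1) t \<zeta> \<le> l * t" using E2 \<zeta> t by (auto simp: E_def not_less)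
      then show "integral {0..t} (\<lambda>s. (cmod (g (cis (- s) *s \<zeta>)))\<^sup>2) \<le> l * t" by (simp add: arc_integral_def)
    qed
    then show False using r by (simp add: vector_smult_of_real)
  qed
  have "measure \<sigma> ?X \<le> measure \<sigma> (E 1 \<union> E (- 1))"
    by (rule sphere.finite_measure_mono[OF sub]) (use E(1)[of 1] E(1)[of "- 1"] in auto)
  also have "\<dots> \<le> measure \<sigma> (E 1) + measure \<sigma> (E (- 1))"
    by (rule measure_Un_le) (use E(1)[of 1] E(1)[of "- 1"] in auto)
  also have "\<dots> \<le> (\<integral>\<zeta>. ?g \<zeta> \<partial>\<sigma>) / l + (\<integral>\<zeta>. ?g \<zeta> \<partial>\<sigma>) / l"
    by (intro add_mono E(2)) auto
  finally show "measure \<sigma> ?X \<le> 2 * (\<integral>\<zeta>. ?g \<zeta> \<partial>\<sigma>) / l" by simp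
qed

lemma hcoeff_lincomb:
  fixes g h :: "complex ^ 'n \<Rightarrow> complex"
  assumes g: "holomorphic_fun_on g (ball 0 R)" and h: "holomorphic_fun_on h (ball 0 R)" and R: "R > 0"
  shows "hcoeff (\<lambda>z. a * g z + b * h z) k z = a * hcoeff g k z + b * hcoeff h k z"
proof -
  let ?S = "{l. l *s z \<in> ball 0 R}"
  have 0: "0 \<in> ?S" using R by simp
  have hol: "(\<lambda>l. a * g (l *s z)) holomorphic_on ?S" "(\<lambda>l. b * h (l *s z)) holomorphic_on ?S"
    by (intro holomorphic_intros central_slice_holomorphic g h)+
  show ?thesis
    unfolding hcoeff_def higher_deriv_add[OF hol open_central_slice 0]
      higher_deriv_cmult[OF central_slice_holomorphic[OF g] 0 open_central_slice]
      higher_deriv_cmult[OF central_slice_holomorphic[OF h] 0 open_central_slice]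
    by (simp add: add_divide_distrib)
qed

definition coeff_norm2 :: "(complex ^ 'n \<Rightarrow> complex) \<Rightarrow> nat \<Rightarrow> real" where
  "coeff_norm2 h k = (\<integral>\<zeta>. (cmod (hcoeff h k \<zeta>))\<^sup>2 \<partial>\<sigma>)"

lemma coeff_norm2_nonneg: "0 \<le> coeff_norm2 h k"
  by (simp add: coeff_norm2_def)

lemma holomorphic_dilate:
  fixes h :: "complex ^ 'n \<Rightarrow> complex"
  assumes h: "holomorphic_fun_on h (ball 0 1)" and t: "0 \<le> r" "r \<le> t" "0 < t"
  shows "holomorphic_fun_on (\<lambda>z. h (r *\<^sub>R z)) (ball 0 (1 / t))"
proof -
  have "holomorphic_fun_on (\<lambda>z. h (0 + of_real r *s z)) (ball 0 (1 / t))"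
  proof (rule holomorphic_fun_on_affine[OF h])
    fix z :: "complex ^ 'n" assume "z \<in> ball 0 (1 / t)"
    then have "t * norm z < 1" using t by (simp add: field_simps)
    moreover have "r * norm z \<le> t * norm z" using t by (intro mult_right_mono) auto
    ultimately show "0 + of_real r *s z \<in> ball 0 1" using t by (simp add: norm_vector_smult)
  qed
  then show ?thesis by (simp add: vector_smult_of_real)
qed

lemma hcoeff_scaleR:
  assumes "holomorphic_fun_on h (ball 0 R)" "R > 0"
  shows "hcoeff h k (r *\<^sub>R z) = of_real (r ^ k) * hcoeff h k z"
  using hcoeff_smult[OF assms, of k "of_real r" z] by (simp add: vector_smult_of_real)

lemma hcoeff_dilate_real:
  "hcoeff (\<lambda>z. h (r *\<^sub>R z)) k z = hcoeff h k (r *\<^sub>R z)"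
  using hcoeff_dilate[of h "of_real r" k z] by (simp add: vector_smult_of_real)

lemma AE_sphere_norm: "AE \<zeta> in \<sigma>. norm \<zeta> \<le> 1"
  by (rule AE_I2) simp

text \<open>
  The dilation by \<open>r\<close> multiplies the component of degree \<open>k\<close> by \<open>r ^ k\<close>, and dilations are holomorphic
  beyond the closed ball, where Parseval's identity applies.  All comparisons of norms of dilations
  thus become comparisons of coefficients.
\<close>

lemma sphere_norm_lincomb_sums:
  fixes h :: "complex ^ 'n \<Rightarrow> complex"
  assumes h: "holomorphic_fun_on h (ball 0 1)" and r: "0 \<le> r" "r < 1" "0 \<le> s" "s < 1"
  shows "(\<lambda>k. coeff_norm2 h k * (a * r ^ k + b * s ^ k)\<^sup>2) sums
     (\<integral>\<zeta>. (cmod (of_real a * h (r *\<^sub>R \<zeta>) + of_real b * h (s *\<^sub>R \<zeta>)))\<^sup>2 \<partial>\<sigma>)"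
proof -
  obtain t where t: "r \<le> t" "s \<le> t" "0 < t" "t < 1"
    using r that[of "(1 + max r s) / 2"] by (auto simp: max_def)
  have R: "1 / t > 1" "1 / t > 0" using t by auto
  let ?g = "\<lambda>\<zeta>. of_real a * h (r *\<^sub>R \<zeta>) + of_real b * h (s *\<^sub>R \<zeta>)"
  note dil = holomorphic_dilate[OF h r(1) t(1,3)] holomorphic_dilate[OF h r(3) t(2,3)]
  have g: "holomorphic_fun_on ?g (ball 0 (1 / t))"
    by (rule holomorphic_fun_on_lincomb[OF dil])
  have meas: "?g \<in> borel_measurable \<sigma>"
    by (rule borel_measurable_sphere_measure_continuous, rule continuous_on_subset[OF holomorphic_fun_on_imp_continuous_on[OF g]])
       (use R in auto)
  have c: "hcoeff ?g k \<zeta> = of_real (a * r ^ k + b * s ^ k) * hcoeff h k \<zeta>" for k \<zeta>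
    by (subst hcoeff_lincomb[OF dil R(2)]) (simp add: hcoeff_dilate_real hcoeff_scaleR[OF h] algebra_simps)
  have "(\<lambda>k. \<integral>x. (cmod (hcoeff ?g k x))\<^sup>2 \<partial>\<sigma>) sums (\<integral>x. (cmod (?g x))\<^sup>2 \<partial>\<sigma>)"
    by (rule parseval_norm[OF circle_invariant_sphere_measure _ R(1) AE_sphere_norm g meas]) simp
  moreover have "(\<integral>x. (cmod (hcoeff ?g k x))\<^sup>2 \<partial>\<sigma>) = coeff_norm2 h k * (a * r ^ k + b * s ^ k)\<^sup>2" for k
    unfolding c norm_mult power_mult_distrib norm_of_real power2_abs coeff_norm2_def
    by (simp add: mult.commute)
  ultimately show ?thesis by simp
qed

lemma sphere_norm_sums:
  fixes h :: "complex ^ 'n \<Rightarrow> complex"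
  assumes h: "holomorphic_fun_on h (ball 0 1)" and r: "0 \<le> r" "r < 1"
  shows "(\<lambda>k. coeff_norm2 h k * (r ^ k)\<^sup>2) sums (\<integral>\<zeta>. (cmod (h (r *\<^sub>R \<zeta>)))\<^sup>2 \<partial>\<sigma>)"
  using sphere_norm_lincomb_sums[OF h r r, of 1 0] by simp

lemma sphere_norm_diff_sums:
  fixes h :: "complex ^ 'n \<Rightarrow> complex"
  assumes h: "holomorphic_fun_on h (ball 0 1)" and r: "0 \<le> r" "r < 1" "0 \<le> s" "s < 1"
  shows "(\<lambda>k. coeff_norm2 h k * (r ^ k - s ^ k)\<^sup>2) sums (\<integral>\<zeta>. (cmod (h (r *\<^sub>R \<zeta>) - h (s *\<^sub>R \<zeta>)))\<^sup>2 \<partial>\<sigma>)"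
  using sphere_norm_lincomb_sums[OF h r, of 1 "-1"] by simp

lemma sphere_inner_sums:
  fixes g h :: "complex ^ 'n \<Rightarrow> complex"
  assumes g: "holomorphic_fun_on g (ball 0 1)" and h: "holomorphic_fun_on h (ball 0 1)" and r: "0 \<le> r" "r < 1"
  shows "(\<lambda>k. of_real (r ^ k) ^ 2 * (\<integral>\<zeta>. hcoeff g k \<zeta> * cnj (hcoeff h k \<zeta>) \<partial>\<sigma>)) sums
     (\<integral>\<zeta>. g (r *\<^sub>R \<zeta>) * cnj (h (r *\<^sub>R \<zeta>)) \<partial>\<sigma>)"
proof -
  obtain t where t: "r \<le> t" "0 < t" "t < 1" using r that[of "(1 + r) / 2"] by auto
  have R: "1 / t > 1" "1 / t > 0" using t by auto
  note dil = holomorphic_dilate[OF g r(1) t(1,2)] holomorphic_dilate[OF h r(1) t(1,2)]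
  have meas: "(\<lambda>\<zeta>. g (r *\<^sub>R \<zeta>)) \<in> borel_measurable \<sigma>" "(\<lambda>\<zeta>. h (r *\<^sub>R \<zeta>)) \<in> borel_measurable \<sigma>"
    by (rule borel_measurable_sphere_measure_continuous, rule continuous_on_subset[OF holomorphic_fun_on_imp_continuous_on[OF dil(1)]],
        use R in force)
       (rule borel_measurable_sphere_measure_continuous, rule continuous_on_subset[OF holomorphic_fun_on_imp_continuous_on[OF dil(2)]],
        use R in force)
  have "(\<lambda>k. \<integral>\<zeta>. hcoeff (\<lambda>\<zeta>. g (r *\<^sub>R \<zeta>)) k \<zeta> * cnj (hcoeff (\<lambda>\<zeta>. h (r *\<^sub>R \<zeta>)) k \<zeta>) \<partial>\<sigma>) sums
     (\<integral>\<zeta>. g (r *\<^sub>R \<zeta>) * cnj (h (r *\<^sub>R \<zeta>)) \<partial>\<sigma>)"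
    by (rule parseval[OF circle_invariant_sphere_measure _ R(1) AE_sphere_norm dil meas]) simp
  moreover have "hcoeff (\<lambda>\<zeta>. g (r *\<^sub>R \<zeta>)) k \<zeta> * cnj (hcoeff (\<lambda>\<zeta>. h (r *\<^sub>R \<zeta>)) k \<zeta>) =
     of_real (r ^ k) ^ 2 * (hcoeff g k \<zeta> * cnj (hcoeff h k \<zeta>))" for k \<zeta>
    by (simp add: hcoeff_dilate_real hcoeff_scaleR[OF g] hcoeff_scaleR[OF h] power2_eq_square)
  ultimately show ?thesis by simp
qed

lemma Hardy2D:
  assumes "h \<in> Hardy2"
  shows "holomorphic_fun_on h (ball 0 1)" "z \<notin> ball 0 1 \<Longrightarrow> h z = 0"
    "bdd_above ((\<lambda>r. \<integral>\<zeta>. (cmod (h (r *\<^sub>R \<zeta>)))\<^sup>2 \<partial>\<sigma>) ` {0<..<1})"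
  using assms unfolding Hardy2_def by auto

lemma sum_coeff_norm2_le:
  fixes h :: "complex ^ 'n \<Rightarrow> complex"
  assumes h: "holomorphic_fun_on h (ball 0 1)"
    and B: "\<And>r. 0 < r \<Longrightarrow> r < 1 \<Longrightarrow> (\<integral>\<zeta>. (cmod (h (r *\<^sub>R \<zeta>)))\<^sup>2 \<partial>\<sigma>) \<le> B"
  shows "(\<Sum>k<n. coeff_norm2 h k) \<le> B"
proof (rule tendsto_upperbound)
  show "((\<lambda>r. \<Sum>k<n. coeff_norm2 h k * (r ^ k)\<^sup>2) \<longlongrightarrow> (\<Sum>k<n. coeff_norm2 h k)) (at_left 1)"
    by (auto intro!: tendsto_eq_intros)
  have "(\<Sum>k<n. coeff_norm2 h k * (r ^ k)\<^sup>2) \<le> B" if r: "r \<in> {0<..<1}" for r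
  proof -
    note s = sphere_norm_sums[OF h, of r]
    have "(\<Sum>k<n. coeff_norm2 h k * (r ^ k)\<^sup>2) \<le> (\<Sum>k. coeff_norm2 h k * (r ^ k)\<^sup>2)"
      by (rule sum_le_suminf) (use s r in \<open>auto simp: coeff_norm2_nonneg sums_iff\<close>)
    also have "\<dots> = (\<integral>\<zeta>. (cmod (h (r *\<^sub>R \<zeta>)))\<^sup>2 \<partial>\<sigma>)" using s r by (simp add: sums_iff)
    also have "\<dots> \<le> B" using B r by auto
    finally show ?thesis .
  qed
  moreover have "eventually (\<lambda>r. r \<in> {0<..<1}) (at_left (1 :: real))"
    by (rule eventually_at_left_real) simp
  ultimately show "eventually (\<lambda>r. (\<Sum>k<n. coeff_norm2 h k * (r ^ k)\<^sup>2) \<le> B) (at_left 1)"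
    by (auto elim!: eventually_mono)
qed simp

lemma sphere_norm_le_coeff_sum:
  fixes h :: "complex ^ 'n \<Rightarrow> complex"
  assumes h: "holomorphic_fun_on h (ball 0 1)" and s: "summable (coeff_norm2 h)" and r: "0 \<le> r" "r < 1"
  shows "(\<integral>\<zeta>. (cmod (h (r *\<^sub>R \<zeta>)))\<^sup>2 \<partial>\<sigma>) \<le> suminf (coeff_norm2 h)"
proof (rule sums_le[OF _ sphere_norm_sums[OF h r] summable_sums[OF s]])
  fix k
  have "(r ^ k)\<^sup>2 \<le> 1" using r by (simp add: power_le_one)
  then show "coeff_norm2 h k * (r ^ k)\<^sup>2 \<le> coeff_norm2 h k" by (simp add: coeff_norm2_nonneg mult_left_le)
qed

lemma Hardy2I:
  fixes h :: "complex ^ 'n \<Rightarrow> complex"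
  assumes "holomorphic_fun_on h (ball 0 1)" "\<And>z. z \<notin> ball 0 1 \<Longrightarrow> h z = 0"
    and "\<And>r. 0 < r \<Longrightarrow> r < 1 \<Longrightarrow> (\<integral>\<zeta>. (cmod (h (r *\<^sub>R \<zeta>)))\<^sup>2 \<partial>\<sigma>) \<le> B"
  shows "h \<in> Hardy2"
  using assms unfolding Hardy2_def by (auto intro!: bdd_aboveI2[where M = B])

text \<open>
  Monotone convergence of the weights \<open>r ^ (2 k)\<close> as \<open>r\<close> tends to \<open>1\<close>.
\<close>

lemma Hardy2_coeff_sums:
  fixes h :: "complex ^ 'n \<Rightarrow> complex"
  assumes h: "h \<in> Hardy2"
  shows "coeff_norm2 h sums (Hardy2_norm h)\<^sup>2"
proof -
  let ?N = "\<lambda>r. \<integral>\<zeta>. (cmod (h (r *\<^sub>R \<zeta>)))\<^sup>2 \<partial>\<sigma>"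
  let ?S = "SUP r\<in>{0<..<1}. ?N r"
  note D = Hardy2D[OF h]
  have le: "?N r \<le> ?S" if "0 < r" "r < 1" for r
    by (rule cSUP_upper[OF _ D(3)]) (use that in auto)
  have part: "(\<Sum>k<n. coeff_norm2 h k) \<le> ?S" for n
    by (rule sum_coeff_norm2_le[OF D(1) le])
  have sum: "summable (coeff_norm2 h)"
    by (rule summableI_nonneg_bounded[OF _ part]) (rule coeff_norm2_nonneg)
  have "suminf (coeff_norm2 h) \<le> ?S" by (rule suminf_le_const[OF sum part])
  moreover have "?S \<le> suminf (coeff_norm2 h)"
    by (rule cSUP_least) (auto intro!: sphere_norm_le_coeff_sum[OF D(1) sum])
  ultimately have "suminf (coeff_norm2 h) = ?S" by simp
  moreover have "0 \<le> suminf (coeff_norm2 h)" by (rule suminf_nonneg[OF sum coeff_norm2_nonneg])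
  ultimately show ?thesis
    using summable_sums[OF sum] by (simp add: Hardy2_norm_def)
qed

lemma Hardy2_norm_nonneg: "h \<in> Hardy2 \<Longrightarrow> 0 \<le> Hardy2_norm h"
  unfolding Hardy2_norm_def
  by (intro real_sqrt_ge_zero order_trans[OF _ cSUP_upper[OF _ Hardy2D(3), of "1 / 2"]]) auto

text \<open>
  The squared distance between \<open>h\<close> and its dilation by \<open>r\<close>, expressed by homogeneous components.  It
  bounds the distance between any two dilations that differ by the factor \<open>r\<close>.
\<close>

definition dilation_defect :: "(complex ^ 'n \<Rightarrow> complex) \<Rightarrow> real \<Rightarrow> real" where
  "dilation_defect h r = (\<Sum>k. coeff_norm2 h k * (1 - r ^ k)\<^sup>2)"

lemma dilation_defect_summable:
  assumes h: "h \<in> Hardy2" and r: "0 \<le> r" "r \<le> 1"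
  shows "summable (\<lambda>k. coeff_norm2 h k * (1 - r ^ k)\<^sup>2)"
proof (rule summable_comparison_test'[OF sums_summable[OF Hardy2_coeff_sums[OF h]]])
  fix k
  have "(1 - r ^ k)\<^sup>2 \<le> 1" using r by (intro power_le_one) (auto simp: power_le_one)
  then show "norm (coeff_norm2 h k * (1 - r ^ k)\<^sup>2) \<le> coeff_norm2 h k"
    by (simp add: coeff_norm2_nonneg mult_left_le)
qed

lemma dilation_defect_tendsto:
  assumes h: "h \<in> Hardy2"
  shows "(dilation_defect h \<longlongrightarrow> 0) (at_left 1)"
proof -
  have "((\<lambda>r. \<Sum>k. coeff_norm2 h k * (1 - r ^ k)\<^sup>2) \<longlongrightarrow> (\<Sum>k. 0)) (at_left (1 :: real))"
  proof (rule tannerys_theorem[THEN conjunct2, THEN conjunct2])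
    show "((\<lambda>r. coeff_norm2 h k * (1 - r ^ k)\<^sup>2) \<longlongrightarrow> 0) (at_left (1 :: real))" for k
      by (auto intro!: tendsto_eq_intros)
    have "eventually (\<lambda>r. r \<in> {0<..<1}) (at_left (1 :: real))"
      by (rule eventually_at_left_real) simp
    then have ev: "eventually (\<lambda>r. \<forall>k. norm (coeff_norm2 h k * (1 - r ^ k)\<^sup>2) \<le> coeff_norm2 h k) (at_left (1 :: real))"
    proof eventually_elim
      case (elim r)
      have "(1 - r ^ k)\<^sup>2 \<le> 1" for k using elim by (intro power_le_one) (auto simp: power_le_one)
      then show ?case by (simp add: coeff_norm2_nonneg mult_left_le)
    qed
    show "eventually (\<lambda>(k, r). norm (coeff_norm2 h k * (1 - r ^ k)\<^sup>2) \<le> coeff_norm2 h k) (at_top \<times>\<^sub>F at_left 1)"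
      by (rule eventually_mono[OF eventually_prodI[OF eventually_True[of at_top] ev]]) (simp add: split_beta)
    show "summable (coeff_norm2 h)" by (rule sums_summable[OF Hardy2_coeff_sums[OF h]])
  qed simp
  then show ?thesis unfolding dilation_defect_def[abs_def] by simp
qed

lemma sphere_norm_diff_le_defect:
  assumes h: "h \<in> Hardy2" and r: "0 \<le> r" "r \<le> s" "s < 1"
  shows "(\<integral>\<zeta>. (cmod (h (r *\<^sub>R \<zeta>) - h (s *\<^sub>R \<zeta>)))\<^sup>2 \<partial>\<sigma>) \<le> dilation_defect h r"
  unfolding dilation_defect_def
proof (rule sums_le[OF _ sphere_norm_diff_sums[OF Hardy2D(1)[OF h]] summable_sums[OF dilation_defect_summable[OF h]]])
  fix k
  have "r ^ k \<le> s ^ k" "s ^ k \<le> 1" using r by (auto intro!: power_mono power_le_one)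
  then have "(s ^ k - r ^ k)\<^sup>2 \<le> (1 - r ^ k)\<^sup>2" by (intro power_mono) auto
  then show "coeff_norm2 h k * (r ^ k - s ^ k)\<^sup>2 \<le> coeff_norm2 h k * (1 - r ^ k)\<^sup>2"
    by (intro mult_left_mono coeff_norm2_nonneg) (simp add: power2_commute)
qed (use r in auto)

lemma dilated_difference_le_defect:
  assumes h: "h \<in> Hardy2" and r: "0 \<le> t" "t < 1" "0 \<le> s" "s < 1"
  shows "(\<integral>\<zeta>. (cmod (h (s *\<^sub>R \<zeta>) - h ((t * s) *\<^sub>R \<zeta>)))\<^sup>2 \<partial>\<sigma>) \<le> dilation_defect h t"
  unfolding dilation_defect_def
proof (rule sums_le[OF _ sphere_norm_diff_sums[OF Hardy2D(1)[OF h]] summable_sums[OF dilation_defect_summable[OF h]]])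
  show "t * s < 1" using r mult_left_le[of s t] by (metis less_le_trans less_eq_real_def mult.commute not_less)
  fix k
  have "s ^ k - (t * s) ^ k = s ^ k * (1 - t ^ k)" by (simp add: power_mult_distrib algebra_simps)
  also have "\<dots> \<le> 1 * (1 - t ^ k)" using r by (intro mult_right_mono) (auto simp: power_le_one)
  finally have "s ^ k - (t * s) ^ k \<le> 1 - t ^ k" by simp
  moreover have "0 \<le> s ^ k * (1 - t ^ k)" using r by (auto simp: power_le_one)
  ultimately have "(s ^ k - (t * s) ^ k)\<^sup>2 \<le> (1 - t ^ k)\<^sup>2"
    using \<open>s ^ k - (t * s) ^ k = s ^ k * (1 - t ^ k)\<close> by (intro power_mono) auto
  then show "coeff_norm2 h k * (s ^ k - (t * s) ^ k)\<^sup>2 \<le> coeff_norm2 h k * (1 - t ^ k)\<^sup>2"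
    by (intro mult_left_mono coeff_norm2_nonneg)
qed (use r in auto)

section \<open>Radial limits\<close>

definition radius_seq :: "nat \<Rightarrow> real" where
  "radius_seq n = real (Suc n) / real (Suc (Suc n))"

lemma radius_seq: "0 < radius_seq n" "radius_seq n < 1" "radius_seq \<longlonglongrightarrow> 1"
  using LIMSEQ_Suc[OF LIMSEQ_n_over_Suc_n[where 'a = real]] by (auto simp: radius_seq_def[abs_def])

lemma radius_seq_at_left: "filterlim radius_seq (at_left 1) sequentially"
  by (rule tendsto_imp_filterlim_at_left[OF radius_seq(3)]) (use radius_seq(2) in auto)

text \<open>
  The maximal inequality holds for functions that are holomorphic beyond the closed ball, such as
  \<open>z \<mapsto> h (s z) - h (t s z)\<close> for \<open>s < 1\<close>.  The exceptional sets increase with \<open>s\<close>, and their measure is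
  bounded independently of \<open>s\<close>.
\<close>

lemma dilation_maximal_inequality:
  fixes h :: "complex ^ 'n \<Rightarrow> complex"
  assumes h: "h \<in> Hardy2" and t: "0 \<le> t" "t < 1" and l: "0 < l"
  defines "X \<equiv> {\<zeta> \<in> sphere 0 1. \<exists>r\<in>{0..<1}. l < (cmod (h (r *\<^sub>R \<zeta>) - h ((t * r) *\<^sub>R \<zeta>)))\<^sup>2}"
  shows "X \<in> sets \<sigma>" and "measure \<sigma> X \<le> 2 * dilation_defect h t / l"
proof -
  define s where "s = radius_seq"
  have s: "0 < s n" "s n < 1" "s n \<le> s (Suc n)" for n by (auto simp: s_def radius_seq_def field_simps)
  have s_lim: "s \<longlonglongrightarrow> 1" unfolding s_def by (rule radius_seq(3))
  define g where "g n z = h (s n *\<^sub>R z) - h ((t * s n) *\<^sub>R z)" for n z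
  define Y where "Y n = {\<zeta> \<in> sphere 0 1. \<exists>r\<in>{0..<1}. l < (cmod (g n (r *\<^sub>R \<zeta>)))\<^sup>2}" for n
  have Y_iff: "\<zeta> \<in> Y n \<longleftrightarrow> \<zeta> \<in> sphere 0 1 \<and> (\<exists>r\<in>{0..<s n}. l < (cmod (h (r *\<^sub>R \<zeta>) - h ((t * r) *\<^sub>R \<zeta>)))\<^sup>2)" for \<zeta> n
  proof (intro iffI conjI)
    assume "\<zeta> \<in> Y n"
    then obtain r where r: "0 \<le> r" "r < 1" "l < (cmod (g n (r *\<^sub>R \<zeta>)))\<^sup>2" by (auto simp: Y_def)
    then show "\<exists>r\<in>{0..<s n}. l < (cmod (h (r *\<^sub>R \<zeta>) - h ((t * r) *\<^sub>R \<zeta>)))\<^sup>2"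
      using s[of n] by (intro bexI[of _ "s n * r"]) (auto simp: g_def mult_ac)
  next
    assume "\<zeta> \<in> sphere 0 1 \<and> (\<exists>r\<in>{0..<s n}. l < (cmod (h (r *\<^sub>R \<zeta>) - h ((t * r) *\<^sub>R \<zeta>)))\<^sup>2)"
    then obtain r where r: "\<zeta> \<in> sphere 0 1" "0 \<le> r" "r < s n" "l < (cmod (h (r *\<^sub>R \<zeta>) - h ((t * r) *\<^sub>R \<zeta>)))\<^sup>2" by auto
    then show "\<zeta> \<in> Y n"
      using s[of n] by (auto simp: Y_def g_def intro!: bexI[of _ "r / s n"])
  qed (auto simp: Y_def)
  have hol: "holomorphic_fun_on (g n) (ball 0 (1 / s n))" for n
  proof -
    have "t * s n \<le> 1 * s n" using t s[of n] by (intro mult_right_mono) auto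
    then have "holomorphic_fun_on (\<lambda>z. 1 * h (s n *\<^sub>R z) + (- 1) * h ((t * s n) *\<^sub>R z)) (ball 0 (1 / s n))"
      using t s[of n]
      by (intro holomorphic_fun_on_lincomb holomorphic_dilate[OF Hardy2D(1)[OF h]]) (auto simp: less_imp_le)
    then show ?thesis unfolding g_def[abs_def] by simp
  qed
  have Ym: "Y n \<in> sets \<sigma>" for n
    unfolding Y_def by (rule radial_maximal_inequality(1)[OF hol _ l]) (use s in auto)
  have Yb: "measure \<sigma> (Y n) \<le> 2 * dilation_defect h t / l" for n
  proof -
    have "measure \<sigma> (Y n) \<le> 2 * (\<integral>\<zeta>. (cmod (g n \<zeta>))\<^sup>2 \<partial>\<sigma>) / l"
      unfolding Y_def by (rule radial_maximal_inequality(2)[OF hol _ l]) (use s in auto)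
    also have "(\<integral>\<zeta>. (cmod (g n \<zeta>))\<^sup>2 \<partial>\<sigma>) \<le> dilation_defect h t"
      unfolding g_def by (rule dilated_difference_le_defect[OF h t]) (use s[of n] in auto)
    finally show ?thesis using l by (simp add: divide_right_mono)
  qed
  have inc: "incseq Y"
  proof (rule incseq_SucI, rule subsetI)
    fix n \<zeta> assume "\<zeta> \<in> Y n"
    then show "\<zeta> \<in> Y (Suc n)" using s(3)[of n] unfolding Y_iff by force
  qed
  have UY: "X = (\<Union>n. Y n)"
  proof (intro equalityI subsetI)
    fix \<zeta> assume "\<zeta> \<in> X"
    then obtain r where r: "\<zeta> \<in> sphere 0 1" "0 \<le> r" "r < 1" "l < (cmod (h (r *\<^sub>R \<zeta>) - h ((t * r) *\<^sub>R \<zeta>)))\<^sup>2"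
      by (auto simp: X_def)
    have "eventually (\<lambda>n. r < s n) sequentially" by (rule order_tendstoD(1)[OF s_lim r(3)])
    then obtain n where "r < s n" using eventually_happens by fastforce
    with r have "\<zeta> \<in> Y n" unfolding Y_iff by auto
    then show "\<zeta> \<in> (\<Union>n. Y n)" by blast
  next
    fix \<zeta> assume "\<zeta> \<in> (\<Union>n. Y n)"
    then obtain n r where "\<zeta> \<in> sphere 0 1" "0 \<le> r" "r < s n" "l < (cmod (h (r *\<^sub>R \<zeta>) - h ((t * r) *\<^sub>R \<zeta>)))\<^sup>2"
      unfolding UN_iff Y_iff by auto
    then show "\<zeta> \<in> X" using s(2)[of n] by (auto simp: X_def intro!: bexI[of _ r])
  qed
  show "X \<in> sets \<sigma>" unfolding UY using Ym by auto
  have "(\<lambda>n. measure \<sigma> (Y n)) \<longlonglongrightarrow> measure \<sigma> X"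
    unfolding UY by (rule sphere.finite_Lim_measure_incseq[OF _ inc]) (use Ym in auto)
  then show "measure \<sigma> X \<le> 2 * dilation_defect h t / l"
    by (rule LIMSEQ_le_const2) (use Yb in auto)
qed

lemma norm_diff_chain: "norm (a - b) \<le> norm (a - c) + norm (c - d) + norm (b - d)"
  for a b c d :: "'a :: real_normed_vector"
  using dist_triangle[of a b c] dist_triangle[of c b d] by (simp add: dist_norm norm_minus_commute[of d b])

text \<open>
  Cauchy's criterion for the radial limit, with rational radii only: in this form it defines a
  measurable set of points.
\<close>

definition radially_cauchy :: "(complex ^ 'n \<Rightarrow> complex) \<Rightarrow> complex ^ 'n \<Rightarrow> bool" where
  "radially_cauchy h \<zeta> \<longleftrightarrow> (\<forall>m. \<exists>n. \<forall>p q :: rat.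
     1 - 1 / real (Suc n) < of_rat p \<and> of_rat p < (1 :: real) \<and> 1 - 1 / real (Suc n) < of_rat q \<and> of_rat q < (1 :: real)
     \<longrightarrow> cmod (h (of_rat p *\<^sub>R \<zeta>) - h (of_rat q *\<^sub>R \<zeta>)) \<le> 1 / real (Suc m))"

lemma radial_path_continuous:
  fixes h :: "complex ^ 'n \<Rightarrow> complex"
  assumes "holomorphic_fun_on h (ball 0 1)" "norm \<zeta> = 1"
  shows "continuous_on {-1<..<1} (\<lambda>r. h (r *\<^sub>R \<zeta>))"
  by (rule continuous_on_compose2[OF holomorphic_fun_on_imp_continuous_on[OF assms(1)]])
     (use assms(2) in \<open>auto intro!: continuous_intros\<close>)

lemma rat_between_real: "a < (b :: real) \<Longrightarrow> \<exists>q. a < of_rat q \<and> of_rat q < b"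
  using of_rat_dense by blast

lemma radially_cauchy_real:
  fixes h :: "complex ^ 'n \<Rightarrow> complex"
  assumes h: "holomorphic_fun_on h (ball 0 1)" and \<zeta>: "norm \<zeta> = 1" and c: "radially_cauchy h \<zeta>"
  shows "\<exists>d<1. \<forall>r s. d < r \<longrightarrow> r < 1 \<longrightarrow> d < s \<longrightarrow> s < 1 \<longrightarrow> cmod (h (r *\<^sub>R \<zeta>) - h (s *\<^sub>R \<zeta>)) \<le> 1 / real (Suc m)"
proof -
  obtain n where n: "\<And>p q :: rat. 1 - 1 / real (Suc n) < of_rat p \<Longrightarrow> of_rat p < (1 :: real) \<Longrightarrow> 1 - 1 / real (Suc n) < of_rat q \<Longrightarrow> of_rat q < (1 :: real)
     \<Longrightarrow> cmod (h (of_rat p *\<^sub>R \<zeta>) - h (of_rat q *\<^sub>R \<zeta>)) \<le> 1 / real (Suc m)"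
    using c unfolding radially_cauchy_def by meson
  define d where "d = 1 - 1 / real (Suc n)"
  have d: "0 \<le> d" "d < 1" by (auto simp: d_def)
  have seq: "\<exists>p :: nat \<Rightarrow> rat. (\<forall>k. d < of_rat (p k) \<and> of_rat (p k) < r) \<and> (\<lambda>k. of_rat (p k)) \<longlonglongrightarrow> r"
    if r: "d < r" "r < 1" for r :: real
  proof -
    have "\<exists>q :: rat. max d (r - 1 / real (Suc k)) < of_rat q \<and> of_rat q < r" for k
      by (rule rat_between_real) (use r in auto)
    then obtain p :: "nat \<Rightarrow> rat" where p: "\<And>k. max d (r - 1 / real (Suc k)) < of_rat (p k)" "\<And>k. of_rat (p k) < r"
      by metis
    have "(\<lambda>k. of_rat (p k)) \<longlonglongrightarrow> r"
    proof (rule tendsto_sandwich)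
      show "(\<lambda>k. r - 1 / real (Suc k)) \<longlonglongrightarrow> r"
        using tendsto_diff[OF tendsto_const lim_1_over_n[where 'a = real, THEN LIMSEQ_Suc], of r] by simp
      show "eventually (\<lambda>k. r - 1 / real (Suc k) \<le> of_rat (p k)) sequentially"
        using p(1) by (intro always_eventually allI) (simp add: less_imp_le)
      show "eventually (\<lambda>k. of_rat (p k) \<le> r) sequentially"
        using p(2) by (intro always_eventually allI) (simp add: less_imp_le)
    qed simp
    with p show ?thesis by auto
  qed
  show ?thesis
  proof (intro exI[of _ d] conjI d(2) allI impI)
    fix r s assume r: "d < r" "r < 1" and s: "d < s" "s < 1"
    obtain p :: "nat \<Rightarrow> rat" where p: "\<And>k. d < of_rat (p k)" "\<And>k. of_rat (p k) < r" "(\<lambda>k. of_rat (p k)) \<longlonglongrightarrow> r"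
      using seq[OF r] by auto
    obtain q :: "nat \<Rightarrow> rat" where q: "\<And>k. d < of_rat (q k)" "\<And>k. of_rat (q k) < s" "(\<lambda>k. of_rat (q k)) \<longlonglongrightarrow> s"
      using seq[OF s] by auto
    note cont = radial_path_continuous[OF h \<zeta>]
    have pin: "of_rat (p k) \<in> {-1<..<1 :: real}" for k using p(1,2)[of k] r d unfolding greaterThanLessThan_iff by linarith
    have qin: "of_rat (q k) \<in> {-1<..<1 :: real}" for k using q(1,2)[of k] s d unfolding greaterThanLessThan_iff by linarith
    have lp: "(\<lambda>k. h (of_rat (p k) *\<^sub>R \<zeta>)) \<longlonglongrightarrow> h (r *\<^sub>R \<zeta>)"
      by (rule continuous_on_tendsto_compose[OF cont p(3)]) (use r d pin in auto)
    have lq: "(\<lambda>k. h (of_rat (q k) *\<^sub>R \<zeta>)) \<longlonglongrightarrow> h (s *\<^sub>R \<zeta>)"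
      by (rule continuous_on_tendsto_compose[OF cont q(3)]) (use s d qin in auto)
    have "(\<lambda>k. cmod (h (of_rat (p k) *\<^sub>R \<zeta>) - h (of_rat (q k) *\<^sub>R \<zeta>))) \<longlonglongrightarrow> cmod (h (r *\<^sub>R \<zeta>) - h (s *\<^sub>R \<zeta>))"
      by (intro tendsto_norm tendsto_diff lp lq)
    then show "cmod (h (r *\<^sub>R \<zeta>) - h (s *\<^sub>R \<zeta>)) \<le> 1 / real (Suc m)"
    proof (rule LIMSEQ_le_const2)
      show "\<exists>N. \<forall>k\<ge>N. cmod (h (of_rat (p k) *\<^sub>R \<zeta>) - h (of_rat (q k) *\<^sub>R \<zeta>)) \<le> 1 / real (Suc m)"
        using n[OF p(1)[unfolded d_def] less_trans[OF p(2) r(2)] q(1)[unfolded d_def] less_trans[OF q(2) s(2)]] by blast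
    qed
  qed
qed

lemma radially_cauchy_iff:
  fixes h :: "complex ^ 'n \<Rightarrow> complex"
  assumes h: "holomorphic_fun_on h (ball 0 1)" and \<zeta>: "norm \<zeta> = 1"
  shows "radially_cauchy h \<zeta> \<longleftrightarrow> (\<exists>L. ((\<lambda>r. h (r *\<^sub>R \<zeta>)) \<longlongrightarrow> L) (at_left 1))"
proof
  assume c: "radially_cauchy h \<zeta>"
  have osc: "\<exists>d<1. \<forall>r s. d < r \<longrightarrow> r < 1 \<longrightarrow> d < s \<longrightarrow> s < 1 \<longrightarrow> dist (h (r *\<^sub>R \<zeta>)) (h (s *\<^sub>R \<zeta>)) < e" if e: "e > 0" for e
  proof -
    obtain m where m: "1 / real (Suc m) < e" using nat_approx_posE[OF e] .
    obtain d where d: "d < 1" "\<And>r s. d < r \<Longrightarrow> r < 1 \<Longrightarrow> d < s \<Longrightarrow> s < 1 \<Longrightarrow> cmod (h (r *\<^sub>R \<zeta>) - h (s *\<^sub>R \<zeta>)) \<le> 1 / real (Suc m)"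
      using radially_cauchy_real[OF h \<zeta> c, of m] by blast
    show ?thesis
      unfolding dist_norm
      by (intro exI[of _ d] conjI allI impI d(1)) (rule le_less_trans[OF d(2) m])
  qed
  have "Cauchy (\<lambda>n. h (radius_seq n *\<^sub>R \<zeta>))"
    unfolding Cauchy_def
  proof (intro allI impI)
    fix e :: real assume "e > 0"
    then obtain d where d: "d < 1" "\<And>r s. d < r \<Longrightarrow> r < 1 \<Longrightarrow> d < s \<Longrightarrow> s < 1 \<Longrightarrow> dist (h (r *\<^sub>R \<zeta>)) (h (s *\<^sub>R \<zeta>)) < e"
      using osc by meson
    from order_tendstoD(1)[OF radius_seq(3) d(1)] obtain N where "\<And>n. n \<ge> N \<Longrightarrow> d < radius_seq n"
      unfolding eventually_sequentially by blast
    then show "\<exists>M. \<forall>m\<ge>M. \<forall>n\<ge>M. dist (h (radius_seq m *\<^sub>R \<zeta>)) (h (radius_seq n *\<^sub>R \<zeta>)) < e"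
      using d(2) radius_seq(2) by blast
  qed
  then obtain L where L: "(\<lambda>n. h (radius_seq n *\<^sub>R \<zeta>)) \<longlonglongrightarrow> L" using Cauchy_convergent convergent_def by blast
  have "((\<lambda>r. h (r *\<^sub>R \<zeta>)) \<longlongrightarrow> L) (at_left 1)"
  proof (rule tendstoI)
    fix e :: real assume e: "e > 0"
    then obtain d where d: "d < 1" "\<And>r s. d < r \<Longrightarrow> r < 1 \<Longrightarrow> d < s \<Longrightarrow> s < 1 \<Longrightarrow> dist (h (r *\<^sub>R \<zeta>)) (h (s *\<^sub>R \<zeta>)) < e / 2"
      using osc[of "e / 2"] by auto
    have "eventually (\<lambda>n. dist (h (radius_seq n *\<^sub>R \<zeta>)) L < e / 2 \<and> d < radius_seq n) sequentially"
      using e by (intro eventually_conj tendstoD[OF L] order_tendstoD(1)[OF radius_seq(3) d(1)]) auto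
    then obtain n where n: "dist (h (radius_seq n *\<^sub>R \<zeta>)) L < e / 2" "d < radius_seq n" using eventually_happens by fastforce
    have "dist (h (r *\<^sub>R \<zeta>)) L < e" if "d < r" "r < 1" for r
      using d(2)[OF that n(2) radius_seq(2)] n(1) dist_triangle[of "h (r *\<^sub>R \<zeta>)" L "h (radius_seq n *\<^sub>R \<zeta>)"]
      by linarith
    moreover have "eventually (\<lambda>r. r \<in> {d<..<1}) (at_left 1)" by (rule eventually_at_left_real[OF d(1)])
    ultimately show "eventually (\<lambda>r. dist (h (r *\<^sub>R \<zeta>)) L < e) (at_left 1)" by (auto elim!: eventually_mono)
  qed
  then show "\<exists>L. ((\<lambda>r. h (r *\<^sub>R \<zeta>)) \<longlongrightarrow> L) (at_left 1)" ..
next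
  assume "\<exists>L. ((\<lambda>r. h (r *\<^sub>R \<zeta>)) \<longlongrightarrow> L) (at_left 1)"
  then obtain L where L: "((\<lambda>r. h (r *\<^sub>R \<zeta>)) \<longlongrightarrow> L) (at_left 1)" ..
  show "radially_cauchy h \<zeta>"
    unfolding radially_cauchy_def
  proof
    fix m
    have "eventually (\<lambda>r. dist (h (r *\<^sub>R \<zeta>)) L < 1 / real (Suc m) / 2) (at_left 1)"
      by (rule tendstoD[OF L]) simp
    then obtain b where b: "b < 1" "\<And>r. b < r \<Longrightarrow> r < 1 \<Longrightarrow> dist (h (r *\<^sub>R \<zeta>)) L < 1 / real (Suc m) / 2"
      unfolding eventually_at_left[OF zero_less_one] by auto
    obtain n where n: "1 / real (Suc n) < 1 - b" using nat_approx_posE[of "1 - b"] b(1) by auto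
    have "cmod (h (of_rat p *\<^sub>R \<zeta>) - h (of_rat q *\<^sub>R \<zeta>)) \<le> 1 / real (Suc m)"
      if "1 - 1 / real (Suc n) < of_rat p" "of_rat p < (1 :: real)" "1 - 1 / real (Suc n) < of_rat q" "of_rat q < (1 :: real)" for p q
      using dist_triangle_half_l[OF b(2)[of "of_rat p"] b(2)[of "of_rat q"]] that n by (simp add: dist_norm)
    then show "\<exists>n. \<forall>p q. 1 - 1 / real (Suc n) < of_rat p \<and> of_rat p < (1 :: real) \<and> 1 - 1 / real (Suc n) < of_rat q \<and> of_rat q < (1 :: real)
        \<longrightarrow> cmod (h (of_rat p *\<^sub>R \<zeta>) - h (of_rat q *\<^sub>R \<zeta>)) \<le> 1 / real (Suc m)" by blast
  qed
qed

text \<open>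
  Fatou's theorem.  At a point outside the exceptional sets of the maximal inequality for
  \<open>h - h(t \<cdot>)\<close>, the oscillation of \<open>h\<close> along the radius is that of \<open>h(t \<cdot>)\<close> up to a small
  error, and the latter function is continuous on the closed ball.
\<close>

theorem Hardy2_radial_limits:
  fixes h :: "complex ^ 'n \<Rightarrow> complex"
  assumes h: "h \<in> Hardy2"
  shows "AE \<zeta> in \<sigma>. \<exists>L. ((\<lambda>r. h (r *\<^sub>R \<zeta>)) \<longlongrightarrow> L) (at_left 1)"
proof -
  define l where "l m = (1 / (3 * real (Suc m)))\<^sup>2" for m
  have l: "0 < l m" for m by (simp add: l_def)
  define X where "X m j = {\<zeta> \<in> sphere 0 1. \<exists>r\<in>{0..<1}. l m < (cmod (h (r *\<^sub>R \<zeta>) - h ((radius_seq j * r) *\<^sub>R \<zeta>)))\<^sup>2}" for m j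
  have X: "X m j \<in> sets \<sigma>" "measure \<sigma> (X m j) \<le> 2 * dilation_defect h (radius_seq j) / l m" for m j
    unfolding X_def using dilation_maximal_inequality[OF h less_imp_le[OF radius_seq(1)] radius_seq(2) l] by auto
  have "(\<lambda>j. 2 * dilation_defect h (radius_seq j) / l m) \<longlonglongrightarrow> 2 * 0 / l m" for m
    by (intro tendsto_intros filterlim_compose[OF dilation_defect_tendsto[OF h] radius_seq_at_left]) (use l[of m] in simp)
  then have lim: "(\<lambda>j. 2 * dilation_defect h (radius_seq j) / l m) \<longlonglongrightarrow> 0" for m by simp
  have null: "(\<Inter>j. X m j) \<in> null_sets \<sigma>" for m
  proof -
    have "measure \<sigma> (\<Inter>j. X m j) \<le> 2 * dilation_defect h (radius_seq j) / l m" for j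
      by (rule order_trans[OF sphere.finite_measure_mono X(2)]) (use X(1) in auto)
    then have "measure \<sigma> (\<Inter>j. X m j) \<le> 0"
      by (intro LIMSEQ_le_const[OF lim]) auto
    then have "emeasure \<sigma> (\<Inter>j. X m j) = 0"
      by (simp add: sphere.emeasure_eq_measure measure_le_0_iff)
    then show ?thesis using X(1) by (intro null_setsI) auto
  qed
  have "(\<Union>m. \<Inter>j. X m j) \<in> null_sets \<sigma>" using null by auto
  then show ?thesis
  proof (rule AE_I')
    show "{\<zeta> \<in> space \<sigma>. \<not> (\<exists>L. ((\<lambda>r. h (r *\<^sub>R \<zeta>)) \<longlongrightarrow> L) (at_left 1))} \<subseteq> (\<Union>m. \<Inter>j. X m j)"
    proof (rule subsetI, rule ccontr)
      fix \<zeta> assume \<zeta>: "\<zeta> \<in> {\<zeta> \<in> space \<sigma>. \<not> (\<exists>L. ((\<lambda>r. h (r *\<^sub>R \<zeta>)) \<longlongrightarrow> L) (at_left 1))}"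
        and "\<zeta> \<notin> (\<Union>m. \<Inter>j. X m j)"
      then have z: "norm \<zeta> = 1" and ex: "\<And>m. \<exists>j. \<zeta> \<notin> X m j" by auto
      have "radially_cauchy h \<zeta>"
        unfolding radially_cauchy_def
      proof
        fix m
        obtain j where j: "\<zeta> \<notin> X m j" using ex by blast
        let ?t = "radius_seq j"
        let ?e = "1 / (3 * real (Suc m))"
        have near: "cmod (h (r *\<^sub>R \<zeta>) - h ((?t * r) *\<^sub>R \<zeta>)) \<le> ?e" if "0 \<le> r" "r < 1" for r
        proof -
          have "(cmod (h (r *\<^sub>R \<zeta>) - h ((?t * r) *\<^sub>R \<zeta>)))\<^sup>2 \<le> ?e\<^sup>2"
            using j that z by (auto simp: X_def l_def not_less)
          then show ?thesis by (rule power2_le_imp_le) simp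
        qed
        have "isCont (\<lambda>r. h (r *\<^sub>R \<zeta>)) ?t"
          using radial_path_continuous[OF Hardy2D(1)[OF h] z] radius_seq(1,2)[of j]
          by (auto simp: continuous_on_eq_continuous_at)
        then obtain d where d: "d > 0" "\<And>r. dist r ?t < d \<Longrightarrow> dist (h (r *\<^sub>R \<zeta>)) (h (?t *\<^sub>R \<zeta>)) < ?e / 2"
          unfolding continuous_at_eps_delta by (drule_tac spec[of _ "?e / 2"]) auto
        obtain n where n: "1 / real (Suc n) < d" using nat_approx_posE[OF d(1)] .
        have close: "dist (h ((?t * r) *\<^sub>R \<zeta>)) (h (?t *\<^sub>R \<zeta>)) < ?e / 2" if "1 - 1 / real (Suc n) < r" "r < 1" for r
        proof (rule d(2))
          have "dist (?t * r) ?t = ?t * (1 - r)"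
            using that radius_seq(1,2)[of j] by (simp add: dist_real_def abs_if algebra_simps)
          also have "\<dots> \<le> 1 * (1 - r)" using that radius_seq(1,2)[of j] by (intro mult_right_mono) auto
          finally show "dist (?t * r) ?t < d" using that n by simp
        qed
        have "cmod (h (p *\<^sub>R \<zeta>) - h (q *\<^sub>R \<zeta>)) \<le> 1 / real (Suc m)"
          if p: "1 - 1 / real (Suc n) < p" "p < 1" and q: "1 - 1 / real (Suc n) < q" "q < 1" for p q :: real
        proof -
          have "0 \<le> 1 - 1 / real (Suc n)" by simp
          then have pos: "0 \<le> p" "0 \<le> q" using p q by linarith+
          have "dist (h ((?t * p) *\<^sub>R \<zeta>)) (h ((?t * q) *\<^sub>R \<zeta>)) < ?e"
            using close[OF p] close[OF q] by (rule dist_triangle_half_l)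
          then have "cmod (h ((?t * p) *\<^sub>R \<zeta>) - h ((?t * q) *\<^sub>R \<zeta>)) \<le> ?e" by (simp add: dist_norm)
          moreover note norm_diff_chain[of "h (p *\<^sub>R \<zeta>)" "h (q *\<^sub>R \<zeta>)" "h ((?t * p) *\<^sub>R \<zeta>)" "h ((?t * q) *\<^sub>R \<zeta>)"]
          ultimately have "cmod (h (p *\<^sub>R \<zeta>) - h (q *\<^sub>R \<zeta>)) \<le> 3 * ?e"
            using near[OF pos(1) p(2)] near[OF pos(2) q(2)] by linarith
          also have "3 * ?e = 1 / real (Suc m)" by (simp add: field_simps)
          finally show ?thesis .
        qed
        then show "\<exists>n. \<forall>p q. 1 - 1 / real (Suc n) < of_rat p \<and> of_rat p < (1 :: real) \<and> 1 - 1 / real (Suc n) < of_rat q \<and> of_rat q < (1 :: real)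
          \<longrightarrow> cmod (h (of_rat p *\<^sub>R \<zeta>) - h (of_rat q *\<^sub>R \<zeta>)) \<le> 1 / real (Suc m)" by blast
      qed
      with radially_cauchy_iff[OF Hardy2D(1)[OF h] z] \<zeta> show False by blast
    qed
  qed
qed

section \<open>Boundary functions as square integrable functions\<close>

lemma boundary_fun_eqI:
  "((\<lambda>r. h (r *\<^sub>R \<zeta>)) \<longlongrightarrow> L) (at_left 1) \<Longrightarrow> boundary_fun h \<zeta> = L"
  unfolding boundary_fun_def by (rule tendsto_Lim) (auto simp: trivial_limit_at_left_real)

lemma AE_boundary_tendsto:
  fixes h :: "complex ^ 'n \<Rightarrow> complex"
  assumes h: "h \<in> Hardy2"
  shows "AE \<zeta> in \<sigma>. ((\<lambda>r. h (r *\<^sub>R \<zeta>)) \<longlongrightarrow> boundary_fun h \<zeta>) (at_left 1)"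
  using Hardy2_radial_limits[OF h] by eventually_elim (metis boundary_fun_eqI)

lemma Hardy2_borel_measurable:
  fixes h :: "complex ^ 'n \<Rightarrow> complex"
  assumes h: "h \<in> Hardy2"
  shows "h \<in> borel_measurable borel"
proof -
  have "(\<lambda>z. if z \<in> ball 0 1 then h z else 0) \<in> borel_measurable borel"
    by (rule borel_measurable_continuous_on_if) (use holomorphic_fun_on_imp_continuous_on[OF Hardy2D(1)[OF h]] in auto)
  also have "(\<lambda>z. if z \<in> ball 0 1 then h z else 0) = h" using Hardy2D(2)[OF h] by auto
  finally show ?thesis .
qed

lemma Hardy2_dilate_measurable:
  fixes h :: "complex ^ 'n \<Rightarrow> complex"
  assumes h: "h \<in> Hardy2"
  shows "(\<lambda>\<zeta>. h (r *\<^sub>R \<zeta>)) \<in> borel_measurable \<sigma>"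
  by (rule borel_measurable_sphere_measureI, rule measurable_compose[OF _ Hardy2_borel_measurable[OF h]]) measurable

text \<open>
  The points with a radial limit form a measurable set.  At all other points \<open>Lim\<close> has one and the
  same unspecified value, a description of an object that does not exist.
\<close>

lemma boundary_fun_measurable:
  fixes h :: "complex ^ 'n \<Rightarrow> complex"
  assumes h: "h \<in> Hardy2"
  shows "boundary_fun h \<in> borel_measurable \<sigma>"
proof -
  note [measurable] = Hardy2_dilate_measurable[OF h]
  define G where "G \<zeta> = (if radially_cauchy h \<zeta> then lim (\<lambda>n. h (radius_seq n *\<^sub>R \<zeta>)) else (THE l. False))" for \<zeta>
  have pred: "Measurable.pred \<sigma> (radially_cauchy h)"
    unfolding radially_cauchy_def by measurable
  have "G \<in> borel_measurable \<sigma>"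
    unfolding G_def[abs_def]
    by (rule measurable_If[OF borel_measurable_lim_metric _ predE[OF pred]]) measurable
  moreover have "boundary_fun h \<zeta> = G \<zeta>" if "\<zeta> \<in> space \<sigma>" for \<zeta>
  proof (cases "radially_cauchy h \<zeta>")
    case True
    have "norm \<zeta> = 1" using that by simp
    from radially_cauchy_iff[OF Hardy2D(1)[OF h] this] True
    obtain L where L: "((\<lambda>r. h (r *\<^sub>R \<zeta>)) \<longlongrightarrow> L) (at_left 1)" by blast
    have "(\<lambda>n. h (radius_seq n *\<^sub>R \<zeta>)) \<longlonglongrightarrow> L" using L
      by (rule filterlim_compose[OF _ radius_seq_at_left])
    with L True show ?thesis by (simp add: G_def boundary_fun_eqI limI)
  next
    case False
    then have "\<not> (((\<lambda>r. h (r *\<^sub>R \<zeta>)) \<longlongrightarrow> L) (at_left 1))" for L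
      using radially_cauchy_iff[OF Hardy2D(1)[OF h], of \<zeta>] that by auto
    with False show ?thesis by (simp add: G_def boundary_fun_def Topological_Spaces.Lim_def)
  qed
  ultimately show ?thesis by (subst measurable_cong)
qed

definition sq_integrable :: "(complex ^ 'n \<Rightarrow> complex) \<Rightarrow> bool" where
  "sq_integrable u \<longleftrightarrow> u \<in> borel_measurable \<sigma> \<and> integrable \<sigma> (\<lambda>\<zeta>. (cmod (u \<zeta>))\<^sup>2)"

text \<open>
  The square of the \<open>L\<^sup>2\<close> norm, since the identities below are quadratic.
\<close>

definition sq_norm :: "(complex ^ 'n \<Rightarrow> complex) \<Rightarrow> real" where
  "sq_norm u = (\<integral>\<zeta>. (cmod (u \<zeta>))\<^sup>2 \<partial>\<sigma>)"

lemma sq_norm_nonneg: "0 \<le> sq_norm u" by (simp add: sq_norm_def)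

lemma sq_integrable_measurable [measurable_dest]: "sq_integrable u \<Longrightarrow> u \<in> borel_measurable \<sigma>"
  by (simp add: sq_integrable_def)

lemma norm_mult_le_squares: "cmod (a * cnj b) \<le> (cmod a)\<^sup>2 + (cmod b)\<^sup>2"
proof -
  have "0 \<le> (cmod a - cmod b)\<^sup>2" by simp
  then have "2 * (cmod a * cmod b) \<le> (cmod a)\<^sup>2 + (cmod b)\<^sup>2" by (simp add: power2_diff)
  moreover have "0 \<le> cmod a * cmod b" by simp
  ultimately show ?thesis unfolding norm_mult complex_mod_cnj by linarith
qed

lemma integrable_inner:
  assumes u: "sq_integrable u" and v: "sq_integrable v"
  shows "integrable \<sigma> (\<lambda>\<zeta>. u \<zeta> * cnj (v \<zeta>))"
proof (rule Bochner_Integration.integrable_bound)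
  show "integrable \<sigma> (\<lambda>\<zeta>. (cmod (u \<zeta>))\<^sup>2 + (cmod (v \<zeta>))\<^sup>2)" using u v by (simp add: sq_integrable_def)
  show "(\<lambda>\<zeta>. u \<zeta> * cnj (v \<zeta>)) \<in> borel_measurable \<sigma>" using u v by measurable
qed (rule AE_I2, use norm_mult_le_squares in simp)

lemma norm_lincomb_le_squares: "(cmod (a * x + b * y))\<^sup>2 \<le> 2 * (cmod a)\<^sup>2 * (cmod x)\<^sup>2 + 2 * (cmod b)\<^sup>2 * (cmod y)\<^sup>2"
proof -
  have "(cmod (a * x + b * y))\<^sup>2 \<le> (cmod (a * x) + cmod (b * y))\<^sup>2"
    by (intro power_mono norm_triangle_ineq) simp
  also have "\<dots> \<le> 2 * (cmod (a * x))\<^sup>2 + 2 * (cmod (b * y))\<^sup>2"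
    using sum_squares_bound[of "cmod (a * x)" "cmod (b * y)"] by (simp add: power2_sum)
  finally show ?thesis by (simp add: norm_mult power_mult_distrib mult_ac)
qed

lemma sq_integrable_lincomb:
  assumes u: "sq_integrable u" and v: "sq_integrable v"
  shows "sq_integrable (\<lambda>\<zeta>. a * u \<zeta> + b * v \<zeta>)"
    and "sq_norm (\<lambda>\<zeta>. a * u \<zeta> + b * v \<zeta>) \<le> 2 * (cmod a)\<^sup>2 * sq_norm u + 2 * (cmod b)\<^sup>2 * sq_norm v"
proof -
  have int: "integrable \<sigma> (\<lambda>\<zeta>. 2 * (cmod a)\<^sup>2 * (cmod (u \<zeta>))\<^sup>2 + 2 * (cmod b)\<^sup>2 * (cmod (v \<zeta>))\<^sup>2)"
    using u v by (simp add: sq_integrable_def)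
  have "integrable \<sigma> (\<lambda>\<zeta>. (cmod (a * u \<zeta> + b * v \<zeta>))\<^sup>2)"
  proof (rule Bochner_Integration.integrable_bound[OF int])
    show "(\<lambda>\<zeta>. (cmod (a * u \<zeta> + b * v \<zeta>))\<^sup>2) \<in> borel_measurable \<sigma>" using u v by measurable
  qed (rule AE_I2, use norm_lincomb_le_squares in simp)
  moreover have "(\<lambda>\<zeta>. a * u \<zeta> + b * v \<zeta>) \<in> borel_measurable \<sigma>" using u v by measurable
  ultimately show sq: "sq_integrable (\<lambda>\<zeta>. a * u \<zeta> + b * v \<zeta>)" by (simp add: sq_integrable_def)
  have "sq_norm (\<lambda>\<zeta>. a * u \<zeta> + b * v \<zeta>) \<le> (\<integral>\<zeta>. 2 * (cmod a)\<^sup>2 * (cmod (u \<zeta>))\<^sup>2 + 2 * (cmod b)\<^sup>2 * (cmod (v \<zeta>))\<^sup>2 \<partial>\<sigma>)"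
    unfolding sq_norm_def by (rule integral_mono) (use sq int norm_lincomb_le_squares in \<open>auto simp: sq_integrable_def\<close>)
  also have "\<dots> = 2 * (cmod a)\<^sup>2 * sq_norm u + 2 * (cmod b)\<^sup>2 * sq_norm v"
    unfolding sq_norm_def using u v by (simp add: sq_integrable_def)
  finally show "sq_norm (\<lambda>\<zeta>. a * u \<zeta> + b * v \<zeta>) \<le> 2 * (cmod a)\<^sup>2 * sq_norm u + 2 * (cmod b)\<^sup>2 * sq_norm v" .
qed

lemma sq_integrable_diff: "sq_integrable u \<Longrightarrow> sq_integrable v \<Longrightarrow> sq_integrable (\<lambda>\<zeta>. u \<zeta> - v \<zeta>)"
  using sq_integrable_lincomb(1)[of u v 1 "- 1"] by simp

lemma sq_integrable_bounded_mult:
  assumes f: "f \<in> borel_measurable \<sigma>" "AE \<zeta> in \<sigma>. cmod (f \<zeta>) \<le> B" and u: "sq_integrable u"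
  shows "sq_integrable (\<lambda>\<zeta>. f \<zeta> * u \<zeta>)"
proof -
  have "integrable \<sigma> (\<lambda>\<zeta>. B\<^sup>2 * (cmod (u \<zeta>))\<^sup>2)" using u by (simp add: sq_integrable_def)
  then have "integrable \<sigma> (\<lambda>\<zeta>. (cmod (f \<zeta> * u \<zeta>))\<^sup>2)"
  proof (rule Bochner_Integration.integrable_bound)
    show "(\<lambda>\<zeta>. (cmod (f \<zeta> * u \<zeta>))\<^sup>2) \<in> borel_measurable \<sigma>" using f u by measurable
    show "AE \<zeta> in \<sigma>. norm ((cmod (f \<zeta> * u \<zeta>))\<^sup>2) \<le> norm (B\<^sup>2 * (cmod (u \<zeta>))\<^sup>2)"
      using f(2) by eventually_elim (auto simp: norm_mult power_mult_distrib intro!: mult_right_mono power_mono)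
  qed
  moreover have "(\<lambda>\<zeta>. f \<zeta> * u \<zeta>) \<in> borel_measurable \<sigma>" using f u by measurable
  ultimately show ?thesis by (simp add: sq_integrable_def)
qed

lemma L2_inner_lincomb_left:
  assumes "sq_integrable u" "sq_integrable v" "sq_integrable w"
  shows "L2_inner (\<lambda>\<zeta>. a * u \<zeta> + b * v \<zeta>) w = a * L2_inner u w + b * L2_inner v w"
proof -
  have "L2_inner (\<lambda>\<zeta>. a * u \<zeta> + b * v \<zeta>) w = (\<integral>\<zeta>. a * (u \<zeta> * cnj (w \<zeta>)) + b * (v \<zeta> * cnj (w \<zeta>)) \<partial>\<sigma>)"
    unfolding L2_inner_def by (simp add: algebra_simps)
  then show ?thesis unfolding L2_inner_def using assms by (simp add: integrable_inner)
qed

lemma L2_inner_add_left: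
  "sq_integrable u \<Longrightarrow> sq_integrable v \<Longrightarrow> sq_integrable w \<Longrightarrow> L2_inner (\<lambda>\<zeta>. u \<zeta> + v \<zeta>) w = L2_inner u w + L2_inner v w"
  using L2_inner_lincomb_left[of u v w 1 1] by simp

lemma L2_inner_diff_left:
  "sq_integrable u \<Longrightarrow> sq_integrable v \<Longrightarrow> sq_integrable w \<Longrightarrow> L2_inner (\<lambda>\<zeta>. u \<zeta> - v \<zeta>) w = L2_inner u w - L2_inner v w"
  using L2_inner_lincomb_left[of u v w 1 "- 1"] by simp

lemma L2_inner_commute: "L2_inner v u = cnj (L2_inner u v)"
proof -
  have "(\<lambda>\<zeta>. cnj (u \<zeta> * cnj (v \<zeta>))) = (\<lambda>\<zeta>. v \<zeta> * cnj (u \<zeta>))" by (auto simp: mult.commute)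
  with Bochner_Integration.integral_cnj[of \<sigma> "\<lambda>\<zeta>. u \<zeta> * cnj (v \<zeta>)"] show ?thesis by (simp only: L2_inner_def)
qed

lemma L2_inner_diff_right:
  "sq_integrable u \<Longrightarrow> sq_integrable v \<Longrightarrow> sq_integrable w \<Longrightarrow> L2_inner w (\<lambda>\<zeta>. u \<zeta> - v \<zeta>) = L2_inner w u - L2_inner w v"
  using L2_inner_diff_left[of u v w] by (metis L2_inner_commute complex_cnj_diff)

lemma L2_inner_self: "L2_inner u u = of_real (sq_norm u)"
  unfolding L2_inner_def sq_norm_def
  by (subst integral_complex_of_real[symmetric]) (simp only: complex_norm_square)

lemma sq_norm_add_cmult:
  assumes u: "sq_integrable u" and v: "sq_integrable v"
  shows "sq_norm (\<lambda>\<zeta>. u \<zeta> + c * v \<zeta>) = sq_norm u + 2 * Re (cnj c * L2_inner u v) + (cmod c)\<^sup>2 * sq_norm v"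
proof -
  have pt: "(cmod (x + c * y))\<^sup>2 = (cmod x)\<^sup>2 + (2 * Re (cnj c * (x * cnj y)) + (cmod c)\<^sup>2 * (cmod y)\<^sup>2)" for x y
    by (simp only: cmod_power2) (simp add: power2_eq_square algebra_simps)
  define R where "R \<zeta> = Re (cnj c * (u \<zeta> * cnj (v \<zeta>)))" for \<zeta>
  have "(\<integral>\<zeta>. R \<zeta> \<partial>\<sigma>) = Re (cnj c * L2_inner u v)"
    unfolding L2_inner_def R_def
    by (subst integral_Re) (auto simp: integrable_inner[OF u v] simp del: times_complex.sel)
  moreover have "integrable \<sigma> R"
    unfolding R_def by (intro integrable_Re integrable_mult_right integrable_inner u v)
  ultimately show ?thesis
    using u v unfolding sq_norm_def pt R_def[symmetric] by (simp add: sq_integrable_def del: times_complex.sel)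
qed

text \<open>
  The usual discriminant argument, for the vectors \<open>u - t \<langle>u, v\<rangle> v\<close> with real \<open>t\<close>.
\<close>

lemma L2_Cauchy_Schwarz:
  assumes u: "sq_integrable u" and v: "sq_integrable v"
  shows "(cmod (L2_inner u v))\<^sup>2 \<le> sq_norm u * sq_norm v"
proof -
  let ?L = "L2_inner u v"
  have key: "0 \<le> sq_norm u - 2 * t * (cmod ?L)\<^sup>2 + t\<^sup>2 * (cmod ?L)\<^sup>2 * sq_norm v" for t
  proof -
    have "Re (cnj (- of_real t * ?L) * ?L) = - t * (cmod ?L)\<^sup>2"
    proof -
      have "cnj ?L * ?L = of_real ((cmod ?L)\<^sup>2)" by (simp only: complex_norm_square mult.commute)
      then have "cnj (- of_real t * ?L) * ?L = of_real (- t * (cmod ?L)\<^sup>2)" by (simp add: mult.assoc)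
      then show ?thesis by (simp only: Re_complex_of_real)
    qed
    moreover have "(cmod (- of_real t * ?L))\<^sup>2 = t\<^sup>2 * (cmod ?L)\<^sup>2" by (simp add: norm_mult power_mult_distrib)
    ultimately show ?thesis
      using sq_norm_add_cmult[OF u v, of "- of_real t * ?L"] sq_norm_nonneg[of "\<lambda>\<zeta>. u \<zeta> + (- of_real t * ?L) * v \<zeta>"]
      by simp
  qed
  show ?thesis
  proof (cases "sq_norm v = 0")
    case True
    show ?thesis
    proof (rule ccontr)
      assume "\<not> ?thesis"
      then have L: "(cmod ?L)\<^sup>2 > 0" using True by simp
      from key[of "(sq_norm u + 1) / (2 * (cmod ?L)\<^sup>2)"] True L show False by (simp add: field_simps)
    qed
  next
    case False
    then have v0: "sq_norm v > 0" using sq_norm_nonneg[of v] by simp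
    have "0 \<le> sq_norm u - (cmod ?L)\<^sup>2 / sq_norm v"
      using key[of "1 / sq_norm v"] v0 by (simp add: power2_eq_square field_simps)
    then show ?thesis using v0 by (simp add: pos_divide_le_eq)
  qed
qed

lemma L2_inner_bound:
  assumes u: "sq_integrable u" and v: "sq_integrable v" and "sq_norm u \<le> A" "sq_norm v \<le> B"
  shows "cmod (L2_inner u v) \<le> sqrt (A * B)"
proof (rule real_le_rsqrt)
  have "sq_norm u * sq_norm v \<le> A * B"
    using assms sq_norm_nonneg[of u] sq_norm_nonneg[of v] by (intro mult_mono) auto
  with L2_Cauchy_Schwarz[OF u v] show "(cmod (L2_inner u v))\<^sup>2 \<le> A * B" by linarith
qed

lemma sq_integrable_dilate:
  fixes h :: "complex ^ 'n \<Rightarrow> complex"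
  assumes h: "h \<in> Hardy2" and r: "0 \<le> r" "r < 1"
  shows "sq_integrable (\<lambda>\<zeta>. h (r *\<^sub>R \<zeta>))" and "sq_norm (\<lambda>\<zeta>. h (r *\<^sub>R \<zeta>)) \<le> (Hardy2_norm h)\<^sup>2"
proof -
  have "continuous_on (sphere 0 1) (\<lambda>\<zeta>. h (r *\<^sub>R \<zeta>))"
    by (rule continuous_on_compose2[OF holomorphic_fun_on_imp_continuous_on[OF Hardy2D(1)[OF h]]])
       (use r in \<open>auto intro!: continuous_intros\<close>)
  then have "compact ((\<lambda>\<zeta>. h (r *\<^sub>R \<zeta>)) ` sphere 0 1)" by (rule compact_continuous_image) auto
  then obtain B where B: "\<forall>x\<in>sphere 0 1. cmod (h (r *\<^sub>R x)) \<le> B" using compact_imp_bounded bounded_iff by (metis imageI)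
  have "integrable \<sigma> (\<lambda>\<zeta>. (cmod (h (r *\<^sub>R \<zeta>)))\<^sup>2)"
    by (rule sphere.integrable_const_bound[where B = "B\<^sup>2"])
       (use B Hardy2_dilate_measurable[OF h, of r] in \<open>auto intro!: power_mono\<close>)
  then show "sq_integrable (\<lambda>\<zeta>. h (r *\<^sub>R \<zeta>))" by (simp add: sq_integrable_def Hardy2_dilate_measurable[OF h])
  show "sq_norm (\<lambda>\<zeta>. h (r *\<^sub>R \<zeta>)) \<le> (Hardy2_norm h)\<^sup>2"
    unfolding sq_norm_def sums_unique[OF Hardy2_coeff_sums[OF h]]
    by (rule sphere_norm_le_coeff_sum[OF Hardy2D(1)[OF h] sums_summable[OF Hardy2_coeff_sums[OF h]] r])
qed

text \<open>
  Fatou's lemma, as the second radius tends to \<open>1\<close>.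
\<close>

lemma boundary_distance:
  fixes h :: "complex ^ 'n \<Rightarrow> complex"
  assumes h: "h \<in> Hardy2" and r: "0 \<le> r" "r < 1"
  shows "sq_integrable (\<lambda>\<zeta>. h (r *\<^sub>R \<zeta>) - boundary_fun h \<zeta>)"
    and "sq_norm (\<lambda>\<zeta>. h (r *\<^sub>R \<zeta>) - boundary_fun h \<zeta>) \<le> dilation_defect h r"
proof -
  note [measurable] = Hardy2_dilate_measurable[OF h] boundary_fun_measurable[OF h]
  let ?u = "\<lambda>\<zeta>. h (r *\<^sub>R \<zeta>) - boundary_fun h \<zeta>"
  let ?v = "\<lambda>n \<zeta>. h (r *\<^sub>R \<zeta>) - h (radius_seq n *\<^sub>R \<zeta>)"
  have D0: "0 \<le> dilation_defect h r"
    unfolding dilation_defect_def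
    by (intro suminf_nonneg[OF dilation_defect_summable[OF h]] mult_nonneg_nonneg coeff_norm2_nonneg) (use r in auto)
  have "(\<integral>\<^sup>+\<zeta>. ennreal ((cmod (?u \<zeta>))\<^sup>2) \<partial>\<sigma>) = (\<integral>\<^sup>+\<zeta>. liminf (\<lambda>n. ennreal ((cmod (?v n \<zeta>))\<^sup>2)) \<partial>\<sigma>)"
  proof (rule nn_integral_cong_AE)
    show "AE \<zeta> in \<sigma>. ennreal ((cmod (?u \<zeta>))\<^sup>2) = liminf (\<lambda>n. ennreal ((cmod (?v n \<zeta>))\<^sup>2))"
      using AE_boundary_tendsto[OF h]
    proof eventually_elim
      case (elim \<zeta>)
      have "(\<lambda>n. h (radius_seq n *\<^sub>R \<zeta>)) \<longlonglongrightarrow> boundary_fun h \<zeta>"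
        by (rule filterlim_compose[OF elim radius_seq_at_left])
      then have "(\<lambda>n. ennreal ((cmod (?v n \<zeta>))\<^sup>2)) \<longlonglongrightarrow> ennreal ((cmod (?u \<zeta>))\<^sup>2)"
        by (intro tendsto_ennrealI tendsto_intros)
      then show ?case by (rule lim_imp_Liminf[OF trivial_limit_sequentially, symmetric])
    qed
  qed
  also have "\<dots> \<le> liminf (\<lambda>n. \<integral>\<^sup>+\<zeta>. ennreal ((cmod (?v n \<zeta>))\<^sup>2) \<partial>\<sigma>)"
    by (rule nn_integral_liminf) measurable
  also have "\<dots> \<le> liminf (\<lambda>n :: nat. ennreal (dilation_defect h r))"
  proof (rule Liminf_mono)
    have "eventually (\<lambda>n. r < radius_seq n) sequentially" by (rule order_tendstoD(1)[OF radius_seq(3) r(2)])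
    then show "eventually (\<lambda>n. (\<integral>\<^sup>+\<zeta>. ennreal ((cmod (?v n \<zeta>))\<^sup>2) \<partial>\<sigma>) \<le> ennreal (dilation_defect h r)) sequentially"
    proof eventually_elim
      case (elim n)
      have "integrable \<sigma> (\<lambda>\<zeta>. (cmod (?v n \<zeta>))\<^sup>2)"
        using sq_integrable_diff[OF sq_integrable_dilate(1)[OF h r] sq_integrable_dilate(1)[OF h less_imp_le[OF radius_seq(1)] radius_seq(2)], of n]
        by (simp add: sq_integrable_def)
      then have "(\<integral>\<^sup>+\<zeta>. ennreal ((cmod (?v n \<zeta>))\<^sup>2) \<partial>\<sigma>) = ennreal (\<integral>\<zeta>. (cmod (?v n \<zeta>))\<^sup>2 \<partial>\<sigma>)"
        by (intro nn_integral_eq_integral) auto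
      also have "\<dots> \<le> ennreal (dilation_defect h r)"
        by (intro ennreal_leI sphere_norm_diff_le_defect[OF h]) (use elim r radius_seq in auto)
      finally show ?case .
    qed
  qed
  also have "\<dots> = ennreal (dilation_defect h r)" by (simp add: Liminf_const)
  finally have le: "(\<integral>\<^sup>+\<zeta>. ennreal ((cmod (?u \<zeta>))\<^sup>2) \<partial>\<sigma>) \<le> ennreal (dilation_defect h r)" .
  have int: "integrable \<sigma> (\<lambda>\<zeta>. (cmod (?u \<zeta>))\<^sup>2)"
    by (rule integrableI_bounded) (use le in \<open>auto intro: le_less_trans\<close>)
  then show "sq_integrable ?u" by (simp add: sq_integrable_def)
  show "sq_norm ?u \<le> dilation_defect h r"
    using le D0 unfolding sq_norm_def by (subst (asm) nn_integral_eq_integral[OF int]) auto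
qed

lemma boundary_sq_integrable:
  fixes h :: "complex ^ 'n \<Rightarrow> complex"
  assumes h: "h \<in> Hardy2"
  shows "sq_integrable (boundary_fun h)"
  using sq_integrable_diff[OF sq_integrable_dilate(1)[OF h, of 0] boundary_distance(1)[OF h, of 0]] by simp

text \<open>
  The dilations of \<open>g\<close> and \<open>h\<close> tend to the boundary functions in \<open>L\<^sup>2\<close>.
\<close>

lemma inner_boundary_tendsto:
  fixes g h :: "complex ^ 'n \<Rightarrow> complex"
  assumes g: "g \<in> Hardy2" and h: "h \<in> Hardy2"
  shows "((\<lambda>r. L2_inner (\<lambda>\<zeta>. g (r *\<^sub>R \<zeta>)) (\<lambda>\<zeta>. h (r *\<^sub>R \<zeta>))) \<longlongrightarrow> L2_inner (boundary_fun g) (boundary_fun h)) (at_left 1)"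
proof -
  note bg = boundary_sq_integrable[OF g] and bh = boundary_sq_integrable[OF h]
  let ?L = "\<lambda>r. L2_inner (\<lambda>\<zeta>. g (r *\<^sub>R \<zeta>)) (\<lambda>\<zeta>. h (r *\<^sub>R \<zeta>))"
  let ?B = "\<lambda>r. sqrt (dilation_defect g r * (Hardy2_norm h)\<^sup>2) + sqrt (sq_norm (boundary_fun g) * dilation_defect h r)"
  have "(?B \<longlongrightarrow> sqrt (0 * (Hardy2_norm h)\<^sup>2) + sqrt (sq_norm (boundary_fun g) * 0)) (at_left 1)"
    by (intro tendsto_intros dilation_defect_tendsto g h)
  then have B0: "(?B \<longlongrightarrow> 0) (at_left 1)" by simp
  have "eventually (\<lambda>r. r \<in> {0<..<1}) (at_left (1 :: real))"
    by (rule eventually_at_left_real) simp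
  then have "eventually (\<lambda>r. norm (?L r - L2_inner (boundary_fun g) (boundary_fun h)) \<le> ?B r) (at_left 1)"
  proof eventually_elim
    case (elim r)
    then have r: "0 \<le> r" "r < 1" by auto
    note dg = sq_integrable_dilate[OF g r] and dh = sq_integrable_dilate[OF h r]
    have "?L r - L2_inner (boundary_fun g) (boundary_fun h) =
      L2_inner (\<lambda>\<zeta>. g (r *\<^sub>R \<zeta>) - boundary_fun g \<zeta>) (\<lambda>\<zeta>. h (r *\<^sub>R \<zeta>)) + L2_inner (boundary_fun g) (\<lambda>\<zeta>. h (r *\<^sub>R \<zeta>) - boundary_fun h \<zeta>)"
      by (simp add: L2_inner_diff_left[OF dg(1) bg dh(1)] L2_inner_diff_right[OF dh(1) bh bg])
    also have "cmod \<dots> \<le> ?B r"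
      by (intro norm_triangle_mono L2_inner_bound boundary_distance g h r dh bg) simp
    finally show ?case .
  qed
  then have "((\<lambda>r. ?L r - L2_inner (boundary_fun g) (boundary_fun h)) \<longlongrightarrow> 0) (at_left 1)"
    by (rule Lim_null_comparison[OF _ B0])
  then show ?thesis by (rule LIM_zero_cancel)
qed

text \<open>
  As \<open>r\<close> tends to \<open>1\<close>, the \<open>L\<^sup>2\<close> norms of the dilations increase to the Hardy norm by definition,
  and tend to the norm of the boundary function by convergence in \<open>L\<^sup>2\<close>.
\<close>

lemma Hardy2_norm_boundary:
  fixes h :: "complex ^ 'n \<Rightarrow> complex"
  assumes h: "h \<in> Hardy2"
  shows "(Hardy2_norm h)\<^sup>2 = sq_norm (boundary_fun h)"
proof -
  have "((\<lambda>r. complex_of_real (sq_norm (\<lambda>\<zeta>. h (r *\<^sub>R \<zeta>)))) \<longlongrightarrow> complex_of_real (sq_norm (boundary_fun h))) (at_left 1)"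
    using inner_boundary_tendsto[OF h h] by (simp add: L2_inner_self)
  then have lim: "((\<lambda>r. sq_norm (\<lambda>\<zeta>. h (r *\<^sub>R \<zeta>))) \<longlongrightarrow> sq_norm (boundary_fun h)) (at_left 1)"
    by (simp add: tendsto_of_real_iff)
  have ev: "eventually (\<lambda>r. r \<in> {0<..<1}) (at_left (1 :: real))"
    by (rule eventually_at_left_real) simp
  have "sq_norm (boundary_fun h) \<le> (Hardy2_norm h)\<^sup>2"
  proof (rule tendsto_upperbound[OF lim])
    show "eventually (\<lambda>r. sq_norm (\<lambda>\<zeta>. h (r *\<^sub>R \<zeta>)) \<le> (Hardy2_norm h)\<^sup>2) (at_left 1)"
      using ev by eventually_elim (rule sq_integrable_dilate(2)[OF h], auto)
  qed simp
  moreover have "(Hardy2_norm h)\<^sup>2 \<le> sq_norm (boundary_fun h)"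
  proof -
    have "(\<Sum>k<n. coeff_norm2 h k) \<le> sq_norm (boundary_fun h)" for n
    proof (rule sum_coeff_norm2_le[OF Hardy2D(1)[OF h]])
      fix r :: real assume r: "0 < r" "r < 1"
      show "(\<integral>\<zeta>. (cmod (h (r *\<^sub>R \<zeta>)))\<^sup>2 \<partial>\<sigma>) \<le> sq_norm (boundary_fun h)"
      proof (rule tendsto_lowerbound[OF lim])
        have "eventually (\<lambda>s. s \<in> {r<..<1}) (at_left (1 :: real))"
          by (rule eventually_at_left_real[OF r(2)])
        then show "eventually (\<lambda>s. (\<integral>\<zeta>. (cmod (h (r *\<^sub>R \<zeta>)))\<^sup>2 \<partial>\<sigma>) \<le> sq_norm (\<lambda>\<zeta>. h (s *\<^sub>R \<zeta>))) (at_left 1)"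
        proof eventually_elim
          case (elim s)
          show ?case unfolding sq_norm_def
          proof (rule sums_le[OF _ sphere_norm_sums[OF Hardy2D(1)[OF h]] sphere_norm_sums[OF Hardy2D(1)[OF h]]])
            fix k
            show "coeff_norm2 h k * (r ^ k)\<^sup>2 \<le> coeff_norm2 h k * (s ^ k)\<^sup>2"
              using elim r by (intro mult_left_mono power_mono coeff_norm2_nonneg) auto
          qed (use elim r in auto)
        qed
      qed simp
    qed
    then show ?thesis
      unfolding sums_unique[OF Hardy2_coeff_sums[OF h]]
      by (intro suminf_le_const sums_summable[OF Hardy2_coeff_sums[OF h]])
  qed
  ultimately show ?thesis by simp
qed

lemma Hardy2_lincomb:
  fixes g h :: "complex ^ 'n \<Rightarrow> complex"
  assumes g: "g \<in> Hardy2" and h: "h \<in> Hardy2"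
  shows "(\<lambda>z. a * g z + b * h z) \<in> Hardy2"
proof (rule Hardy2I)
  show "holomorphic_fun_on (\<lambda>z. a * g z + b * h z) (ball 0 1)"
    by (intro holomorphic_fun_on_lincomb Hardy2D(1) g h)
  fix r :: real assume r: "0 < r" "r < 1"
  have "sq_norm (\<lambda>\<zeta>. a * g (r *\<^sub>R \<zeta>) + b * h (r *\<^sub>R \<zeta>)) \<le> 2 * (cmod a)\<^sup>2 * sq_norm (\<lambda>\<zeta>. g (r *\<^sub>R \<zeta>)) + 2 * (cmod b)\<^sup>2 * sq_norm (\<lambda>\<zeta>. h (r *\<^sub>R \<zeta>))"
    by (rule sq_integrable_lincomb(2)) (use r in \<open>auto intro!: sq_integrable_dilate g h\<close>)
  also have "\<dots> \<le> 2 * (cmod a)\<^sup>2 * (Hardy2_norm g)\<^sup>2 + 2 * (cmod b)\<^sup>2 * (Hardy2_norm h)\<^sup>2"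
    by (intro add_mono mult_left_mono sq_integrable_dilate(2) g h) (use r in auto)
  finally show "(\<integral>\<zeta>. (cmod (a * g (r *\<^sub>R \<zeta>) + b * h (r *\<^sub>R \<zeta>)))\<^sup>2 \<partial>\<sigma>) \<le> 2 * (cmod a)\<^sup>2 * (Hardy2_norm g)\<^sup>2 + 2 * (cmod b)\<^sup>2 * (Hardy2_norm h)\<^sup>2"
    by (simp add: sq_norm_def)
qed (use Hardy2D(2)[OF g] Hardy2D(2)[OF h] in auto)

lemma boundary_lincomb:
  fixes g h :: "complex ^ 'n \<Rightarrow> complex"
  assumes g: "g \<in> Hardy2" and h: "h \<in> Hardy2"
  shows "AE \<zeta> in \<sigma>. boundary_fun (\<lambda>z. a * g z + b * h z) \<zeta> = a * boundary_fun g \<zeta> + b * boundary_fun h \<zeta>"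
  using AE_boundary_tendsto[OF g] AE_boundary_tendsto[OF h]
  by eventually_elim (rule boundary_fun_eqI, intro tendsto_intros)

lemma sq_norm_cong_AE:
  assumes "AE \<zeta> in \<sigma>. u \<zeta> = v \<zeta>" "u \<in> borel_measurable \<sigma>" "v \<in> borel_measurable \<sigma>"
  shows "sq_norm u = sq_norm v"
  unfolding sq_norm_def by (rule integral_cong_AE) (use assms in \<open>auto elim!: eventually_mono\<close>)

lemma L2_inner_cong_AE:
  assumes "AE \<zeta> in \<sigma>. u \<zeta> = u' \<zeta>" "AE \<zeta> in \<sigma>. v \<zeta> = v' \<zeta>"
    and [measurable]: "u \<in> borel_measurable \<sigma>" "v \<in> borel_measurable \<sigma>" "u' \<in> borel_measurable \<sigma>" "v' \<in> borel_measurable \<sigma>"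
  shows "L2_inner u v = L2_inner u' v'"
  unfolding L2_inner_def
proof (rule integral_cong_AE)
  show "AE \<zeta> in \<sigma>. u \<zeta> * cnj (v \<zeta>) = u' \<zeta> * cnj (v' \<zeta>)" using assms(1,2) by eventually_elim simp
qed measurable

definition coord_mult :: "'n \<Rightarrow> (complex ^ 'n \<Rightarrow> complex) \<Rightarrow> complex ^ 'n \<Rightarrow> complex" where
  "coord_mult j h z = z $ j * h z"

lemma Hardy2_bounded_mult:
  fixes h :: "complex ^ 'n \<Rightarrow> complex"
  assumes h: "h \<in> Hardy2" and b: "holomorphic_fun_on b (ball 0 1)" "\<And>z. z \<in> ball 0 1 \<Longrightarrow> cmod (b z) \<le> 1"
  shows "(\<lambda>z. b z * h z) \<in> Hardy2"
proof (rule Hardy2I)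
  show "holomorphic_fun_on (\<lambda>z. b z * h z) (ball 0 1)"
    by (intro holomorphic_fun_on_mult Hardy2D(1) h b)
  fix r :: real assume r: "0 < r" "r < 1"
  have "(\<integral>\<zeta>. (cmod (b (r *\<^sub>R \<zeta>) * h (r *\<^sub>R \<zeta>)))\<^sup>2 \<partial>\<sigma>) \<le> (\<integral>\<zeta>. (cmod (h (r *\<^sub>R \<zeta>)))\<^sup>2 \<partial>\<sigma>)"
  proof (rule integral_mono_AE')
    show "AE \<zeta> in \<sigma>. (cmod (b (r *\<^sub>R \<zeta>) * h (r *\<^sub>R \<zeta>)))\<^sup>2 \<le> (cmod (h (r *\<^sub>R \<zeta>)))\<^sup>2"
      by (rule AE_I2) (use b(2) r in \<open>auto simp: norm_mult intro!: power_mono mult_left_le_one_le\<close>)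
    show "integrable \<sigma> (\<lambda>\<zeta>. (cmod (h (r *\<^sub>R \<zeta>)))\<^sup>2)"
      using sq_integrable_dilate(1)[OF h, of r] r by (simp add: sq_integrable_def)
  qed auto
  also have "\<dots> \<le> (Hardy2_norm h)\<^sup>2"
    using sq_integrable_dilate(2)[OF h, of r] r by (simp add: sq_norm_def)
  finally show "(\<integral>\<zeta>. (cmod (b (r *\<^sub>R \<zeta>) * h (r *\<^sub>R \<zeta>)))\<^sup>2 \<partial>\<sigma>) \<le> (Hardy2_norm h)\<^sup>2" .
qed (use Hardy2D(2)[OF h] in auto)

lemma Hardy2_coord_mult: "h \<in> Hardy2 \<Longrightarrow> coord_mult j h \<in> Hardy2"
  unfolding coord_mult_def[abs_def]
  by (rule Hardy2_bounded_mult)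
     (auto intro: holomorphic_fun_on_nth order_trans[OF Finite_Cartesian_Product.norm_nth_le less_imp_le])

lemma boundary_coord_mult:
  fixes h :: "complex ^ 'n \<Rightarrow> complex"
  assumes h: "h \<in> Hardy2"
  shows "AE \<zeta> in \<sigma>. boundary_fun (coord_mult j h) \<zeta> = \<zeta> $ j * boundary_fun h \<zeta>"
  using AE_boundary_tendsto[OF h]
proof eventually_elim
  case (elim \<zeta>)
  have "((\<lambda>r. (r *\<^sub>R \<zeta>) $ j * h (r *\<^sub>R \<zeta>)) \<longlongrightarrow> (1 *\<^sub>R \<zeta>) $ j * boundary_fun h \<zeta>) (at_left 1)"
    by (intro tendsto_mult elim tendsto_vec_nth tendsto_scaleR tendsto_const) (rule tendsto_ident_at)
  then show ?case by (intro boundary_fun_eqI) (simp add: coord_mult_def)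
qed

section \<open>Point evaluations\<close>

lemma AE_uniform_ball: "AE x in uniform_measure lborel (ball (0 :: complex ^ 'n) 1). norm x \<le> 1"
  by (rule AE_uniform_measureI) auto

lemma hcoeff_sgn:
  fixes h :: "complex ^ 'n \<Rightarrow> complex"
  assumes "holomorphic_fun_on h (ball 0 1)"
  shows "hcoeff h k x = of_real (norm x ^ k) * hcoeff h k (sgn x)"
proof -
  have "norm x *\<^sub>R sgn x = x" by (cases "x = 0") (auto simp: sgn_div_norm)
  then show ?thesis using hcoeff_scaleR[OF assms, of k "norm x" "sgn x"] by simp
qed

text \<open>
  A homogeneous function is no larger in the ball than on the sphere at the point in the same
  direction, so the terms of Parseval's identity for the ball are dominated by those for the sphere.
\<close>

lemma ball_mean_le_Hardy2_norm:
  fixes h :: "complex ^ 'n \<Rightarrow> complex"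
  assumes h: "h \<in> Hardy2" and r: "0 \<le> r" "r < 1"
  shows "(\<integral>x. (cmod (h (r *\<^sub>R x)))\<^sup>2 \<partial>uniform_measure lborel (ball 0 1)) \<le> (Hardy2_norm h)\<^sup>2"
proof -
  let ?U = "uniform_measure lborel (ball (0 :: complex ^ 'n) 1)"
  note hol = Hardy2D(1)[OF h]
  have ci: "circle_invariant ?U" by (rule circle_invariant_uniform_ball) simp
  interpret U: finite_measure ?U using ci by (simp add: circle_invariant_def)
  obtain t where t: "r \<le> t" "0 < t" "t < 1" using r that[of "(1 + r) / 2"] by auto
  let ?g = "\<lambda>x. h (r *\<^sub>R x)"
  have meas: "?g \<in> borel_measurable ?U"
    using measurable_compose[OF _ Hardy2_borel_measurable[OF h], of "(*\<^sub>R) r" borel] by simp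
  have sums: "(\<lambda>k. \<integral>x. (cmod (hcoeff ?g k x))\<^sup>2 \<partial>?U) sums (\<integral>x. (cmod (?g x))\<^sup>2 \<partial>?U)"
    by (rule parseval_norm[OF ci _ _ AE_uniform_ball holomorphic_dilate[OF hol r(1) t(1,2)] meas]) (use t in auto)
  have hm[measurable]: "hcoeff h k \<in> borel_measurable borel" for k by (rule hcoeff_measurable[OF hol]) simp
  have le: "(\<integral>x. (cmod (hcoeff ?g k x))\<^sup>2 \<partial>?U) \<le> coeff_norm2 h k" for k
  proof -
    have "coeff_norm2 h k = (\<integral>x. (cmod (hcoeff h k (sgn x)))\<^sup>2 \<partial>?U)"
      unfolding coeff_norm2_def by (rule integral_sphere_measure_cone) measurable
    moreover have "(\<integral>x. (cmod (hcoeff ?g k x))\<^sup>2 \<partial>?U) \<le> (\<integral>x. (cmod (hcoeff h k (sgn x)))\<^sup>2 \<partial>?U)"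
    proof (rule integral_mono_AE')
      have "0 < (1 / 2 :: real)" "1 / 2 * 1 < (1 :: real)" by simp_all
      from hcoeff_geometric_bound[OF hol this]
      obtain B where "B \<ge> 0" and B: "\<And>x k. norm x \<le> 1 \<Longrightarrow> cmod (hcoeff h k x) \<le> B / (1 / 2) ^ k"
        by blast
      have "(\<lambda>x. (cmod (hcoeff h k (sgn x)))\<^sup>2) \<in> borel_measurable borel" by measurable
      then have "(\<lambda>x. (cmod (hcoeff h k (sgn x)))\<^sup>2) \<in> borel_measurable ?U" by simp
      then show "integrable ?U (\<lambda>x. (cmod (hcoeff h k (sgn x)))\<^sup>2)"
        by (rule U.integrable_const_bound[where B = "(B / (1 / 2) ^ k)\<^sup>2", rotated])
           (rule AE_I2, simp del: divide_const_simps power_divide, intro power_mono B, auto simp: norm_sgn)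
      show "AE x in ?U. (cmod (hcoeff ?g k x))\<^sup>2 \<le> (cmod (hcoeff h k (sgn x)))\<^sup>2"
        using AE_uniform_ball
      proof eventually_elim
        case (elim x)
        have "cmod (hcoeff ?g k x) = r ^ k * norm x ^ k * cmod (hcoeff h k (sgn x))"
          using r by (simp add: hcoeff_dilate_real hcoeff_scaleR[OF hol] hcoeff_sgn[OF hol, of k x] norm_mult norm_power)
        also have "\<dots> \<le> 1 * cmod (hcoeff h k (sgn x))"
          using r elim by (intro mult_right_mono mult_le_one power_le_one) auto
        finally show ?case by (intro power_mono) auto
      qed
    qed simp
    ultimately show ?thesis by simp
  qed
  show ?thesis by (rule sums_le[OF le sums Hardy2_coeff_sums[OF h]])
qed

lemma nn_integral_lborel_affine:
  fixes f :: "'a :: euclidean_space \<Rightarrow> ennreal"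
  assumes [measurable]: "f \<in> borel_measurable borel" and c: "c \<noteq> 0"
  shows "(\<integral>\<^sup>+x. f x \<partial>lborel) = ennreal (\<bar>c\<bar> ^ DIM('a)) * (\<integral>\<^sup>+x. f (t + c *\<^sub>R x) \<partial>lborel)"
proof -
  have "(\<integral>\<^sup>+x. f x \<partial>lborel) = (\<integral>\<^sup>+x. f x \<partial>density (distr lborel borel (\<lambda>x. t + c *\<^sub>R x)) (\<lambda>_. ennreal (\<bar>c\<bar> ^ DIM('a))))"
    by (subst lborel_affine[OF c, of t]) simp
  also have "\<dots> = ennreal (\<bar>c\<bar> ^ DIM('a)) * (\<integral>\<^sup>+x. f (t + c *\<^sub>R x) \<partial>lborel)"
    by (simp add: nn_integral_density nn_integral_distr nn_integral_cmult)
  finally show ?thesis .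
qed

text \<open>
  The constant term of Parseval's identity on a small ball about \<open>z\<close> bounds \<open>|h z|\<^sup>2\<close> by the mean
  of \<open>|h|\<^sup>2\<close> over that ball, hence by a multiple of the mean over a ball about the origin.
\<close>

lemma Hardy2_point_bound:
  assumes s: "0 \<le> s" "s < 1"
  obtains C where "C > 0"
    "\<And>(h :: complex ^ 'n \<Rightarrow> complex) z. h \<in> Hardy2 \<Longrightarrow> norm z \<le> s \<Longrightarrow> cmod (h z) \<le> C * Hardy2_norm h"
proof -
  \<comment> \<open>the ball of radius \<open>\<rho>\<close> about \<open>z\<close> lies in the ball of radius \<open>r < 1\<close> about the origin, and \<open>K\<close> below is the ratio of their volumes\<close>
  define \<rho> where "\<rho> = (1 - s) / 2"
  define r where "r = (1 + s) / 2"
  have \<rho>: "0 < \<rho>" "s + \<rho> = r" "s + 2 * \<rho> = 1" and r: "0 < r" "r < 1" using s by (simp_all add: \<rho>_def r_def field_simps)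
  let ?d = "DIM(complex ^ 'n)"
  define B where "B = ball (0 :: complex ^ 'n) 1"
  have [measurable]: "B \<in> sets borel" by (simp add: B_def)
  let ?U = "uniform_measure lborel B"
  define V where "V = emeasure lborel B"
  have V: "V \<noteq> 0" "V \<noteq> \<infinity>" using emeasure_ball_pos_finite[of 1 "0 :: complex ^ 'n"] by (auto simp: V_def B_def)
  have ci: "circle_invariant ?U" unfolding B_def by (rule circle_invariant_uniform_ball) simp
  interpret U: finite_measure ?U using ci by (simp add: circle_invariant_def)
  have AEB: "AE x in ?U. norm x \<le> 1" unfolding B_def by (rule AE_uniform_ball)
  define K where "K = r ^ ?d / \<rho> ^ ?d"
  have K: "K > 0" using r \<rho> by (simp add: K_def)
  have "(cmod (h z))\<^sup>2 \<le> K * (Hardy2_norm h)\<^sup>2" if h: "h \<in> Hardy2" and z: "norm z \<le> s" for h :: "complex ^ 'n \<Rightarrow> complex" and z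
  proof -
    note [measurable] = Hardy2_borel_measurable[OF h]
    let ?g = "\<lambda>x. h (z + \<rho> *\<^sub>R x)"
    have hol: "holomorphic_fun_on ?g (ball 0 2)"
    proof -
      have "holomorphic_fun_on (\<lambda>x. h (z + of_real \<rho> *s x)) (ball 0 2)"
      proof (rule holomorphic_fun_on_affine[OF Hardy2D(1)[OF h]])
        fix x :: "complex ^ 'n" assume "x \<in> ball 0 2"
        then have "\<rho> * norm x < \<rho> * 2" using \<rho> by (intro mult_strict_left_mono) auto
        moreover have "norm (z + of_real \<rho> *s x) \<le> norm z + \<rho> * norm x"
          using \<rho> norm_triangle_ineq[of z "of_real \<rho> *s x"] by (simp add: norm_vector_smult)
        ultimately have "norm (z + of_real \<rho> *s x) < 1" using z \<rho>(3) by linarith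
        then show "z + of_real \<rho> *s x \<in> ball 0 1" by simp
      qed
      then show ?thesis by (simp add: vector_smult_of_real)
    qed
    have gm: "?g \<in> borel_measurable ?U"
    proof -
      have "?g \<in> borel_measurable borel" by measurable
      then show ?thesis by simp
    qed
    have bounded: "\<exists>M. \<forall>x\<in>cball 0 1. cmod (h (a + c *\<^sub>R x)) \<le> M" if "\<And>x. norm x \<le> 1 \<Longrightarrow> norm (a + c *\<^sub>R x) < 1" for a c
    proof -
      have "continuous_on (cball 0 1) (\<lambda>x. h (a + c *\<^sub>R x))"
        by (rule continuous_on_compose2[OF holomorphic_fun_on_imp_continuous_on[OF Hardy2D(1)[OF h]]])
           (use that in \<open>auto intro!: continuous_intros\<close>)
      then have "compact ((\<lambda>x. h (a + c *\<^sub>R x)) ` cball 0 1)" by (rule compact_continuous_image) auto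
      then show ?thesis using compact_imp_bounded bounded_iff by (metis imageI)
    qed
    have int: "integrable ?U (\<lambda>x. (cmod (h (a + c *\<^sub>R x)))\<^sup>2)" if ac: "\<And>x. norm x \<le> 1 \<Longrightarrow> norm (a + c *\<^sub>R x) < 1" for a c
    proof -
      obtain M where M: "\<forall>x\<in>cball 0 1. cmod (h (a + c *\<^sub>R x)) \<le> M" using bounded[OF ac] by blast
      have "(\<lambda>x. (cmod (h (a + c *\<^sub>R x)))\<^sup>2) \<in> borel_measurable borel" by measurable
      then have m: "(\<lambda>x. (cmod (h (a + c *\<^sub>R x)))\<^sup>2) \<in> borel_measurable ?U" by simp
      show ?thesis
      proof (rule U.integrable_const_bound[OF _ m, where B = "M\<^sup>2"])
        show "AE x in ?U. norm ((cmod (h (a + c *\<^sub>R x)))\<^sup>2) \<le> M\<^sup>2"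
          using AEB by eventually_elim (use M in \<open>auto intro!: power_mono\<close>)
      qed
    qed
    have Uint: "ennreal (\<integral>x. (cmod (h (a + c *\<^sub>R x)))\<^sup>2 \<partial>?U) = (\<integral>\<^sup>+x. ennreal ((cmod (h (a + c *\<^sub>R x)))\<^sup>2) * indicator B x \<partial>lborel) / V"
      if "\<And>x. norm x \<le> 1 \<Longrightarrow> norm (a + c *\<^sub>R x) < 1" for a c
    proof -
      have "ennreal (\<integral>x. (cmod (h (a + c *\<^sub>R x)))\<^sup>2 \<partial>?U) = (\<integral>\<^sup>+x. ennreal ((cmod (h (a + c *\<^sub>R x)))\<^sup>2) \<partial>?U)"
        by (rule nn_integral_eq_integral[symmetric]) (use int[OF that] in auto)
      then show ?thesis unfolding V_def by (subst (asm) nn_integral_uniform_measure) auto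
    qed
    have z1: "norm (z + \<rho> *\<^sub>R x) < 1" if "norm x \<le> 1" for x
    proof -
      have "\<rho> * norm x \<le> \<rho> * 1" using that \<rho> by (intro mult_left_mono) auto
      moreover have "norm (\<rho> *\<^sub>R x) = \<rho> * norm x" using \<rho>(1) by simp
      ultimately show ?thesis using norm_triangle_ineq[of z "\<rho> *\<^sub>R x"] z \<rho>(2) r(2) by linarith
    qed
    have r1: "norm (0 + r *\<^sub>R x) < 1" if "norm x \<le> 1" for x :: "complex ^ 'n"
    proof -
      have "r * norm x \<le> r * 1" using that r by (intro mult_left_mono) auto
      then have "r * norm x < 1" using r(2) by linarith
      then show ?thesis using r by simp
    qed
    have S: "(\<lambda>k. \<integral>x. (cmod (hcoeff ?g k x))\<^sup>2 \<partial>?U) sums (\<integral>x. (cmod (?g x))\<^sup>2 \<partial>?U)"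
      by (rule parseval_norm[OF ci _ _ AEB hol gm]) auto
    from sum_le_suminf[OF sums_summable[OF S], of "{0}"]
    have "(\<integral>x. (cmod (hcoeff ?g 0 x))\<^sup>2 \<partial>?U) \<le> (\<integral>x. (cmod (?g x))\<^sup>2 \<partial>?U)"
      using sums_unique[OF S] by simp
    moreover have "measure ?U (space ?U) = 1"
      using V measure_uniform_measure[of lborel B B] by (simp add: measure_def emeasure_uniform_measure ennreal_divide_self less_top V_def[symmetric])
    ultimately have "(cmod (h z))\<^sup>2 \<le> (\<integral>x. (cmod (h (z + \<rho> *\<^sub>R x)))\<^sup>2 \<partial>?U)"
      by (simp add: hcoeff_def)
    then have "ennreal ((cmod (h z))\<^sup>2) \<le> ennreal (\<integral>x. (cmod (h (z + \<rho> *\<^sub>R x)))\<^sup>2 \<partial>?U)"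
      by (rule ennreal_leI)
    also have "\<dots> = (\<integral>\<^sup>+x. ennreal ((cmod (h (z + \<rho> *\<^sub>R x)))\<^sup>2) * indicator B x \<partial>lborel) / V"
      by (rule Uint[OF z1])
    also have "\<dots> \<le> ennreal K * (\<integral>\<^sup>+x. ennreal ((cmod (h (0 + r *\<^sub>R x)))\<^sup>2) * indicator B x \<partial>lborel) / V"
    proof (rule divide_right_mono_ennreal)
      let ?F = "\<lambda>y. ennreal ((cmod (h y))\<^sup>2) * indicator B ((1 / \<rho>) *\<^sub>R (y - z))"
      let ?G = "\<lambda>y. ennreal ((cmod (h y))\<^sup>2) * indicator B ((1 / r) *\<^sub>R y)"
      have "ennreal (\<rho> ^ ?d) * (\<integral>\<^sup>+x. ennreal ((cmod (h (z + \<rho> *\<^sub>R x)))\<^sup>2) * indicator B x \<partial>lborel) = (\<integral>\<^sup>+y. ?F y \<partial>lborel)"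
        using \<rho> by (subst nn_integral_lborel_affine[of ?F \<rho> z]) auto
      also have "\<dots> \<le> (\<integral>\<^sup>+y. ?G y \<partial>lborel)"
      proof (rule nn_integral_mono)
        fix y :: "complex ^ 'n"
        have "norm y < r" if "norm (y - z) < \<rho>"
          using that z \<rho>(2) norm_triangle_ineq[of z "y - z"] by simp
        moreover have "(1 / \<rho>) *\<^sub>R (y - z) \<in> B \<longleftrightarrow> norm (y - z) < \<rho>"
          unfolding B_def mem_ball_0 norm_scaleR using \<rho>(1) by (simp add: field_simps)
        moreover have "(1 / r) *\<^sub>R y \<in> B \<longleftrightarrow> norm y < r"
          unfolding B_def mem_ball_0 norm_scaleR using r by (simp add: field_simps)
        ultimately show "?F y \<le> ?G y" unfolding indicator_def by simp
      qed
      also have "\<dots> = ennreal (r ^ ?d) * (\<integral>\<^sup>+x. ennreal ((cmod (h (0 + r *\<^sub>R x)))\<^sup>2) * indicator B x \<partial>lborel)"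
        using r by (subst nn_integral_lborel_affine[of ?G r 0]) auto
      finally have "ennreal (1 / \<rho> ^ ?d) * (ennreal (\<rho> ^ ?d) * (\<integral>\<^sup>+x. ennreal ((cmod (h (z + \<rho> *\<^sub>R x)))\<^sup>2) * indicator B x \<partial>lborel)) \<le>
        ennreal (1 / \<rho> ^ ?d) * (ennreal (r ^ ?d) * (\<integral>\<^sup>+x. ennreal ((cmod (h (0 + r *\<^sub>R x)))\<^sup>2) * indicator B x \<partial>lborel))"
        by (rule mult_left_mono) simp
      moreover have "ennreal (1 / \<rho> ^ ?d) * ennreal (\<rho> ^ ?d) = 1" using \<rho>(1) by (simp flip: ennreal_mult)
      moreover have "ennreal (1 / \<rho> ^ ?d) * ennreal (r ^ ?d) = ennreal K" using \<rho>(1) r by (simp add: K_def flip: ennreal_mult)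
      ultimately show "(\<integral>\<^sup>+x. ennreal ((cmod (h (z + \<rho> *\<^sub>R x)))\<^sup>2) * indicator B x \<partial>lborel) \<le>
        ennreal K * (\<integral>\<^sup>+x. ennreal ((cmod (h (0 + r *\<^sub>R x)))\<^sup>2) * indicator B x \<partial>lborel)"
        by (simp add: mult.assoc[symmetric])
    qed
    also have "ennreal K * (\<integral>\<^sup>+x. ennreal ((cmod (h (0 + r *\<^sub>R x)))\<^sup>2) * indicator B x \<partial>lborel) / V =
        ennreal K * ((\<integral>\<^sup>+x. ennreal ((cmod (h (0 + r *\<^sub>R x)))\<^sup>2) * indicator B x \<partial>lborel) / V)"
      by (simp add: ennreal_times_divide)
    also have "\<dots> = ennreal K * ennreal (\<integral>x. (cmod (h (0 + r *\<^sub>R x)))\<^sup>2 \<partial>?U)"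
      by (simp only: Uint[OF r1])
    also have "\<dots> = ennreal (K * (\<integral>x. (cmod (h (0 + r *\<^sub>R x)))\<^sup>2 \<partial>?U))"
      using K by (simp add: ennreal_mult')
    also have "\<dots> \<le> ennreal (K * (Hardy2_norm h)\<^sup>2)"
      using ball_mean_le_Hardy2_norm[OF h, of r] r K by (intro ennreal_leI mult_left_mono) (auto simp: B_def)
    finally show ?thesis using K by simp
  qed
  then have "cmod (h z) \<le> sqrt K * Hardy2_norm h" if "h \<in> Hardy2" "norm z \<le> s" for h :: "complex ^ 'n \<Rightarrow> complex" and z
    using real_le_rsqrt[of "cmod (h z)" "K * (Hardy2_norm h)\<^sup>2"] that by (simp add: real_sqrt_mult Hardy2_norm_nonneg)
  with K show ?thesis by (intro that[of "sqrt K"]) auto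
qed

section \<open>Completeness of the Hardy space\<close>

lemma Hardy2_diff: "g \<in> Hardy2 \<Longrightarrow> h \<in> Hardy2 \<Longrightarrow> (\<lambda>z. g z - h z) \<in> Hardy2"
  using Hardy2_lincomb[of g h 1 "- 1"] by simp

lemma Hardy2_add: "g \<in> Hardy2 \<Longrightarrow> h \<in> Hardy2 \<Longrightarrow> (\<lambda>z. g z + h z) \<in> Hardy2"
  using Hardy2_lincomb[of g h 1 1] by simp

lemma Hardy2_cmult: "h \<in> Hardy2 \<Longrightarrow> (\<lambda>z. a * h z) \<in> Hardy2"
  using Hardy2_lincomb[of h h a 0] by simp

lemma Hardy2_zero: "(\<lambda>_. 0) \<in> Hardy2"
  by (rule Hardy2I[where B = 0]) (auto intro: holomorphic_fun_on_const)

text \<open>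
  Cauchy's estimate on the complex line through \<open>z\<close> in the direction \<open>v\<close>.
\<close>

lemma derivative_Cauchy_bound:
  fixes f :: "complex ^ 'n \<Rightarrow> complex"
  assumes f: "holomorphic_fun_on f U" "open U" and \<rho>: "0 < \<rho>" "cball z \<rho> \<subseteq> U"
    and B: "\<And>y. y \<in> cball z \<rho> \<Longrightarrow> cmod (f y) \<le> B"
    and D: "(f has_derivative D) (at z)" "\<And>c v. D (c *s v) = c * D v"
  shows "cmod (D v) \<le> B / \<rho> * norm v"
proof (cases "v = 0")
  case True
  then show ?thesis using D(2)[of 0 v] by simp
next
  case False
  define r where "r = \<rho> / norm v"
  have r: "0 < r" "r * norm v = \<rho>" using False \<rho> by (auto simp: r_def)
  let ?g = "\<lambda>l. f (z + l *s v)"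
  have in_cball: "z + l *s v \<in> cball z \<rho>" if "cmod l \<le> r" for l
  proof -
    have "cmod l * norm v \<le> r * norm v" using that by (intro mult_right_mono) auto
    then show ?thesis using r(2) by (simp add: dist_norm norm_vector_smult)
  qed
  have hol: "?g holomorphic_on cball 0 r"
    by (rule holomorphic_on_subset[OF slice_holomorphic[OF f]]) (use in_cball \<rho>(2) in auto)
  have "(?g has_field_derivative D v) (at 0)"
    by (rule slice_has_field_derivative) (use D in auto)
  then have d: "deriv ?g 0 = D v" by (rule DERIV_imp_deriv)
  have "cmod ((deriv ^^ 1) ?g 0) \<le> fact 1 * B / r ^ 1"
    by (rule Cauchy_inequality)
       (use hol r B in_cball in \<open>auto intro: holomorphic_on_subset holomorphic_on_imp_continuous_on\<close>)
  then show ?thesis using d False by (simp add: r_def)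
qed

text \<open>
  Weierstrass' theorem: Cauchy's estimate turns uniform convergence of the functions into uniform
  convergence of their derivatives.
\<close>

lemma holomorphic_uniform_limit:
  fixes H :: "nat \<Rightarrow> complex ^ 'n \<Rightarrow> complex"
  assumes H: "\<And>n. holomorphic_fun_on (H n) U" and U: "open U"
    and cauchy: "\<And>z. z \<in> U \<Longrightarrow> \<exists>\<rho>>0. cball z \<rho> \<subseteq> U \<and>
       (\<forall>e>0. \<exists>N. \<forall>m\<ge>N. \<forall>n\<ge>N. \<forall>y\<in>cball z \<rho>. cmod (H m y - H n y) \<le> e)"
    and lim: "\<And>z. z \<in> U \<Longrightarrow> (\<lambda>n. H n z) \<longlonglongrightarrow> h z"
  shows "holomorphic_fun_on h U"
  unfolding holomorphic_fun_on_def
proof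
  fix z0 assume z0: "z0 \<in> U"
  obtain \<rho> where \<rho>: "\<rho> > 0" "cball z0 \<rho> \<subseteq> U"
    and cau: "\<And>e. e > 0 \<Longrightarrow> \<exists>N. \<forall>m\<ge>N. \<forall>n\<ge>N. \<forall>y\<in>cball z0 \<rho>. cmod (H m y - H n y) \<le> e"
    using cauchy[OF z0] by blast
  let ?S = "ball z0 (\<rho> / 2)"
  have S: "cball x (\<rho> / 2) \<subseteq> cball z0 \<rho>" if "x \<in> ?S" for x
  proof
    fix y assume "y \<in> cball x (\<rho> / 2)"
    then show "y \<in> cball z0 \<rho>" using that dist_triangle[of z0 y x] by simp
  qed
  have SU: "x \<in> U" if "x \<in> ?S" for x using S[OF that] \<rho> by (meson centre_in_cball half_gt_zero less_imp_le subsetD)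
  have "\<forall>n x. \<exists>D. x \<in> ?S \<longrightarrow> (H n has_derivative D) (at x) \<and> (\<forall>c v. D (c *s v) = c * D v)"
    using H SU unfolding holomorphic_fun_on_def by blast
  then obtain D where D: "\<And>n x. x \<in> ?S \<Longrightarrow> (H n has_derivative D n x) (at x)"
    "\<And>n x c v. x \<in> ?S \<Longrightarrow> D n x (c *s v) = c * D n x v" by metis
  have diff: "cmod (D m x v - D n x v) \<le> e / (\<rho> / 2) * norm v"
    if e: "\<forall>y\<in>cball z0 \<rho>. cmod (H m y - H n y) \<le> e" and x: "x \<in> ?S" for m n x v e
  proof (rule derivative_Cauchy_bound[where U = U and z = x and f = "\<lambda>y. H m y - H n y"])
    show "holomorphic_fun_on (\<lambda>y. H m y - H n y) U"
      using holomorphic_fun_on_lincomb[OF H H, of 1 m "- 1" n] by simp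
    show "((\<lambda>y. H m y - H n y) has_derivative (\<lambda>v. D m x v - D n x v)) (at x)"
      by (intro has_derivative_diff D x)
  qed (use U \<rho> S[OF x] e D(2)[OF x] in \<open>auto simp: algebra_simps\<close>)
  have cauD: "\<exists>N. \<forall>m\<ge>N. \<forall>n\<ge>N. \<forall>x\<in>?S. \<forall>v. cmod (D m x v - D n x v) \<le> e * norm v" if "e > 0" for e
  proof -
    have pos: "0 < e * (\<rho> / 2)" using that \<rho>(1) by simp
    obtain N where N: "\<forall>m\<ge>N. \<forall>n\<ge>N. \<forall>y\<in>cball z0 \<rho>. cmod (H m y - H n y) \<le> e * (\<rho> / 2)"
      using cau[OF pos] by blast
    have "cmod (D m x v - D n x v) \<le> e * norm v" if "m \<ge> N" "n \<ge> N" "x \<in> ?S" for m n x v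
      using diff[of m n "e * (\<rho> / 2)" x v] N that \<rho> by simp
    then show ?thesis by blast
  qed
  have "convergent (\<lambda>n. D n x v)" if x: "x \<in> ?S" for x v
  proof (rule Cauchy_convergent, rule CauchyI)
    fix e :: real assume e: "e > 0"
    then have "e / (norm v + 1) > 0" by (simp add: add_nonneg_pos)
    from cauD[OF this] obtain N where N: "\<And>m n. m \<ge> N \<Longrightarrow> n \<ge> N \<Longrightarrow> cmod (D m x v - D n x v) \<le> e / (norm v + 1) * norm v"
      using x by blast
    have "0 < norm v + 1" by (rule add_nonneg_pos) auto
    then have "e / (norm v + 1) * norm v < e" using e by (simp add: pos_divide_less_eq algebra_simps)
    with N show "\<exists>M. \<forall>m\<ge>M. \<forall>n\<ge>M. norm (D m x v - D n x v) < e" by (meson le_less_trans)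
  qed
  then obtain G where G: "\<And>x v. x \<in> ?S \<Longrightarrow> (\<lambda>n. D n x v) \<longlonglongrightarrow> G x v" unfolding convergent_def by metis
  have unif: "eventually (\<lambda>n. \<forall>x\<in>?S. \<forall>v. cmod (D n x v - G x v) \<le> e * norm v) sequentially" if "e > 0" for e
  proof -
    obtain N where N: "\<And>m n x v. m \<ge> N \<Longrightarrow> n \<ge> N \<Longrightarrow> x \<in> ?S \<Longrightarrow> cmod (D m x v - D n x v) \<le> e * norm v"
      using cauD[OF \<open>e > 0\<close>] by blast
    have "cmod (D n x v - G x v) \<le> e * norm v" if "n \<ge> N" "x \<in> ?S" for n x v
    proof (rule tendsto_upperbound)
      show "(\<lambda>m. cmod (D n x v - D m x v)) \<longlonglongrightarrow> cmod (D n x v - G x v)"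
        by (intro tendsto_intros G that)
      show "eventually (\<lambda>m. cmod (D n x v - D m x v) \<le> e * norm v) sequentially"
        unfolding eventually_sequentially using N that by blast
    qed simp
    then show ?thesis unfolding eventually_sequentially by blast
  qed
  have "\<exists>g. \<forall>x\<in>?S. (\<lambda>n. H n x) \<longlonglongrightarrow> g x \<and> (g has_derivative G x) (at x within ?S)"
  proof (rule has_derivative_sequence[where f' = D and ?x0.0 = z0])
    show "(H n has_derivative D n x) (at x within ?S)" if "x \<in> ?S" for n x
      using D(1)[OF that] by (rule has_derivative_at_withinI)
  qed (use unif lim[OF z0] \<rho> in auto)
  then obtain g where g: "\<And>x. x \<in> ?S \<Longrightarrow> (\<lambda>n. H n x) \<longlonglongrightarrow> g x" "\<And>x. x \<in> ?S \<Longrightarrow> (g has_derivative G x) (at x within ?S)"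
    by blast
  have z0S: "z0 \<in> ?S" using \<rho> by simp
  have gh: "g x = h x" if "x \<in> ?S" for x using g(1)[OF that] lim[OF SU[OF that]] LIMSEQ_unique by blast
  have "(g has_derivative G z0) (at z0)" using g(2)[OF z0S] z0S by (simp add: at_within_open[OF z0S])
  then have "(h has_derivative G z0) (at z0)"
    by (rule has_derivative_transform_within_open[OF _ open_ball z0S]) (rule gh)
  moreover have "G z0 (c *s v) = c * G z0 v" for c v
  proof (rule LIMSEQ_unique[OF G[OF z0S]])
    show "(\<lambda>n. D n z0 (c *s v)) \<longlonglongrightarrow> c * G z0 v"
      unfolding D(2)[OF z0S] by (intro tendsto_intros G z0S)
  qed
  ultimately show "\<exists>D. (h has_derivative D) (at z0) \<and> (\<forall>c v. D (c *s v) = c * D v)" by blast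
qed

lemma Hardy2_norm_le:
  assumes "\<And>r. 0 < r \<Longrightarrow> r < 1 \<Longrightarrow> (\<integral>\<zeta>. (cmod (h (r *\<^sub>R \<zeta>)))\<^sup>2 \<partial>\<sigma>) \<le> e\<^sup>2" "0 \<le> e"
  shows "Hardy2_norm h \<le> e"
  unfolding Hardy2_norm_def
  by (rule real_le_lsqrt) (use assms in \<open>auto intro!: cSUP_least\<close>)

text \<open>
  By the bound for point evaluations the sequence converges locally uniformly to a holomorphic
  function.  The estimates of the means over a sphere of radius \<open>r < 1\<close> pass to the limit, and they
  are uniform in \<open>r\<close>.
\<close>

lemma Hardy2_complete:
  fixes H :: "nat \<Rightarrow> complex ^ 'n \<Rightarrow> complex"
  assumes H: "\<And>n. H n \<in> Hardy2"
    and cau: "\<And>e. e > 0 \<Longrightarrow> \<exists>N. \<forall>m\<ge>N. \<forall>n\<ge>N. Hardy2_norm (\<lambda>z. H m z - H n z) < e"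
  shows "\<exists>h\<in>Hardy2. (\<lambda>n. Hardy2_norm (\<lambda>z. H n z - h z)) \<longlonglongrightarrow> 0"
proof -
  have unif: "\<exists>N. \<forall>m\<ge>N. \<forall>n\<ge>N. \<forall>y\<in>cball 0 s. cmod (H m y - H n y) \<le> e" if s: "0 \<le> s" "s < 1" and e: "e > 0" for s e
  proof -
    obtain C where C: "C > 0" "\<And>(h :: complex ^ 'n \<Rightarrow> complex) z. h \<in> Hardy2 \<Longrightarrow> norm z \<le> s \<Longrightarrow> cmod (h z) \<le> C * Hardy2_norm h"
      using Hardy2_point_bound[OF s] by blast
    obtain N where N: "\<And>m n. m \<ge> N \<Longrightarrow> n \<ge> N \<Longrightarrow> Hardy2_norm (\<lambda>z. H m z - H n z) < e / C"
      using cau[of "e / C"] e C(1) by auto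
    have "cmod (H m y - H n y) \<le> e" if "m \<ge> N" "n \<ge> N" "y \<in> cball 0 s" for m n y
    proof -
      have "cmod (H m y - H n y) \<le> C * Hardy2_norm (\<lambda>z. H m z - H n z)"
        using that by (intro C(2)[of "\<lambda>z. H m z - H n z" y] Hardy2_diff H) auto
      also have "\<dots> \<le> C * (e / C)" using N[OF that(1,2)] C(1) by (intro mult_left_mono) auto
      finally show ?thesis using C(1) by simp
    qed
    then show ?thesis by blast
  qed
  have conv: "convergent (\<lambda>n. H n z)" for z
  proof (cases "z \<in> ball 0 1")
    case True
    show ?thesis
    proof (rule Cauchy_convergent, rule CauchyI)
      fix e :: real assume "e > 0"
      then obtain N where "\<forall>m\<ge>N. \<forall>n\<ge>N. \<forall>y\<in>cball 0 (norm z). cmod (H m y - H n y) \<le> e / 2"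
        using unif[of "norm z" "e / 2"] True by auto
      then have "\<forall>m\<ge>N. \<forall>n\<ge>N. cmod (H m z - H n z) \<le> e / 2" by simp
      then show "\<exists>M. \<forall>m\<ge>M. \<forall>n\<ge>M. norm (H m z - H n z) < e"
        using \<open>e > 0\<close> by (intro exI[of _ N]) (smt (verit) field_sum_of_halves)
    qed
  next
    case False
    then show ?thesis using Hardy2D(2)[OF H] by (simp add: convergent_const)
  qed
  define h where "h z = lim (\<lambda>n. H n z)" for z
  have lim: "(\<lambda>n. H n z) \<longlonglongrightarrow> h z" for z using conv[of z] by (simp add: h_def convergent_LIMSEQ_iff)
  have hol: "holomorphic_fun_on h (ball 0 1)"
  proof (rule holomorphic_uniform_limit[OF Hardy2D(1)[OF H] open_ball _ lim])
    fix z :: "complex ^ 'n" assume z: "z \<in> ball 0 1"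
    define \<rho> where "\<rho> = (1 - norm z) / 2"
    have \<rho>: "\<rho> > 0" "norm z + \<rho> < 1" "0 \<le> norm z + \<rho>" using z by (auto simp: \<rho>_def field_simps)
    have sub: "cball z \<rho> \<subseteq> cball 0 (norm z + \<rho>)"
    proof
      fix y assume "y \<in> cball z \<rho>"
      then show "y \<in> cball 0 (norm z + \<rho>)"
        using norm_triangle_ineq[of z "y - z"] by (simp add: dist_norm norm_minus_commute)
    qed
    have "\<exists>N. \<forall>m\<ge>N. \<forall>n\<ge>N. \<forall>y\<in>cball z \<rho>. cmod (H m y - H n y) \<le> e" if "e > 0" for e
      using unif[OF \<rho>(3,2) that] sub by (meson subsetD)
    moreover have "cball z \<rho> \<subseteq> ball 0 1" using sub \<rho>(2) by (force dest: subsetD)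
    ultimately show "\<exists>\<rho>>0. cball z \<rho> \<subseteq> ball 0 1 \<and> (\<forall>e>0. \<exists>N. \<forall>m\<ge>N. \<forall>n\<ge>N. \<forall>y\<in>cball z \<rho>. cmod (H m y - H n y) \<le> e)"
      using \<rho>(1) by blast
  qed
  have zero: "h z = 0" if "z \<notin> ball 0 1" for z
    using lim[of z] Hardy2D(2)[OF H that] LIMSEQ_unique[OF _ tendsto_const] by auto
  have key: "\<exists>N. \<forall>n\<ge>N. \<forall>r. 0 < r \<longrightarrow> r < 1 \<longrightarrow> (\<integral>\<zeta>. (cmod (H n (r *\<^sub>R \<zeta>) - h (r *\<^sub>R \<zeta>)))\<^sup>2 \<partial>\<sigma>) \<le> e\<^sup>2" if e: "e > 0" for e
  proof -
    obtain N where N: "\<And>m n. m \<ge> N \<Longrightarrow> n \<ge> N \<Longrightarrow> Hardy2_norm (\<lambda>z. H m z - H n z) < e" using cau[OF e] by blast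
    have "(\<integral>\<zeta>. (cmod (H n (r *\<^sub>R \<zeta>) - h (r *\<^sub>R \<zeta>)))\<^sup>2 \<partial>\<sigma>) \<le> e\<^sup>2" if n: "n \<ge> N" and r: "0 < r" "r < 1" for n r
    proof (rule LIMSEQ_le_const2)
      obtain C where C: "C > 0" "\<And>(h :: complex ^ 'n \<Rightarrow> complex) z. h \<in> Hardy2 \<Longrightarrow> norm z \<le> r \<Longrightarrow> cmod (h z) \<le> C * Hardy2_norm h"
        using Hardy2_point_bound[of r] r by auto
      show "(\<lambda>m. \<integral>\<zeta>. (cmod (H n (r *\<^sub>R \<zeta>) - H (m + N) (r *\<^sub>R \<zeta>)))\<^sup>2 \<partial>\<sigma>) \<longlonglongrightarrow> (\<integral>\<zeta>. (cmod (H n (r *\<^sub>R \<zeta>) - h (r *\<^sub>R \<zeta>)))\<^sup>2 \<partial>\<sigma>)"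
      proof (rule integral_dominated_convergence[where w = "\<lambda>_. (C * e)\<^sup>2"])
        note [measurable] = Hardy2_dilate_measurable[OF H]
        have "(\<lambda>\<zeta>. h (r *\<^sub>R \<zeta>)) \<in> borel_measurable \<sigma>"
          by (rule borel_measurable_LIMSEQ_metric[OF _ lim]) measurable
        note [measurable] = this
        show "(\<lambda>\<zeta>. (cmod (H n (r *\<^sub>R \<zeta>) - h (r *\<^sub>R \<zeta>)))\<^sup>2) \<in> borel_measurable \<sigma>" by measurable
        show "(\<lambda>\<zeta>. (cmod (H n (r *\<^sub>R \<zeta>) - H (m + N) (r *\<^sub>R \<zeta>)))\<^sup>2) \<in> borel_measurable \<sigma>" for m by measurable
        show "AE \<zeta> in \<sigma>. (\<lambda>m. (cmod (H n (r *\<^sub>R \<zeta>) - H (m + N) (r *\<^sub>R \<zeta>)))\<^sup>2) \<longlonglongrightarrow> (cmod (H n (r *\<^sub>R \<zeta>) - h (r *\<^sub>R \<zeta>)))\<^sup>2"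
          by (rule AE_I2) (intro tendsto_intros LIMSEQ_ignore_initial_segment lim)
        show "AE \<zeta> in \<sigma>. norm ((cmod (H n (r *\<^sub>R \<zeta>) - H (m + N) (r *\<^sub>R \<zeta>)))\<^sup>2) \<le> (C * e)\<^sup>2" for m
        proof (rule AE_I2)
          fix \<zeta> :: "complex ^ 'n" assume "\<zeta> \<in> space \<sigma>"
          then have "cmod (H n (r *\<^sub>R \<zeta>) - H (m + N) (r *\<^sub>R \<zeta>)) \<le> C * Hardy2_norm (\<lambda>z. H n z - H (m + N) z)"
            using r by (intro C(2)[of "\<lambda>z. H n z - H (m + N) z"] Hardy2_diff H) auto
          also have "\<dots> \<le> C * e" using N[OF n, of "m + N"] C(1) by (intro mult_left_mono) auto
          finally show "norm ((cmod (H n (r *\<^sub>R \<zeta>) - H (m + N) (r *\<^sub>R \<zeta>)))\<^sup>2) \<le> (C * e)\<^sup>2"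
            by (simp add: power_mono)
        qed
      qed simp
      have "(\<integral>\<zeta>. (cmod (H n (r *\<^sub>R \<zeta>) - H m (r *\<^sub>R \<zeta>)))\<^sup>2 \<partial>\<sigma>) \<le> e\<^sup>2" if "m \<ge> N" for m
      proof -
        have d: "(\<lambda>z. H n z - H m z) \<in> Hardy2" by (intro Hardy2_diff H)
        have "(\<integral>\<zeta>. (cmod (H n (r *\<^sub>R \<zeta>) - H m (r *\<^sub>R \<zeta>)))\<^sup>2 \<partial>\<sigma>) \<le> (Hardy2_norm (\<lambda>z. H n z - H m z))\<^sup>2"
          using sq_integrable_dilate(2)[OF d, of r] r by (simp add: sq_norm_def)
        also have "\<dots> \<le> e\<^sup>2" using N[OF n that] Hardy2_norm_nonneg[OF d] by (intro power_mono) auto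
        finally show ?thesis .
      qed
      then show "\<exists>M. \<forall>m\<ge>M. (\<integral>\<zeta>. (cmod (H n (r *\<^sub>R \<zeta>) - H (m + N) (r *\<^sub>R \<zeta>)))\<^sup>2 \<partial>\<sigma>) \<le> e\<^sup>2" by auto
    qed
    then show ?thesis by blast
  qed
  have hH: "h \<in> Hardy2"
  proof -
    obtain N where N: "\<And>r. 0 < r \<Longrightarrow> r < 1 \<Longrightarrow> (\<integral>\<zeta>. (cmod (H N (r *\<^sub>R \<zeta>) - h (r *\<^sub>R \<zeta>)))\<^sup>2 \<partial>\<sigma>) \<le> 1\<^sup>2" using key[of 1] by fastforce
    have "(\<lambda>z. H N z - h z) \<in> Hardy2"
    proof (rule Hardy2I)
      show "holomorphic_fun_on (\<lambda>z. H N z - h z) (ball 0 1)"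
        using holomorphic_fun_on_lincomb[OF Hardy2D(1)[OF H[of N]] hol, of 1 "- 1"] by simp
    qed (use N zero Hardy2D(2)[OF H[of N]] in auto)
    from Hardy2_diff[OF H[of N] this] show ?thesis by simp
  qed
  have "(\<lambda>n. Hardy2_norm (\<lambda>z. H n z - h z)) \<longlonglongrightarrow> 0"
  proof (rule LIMSEQ_I)
    fix e :: real assume e: "e > 0"
    obtain N where N: "\<And>n r. n \<ge> N \<Longrightarrow> 0 < r \<Longrightarrow> r < 1 \<Longrightarrow> (\<integral>\<zeta>. (cmod (H n (r *\<^sub>R \<zeta>) - h (r *\<^sub>R \<zeta>)))\<^sup>2 \<partial>\<sigma>) \<le> (e / 2)\<^sup>2"
      using key[of "e / 2"] e by auto
    have "norm (Hardy2_norm (\<lambda>z. H n z - h z) - 0) < e" if "n \<ge> N" for n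
    proof -
      have "Hardy2_norm (\<lambda>z. H n z - h z) \<le> e / 2" by (rule Hardy2_norm_le) (use N[OF that] e in auto)
      then show ?thesis using Hardy2_norm_nonneg[OF Hardy2_diff[OF H[of n] hH]] e by simp
    qed
    then show "\<exists>N. \<forall>n\<ge>N. norm (Hardy2_norm (\<lambda>z. H n z - h z) - 0) < e" by blast
  qed
  with hH show ?thesis by blast
qed

section \<open>Orthogonal projection and Toeplitz operators\<close>

lemma boundary_diff:
  fixes g h :: "complex ^ 'n \<Rightarrow> complex"
  assumes "g \<in> Hardy2" "h \<in> Hardy2"
  shows "AE \<zeta> in \<sigma>. boundary_fun (\<lambda>z. g z - h z) \<zeta> = boundary_fun g \<zeta> - boundary_fun h \<zeta>"
  using boundary_lincomb[OF assms, of 1 "- 1"] by simp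

lemma Hardy2_norm_diff:
  fixes g h :: "complex ^ 'n \<Rightarrow> complex"
  assumes g: "g \<in> Hardy2" and h: "h \<in> Hardy2"
  shows "(Hardy2_norm (\<lambda>z. g z - h z))\<^sup>2 = sq_norm (\<lambda>\<zeta>. boundary_fun g \<zeta> - boundary_fun h \<zeta>)"
  unfolding Hardy2_norm_boundary[OF Hardy2_diff[OF g h]]
  by (rule sq_norm_cong_AE[OF boundary_diff[OF g h]])
     (auto intro!: boundary_fun_measurable Hardy2_diff g h borel_measurable_diff)

lemma Hardy2_eq_zero:
  assumes h: "h \<in> Hardy2" and "Hardy2_norm h = 0"
  shows "h = (\<lambda>_. 0)"
proof
  fix z
  show "h z = 0"
  proof (cases "z \<in> ball 0 1")
    case True
    then obtain C where "C > 0" and C: "\<And>(h :: complex ^ 'a \<Rightarrow> complex) w. h \<in> Hardy2 \<Longrightarrow> norm w \<le> norm z \<Longrightarrow> cmod (h w) \<le> C * Hardy2_norm h"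
      using Hardy2_point_bound[of "norm z"] by (metis mem_ball_0 norm_ge_zero)
    from C[OF h, of z] assms(2) show ?thesis by simp
  qed (rule Hardy2D(2)[OF h])
qed

lemma sq_norm_cmult: "sq_norm (\<lambda>\<zeta>. c * u \<zeta>) = (cmod c)\<^sup>2 * sq_norm u"
  by (simp add: sq_norm_def norm_mult power_mult_distrib)

lemma sq_norm_parallelogram:
  assumes u: "sq_integrable u" and v: "sq_integrable v"
  shows "sq_norm (\<lambda>\<zeta>. u \<zeta> - v \<zeta>) + sq_norm (\<lambda>\<zeta>. u \<zeta> + v \<zeta>) = 2 * sq_norm u + 2 * sq_norm v"
  using sq_norm_add_cmult[OF u v, of 1] sq_norm_add_cmult[OF u v, of "- 1"] by simp

text \<open>
  The projection of \<open>g\<close> minimizes the distance to \<open>g\<close>; a minimizing sequence is Cauchy by the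
  parallelogram law.
\<close>

lemma Hardy2_nearest_point:
  fixes g :: "complex ^ 'n \<Rightarrow> complex"
  assumes g: "sq_integrable g"
  shows "\<exists>h\<in>Hardy2. \<forall>k\<in>Hardy2. sq_norm (\<lambda>\<zeta>. g \<zeta> - boundary_fun h \<zeta>) \<le> sq_norm (\<lambda>\<zeta>. g \<zeta> - boundary_fun k \<zeta>)"
proof -
  define Q where "Q h = sq_norm (\<lambda>\<zeta>. g \<zeta> - boundary_fun h \<zeta>)" for h
  define d where "d = Inf (Q ` Hardy2)"
  have Q0: "0 \<le> Q h" for h by (simp add: Q_def sq_norm_nonneg)
  have ne: "(Hardy2 :: (complex ^ 'n \<Rightarrow> complex) set) \<noteq> {}" using Hardy2_zero by blast
  have bdd: "bdd_below (Q ` Hardy2)" using Q0 by (auto intro!: bdd_belowI2)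
  have dle: "d \<le> Q h" if "h \<in> Hardy2" for h unfolding d_def by (rule cINF_lower[OF bdd that])
  have "\<exists>h\<in>Hardy2. Q h < d + 1 / real (Suc n)" for n
    using cINF_less_iff[OF ne bdd] unfolding d_def by (metis less_add_same_cancel1 of_nat_0_less_iff zero_less_Suc zero_less_divide_1_iff)
  then obtain H where H: "\<And>n. H n \<in> Hardy2" "\<And>n. Q (H n) < d + 1 / real (Suc n)" by metis
  have si: "sq_integrable (\<lambda>\<zeta>. g \<zeta> - boundary_fun h \<zeta>)" if "h \<in> Hardy2" for h
    by (intro sq_integrable_diff g boundary_sq_integrable that)
  have para: "(Hardy2_norm (\<lambda>z. a z - b z))\<^sup>2 \<le> 2 * Q a + 2 * Q b - 4 * d" if a: "a \<in> Hardy2" and b: "b \<in> Hardy2" for a b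
  proof -
    let ?u = "\<lambda>\<zeta>. g \<zeta> - boundary_fun a \<zeta>" and ?v = "\<lambda>\<zeta>. g \<zeta> - boundary_fun b \<zeta>"
    let ?c = "\<lambda>z. (1 / 2) * a z + (1 / 2) * b z"
    have c: "?c \<in> Hardy2" by (rule Hardy2_lincomb[OF a b])
    have [measurable]: "boundary_fun a \<in> borel_measurable \<sigma>" "boundary_fun b \<in> borel_measurable \<sigma>" "boundary_fun ?c \<in> borel_measurable \<sigma>" "g \<in> borel_measurable \<sigma>"
      using a b c g by (auto intro: boundary_fun_measurable sq_integrable_measurable)
    have "sq_norm (\<lambda>\<zeta>. ?u \<zeta> - ?v \<zeta>) = (Hardy2_norm (\<lambda>z. b z - a z))\<^sup>2"
      unfolding Hardy2_norm_diff[OF b a] by simp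
    moreover have "(Hardy2_norm (\<lambda>z. b z - a z))\<^sup>2 = (Hardy2_norm (\<lambda>z. a z - b z))\<^sup>2"
      unfolding Hardy2_norm_diff[OF b a] Hardy2_norm_diff[OF a b] sq_norm_def by (simp add: norm_minus_commute)
    moreover have "sq_norm (\<lambda>\<zeta>. ?u \<zeta> + ?v \<zeta>) = 4 * Q ?c"
    proof -
      have "sq_norm (\<lambda>\<zeta>. ?u \<zeta> + ?v \<zeta>) = sq_norm (\<lambda>\<zeta>. 2 * (g \<zeta> - boundary_fun ?c \<zeta>))"
      proof (rule sq_norm_cong_AE)
        show "AE \<zeta> in \<sigma>. ?u \<zeta> + ?v \<zeta> = 2 * (g \<zeta> - boundary_fun ?c \<zeta>)"
          using boundary_lincomb[OF a b, of "1 / 2" "1 / 2"] by eventually_elim (simp add: algebra_simps)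
      qed measurable
      also have "\<dots> = 4 * Q ?c" unfolding Q_def by (subst sq_norm_cmult) simp
      finally show ?thesis .
    qed
    ultimately have "(Hardy2_norm (\<lambda>z. a z - b z))\<^sup>2 + 4 * Q ?c = 2 * Q a + 2 * Q b"
      using sq_norm_parallelogram[OF si[OF a] si[OF b]] by (simp add: Q_def)
    then show ?thesis using dle[OF c] by linarith
  qed
  have "\<exists>h\<in>Hardy2. (\<lambda>n. Hardy2_norm (\<lambda>z. H n z - h z)) \<longlonglongrightarrow> 0"
  proof (rule Hardy2_complete[OF H(1)])
    fix e :: real assume e: "e > 0"
    then have "e\<^sup>2 / 4 > 0" by simp
    then obtain N where N: "1 / real (Suc N) < e\<^sup>2 / 4" by (rule nat_approx_posE)
    have "Hardy2_norm (\<lambda>z. H m z - H n z) < e" if "m \<ge> N" "n \<ge> N" for m n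
    proof -
      have "1 / real (Suc m) \<le> 1 / real (Suc N)" "1 / real (Suc n) \<le> 1 / real (Suc N)" using that by (auto simp: field_simps)
      then have "(Hardy2_norm (\<lambda>z. H m z - H n z))\<^sup>2 < e\<^sup>2"
        using para[OF H(1) H(1), of m n] H(2)[of m] H(2)[of n] N by linarith
      then show ?thesis using e by (meson less_imp_le power2_less_imp_less)
    qed
    then show "\<exists>N. \<forall>m\<ge>N. \<forall>n\<ge>N. Hardy2_norm (\<lambda>z. H m z - H n z) < e" by blast
  qed
  then obtain h where h: "h \<in> Hardy2" and lim: "(\<lambda>n. Hardy2_norm (\<lambda>z. H n z - h z)) \<longlonglongrightarrow> 0" by blast
  have "Q h \<le> d"
  proof -
    have "(\<lambda>n. d + 1 / real (Suc n) + (2 * (sqrt ((d + 1) * (Hardy2_norm (\<lambda>z. H n z - h z))\<^sup>2)) + (Hardy2_norm (\<lambda>z. H n z - h z))\<^sup>2)) \<longlonglongrightarrow> d + 0 + (2 * sqrt ((d + 1) * 0\<^sup>2) + 0\<^sup>2)"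
      by (intro tendsto_intros lim) (use lim_1_over_n[where 'a = real, THEN LIMSEQ_Suc] in simp)
    moreover have "Q h \<le> d + 1 / real (Suc n) + (2 * (sqrt ((d + 1) * (Hardy2_norm (\<lambda>z. H n z - h z))\<^sup>2)) + (Hardy2_norm (\<lambda>z. H n z - h z))\<^sup>2)" for n
    proof -
      let ?u = "\<lambda>\<zeta>. g \<zeta> - boundary_fun (H n) \<zeta>" and ?v = "\<lambda>\<zeta>. boundary_fun (H n) \<zeta> - boundary_fun h \<zeta>"
      have v: "sq_integrable ?v" by (intro sq_integrable_diff boundary_sq_integrable H h)
      have "Q h = Q (H n) + 2 * Re (L2_inner ?u ?v) + sq_norm ?v"
        using sq_norm_add_cmult[OF si[OF H(1)] v, of n 1] by (simp add: Q_def)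
      moreover have "1 / real (Suc n) \<le> 1" by simp
      then have "sq_norm ?u \<le> d + 1" using H(2)[of n] unfolding Q_def by linarith
      then have "cmod (L2_inner ?u ?v) \<le> sqrt ((d + 1) * sq_norm ?v)"
        by (rule L2_inner_bound[OF si[OF H(1)] v]) simp
      ultimately show ?thesis
        unfolding Hardy2_norm_diff[OF H(1) h] using H(2)[of n] complex_Re_le_cmod[of "L2_inner ?u ?v"] by linarith
    qed
    ultimately show ?thesis by (intro LIMSEQ_le_const) auto
  qed
  then show ?thesis using h dle unfolding Q_def by (meson order_trans)
qed

text \<open>
  The nearest point \<open>h\<close> works: with \<open>L = \<langle>g - h, k\<rangle>\<close>, moving \<open>h\<close> to \<open>h + t L k\<close> for small \<open>t > 0\<close> would
  shorten the distance unless \<open>L = 0\<close>.  Uniqueness makes the definite description in the definition of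
  the projection meaningful.
\<close>

lemma Hardy2_projection_ex1:
  fixes g :: "complex ^ 'n \<Rightarrow> complex"
  assumes g: "sq_integrable g"
  shows "\<exists>!h. h \<in> Hardy2 \<and> (\<forall>k\<in>Hardy2. L2_inner (\<lambda>\<zeta>. g \<zeta> - boundary_fun h \<zeta>) (boundary_fun k) = 0)"
proof (rule ex_ex1I)
  obtain h where h: "h \<in> Hardy2" and min: "\<And>k. k \<in> Hardy2 \<Longrightarrow> sq_norm (\<lambda>\<zeta>. g \<zeta> - boundary_fun h \<zeta>) \<le> sq_norm (\<lambda>\<zeta>. g \<zeta> - boundary_fun k \<zeta>)"
    using Hardy2_nearest_point[OF g] by blast
  let ?u = "\<lambda>\<zeta>. g \<zeta> - boundary_fun h \<zeta>"
  have u: "sq_integrable ?u" by (intro sq_integrable_diff g boundary_sq_integrable h)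
  have "L2_inner ?u (boundary_fun k) = 0" if k: "k \<in> Hardy2" for k
  proof -
    let ?L = "L2_inner ?u (boundary_fun k)"
    define s where "s = sq_norm (boundary_fun k)"
    define t where "t = 1 / (s + 1)"
    have s: "s \<ge> 0" by (simp add: s_def sq_norm_nonneg)
    then have t: "t > 0" "t * s < 1" by (auto simp: t_def divide_less_eq add_nonneg_pos)
    let ?c = "of_real t * ?L"
    have kc: "(\<lambda>z. 1 * h z + ?c * k z) \<in> Hardy2" by (rule Hardy2_lincomb[OF h k])
    have [measurable]: "boundary_fun h \<in> borel_measurable \<sigma>" "boundary_fun k \<in> borel_measurable \<sigma>" "g \<in> borel_measurable \<sigma>"
      "boundary_fun (\<lambda>z. 1 * h z + ?c * k z) \<in> borel_measurable \<sigma>"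
      using h k g kc by (auto intro: boundary_fun_measurable sq_integrable_measurable)
    have "sq_norm (\<lambda>\<zeta>. g \<zeta> - boundary_fun (\<lambda>z. 1 * h z + ?c * k z) \<zeta>) = sq_norm (\<lambda>\<zeta>. ?u \<zeta> + (- ?c) * boundary_fun k \<zeta>)"
    proof (rule sq_norm_cong_AE)
      show "AE \<zeta> in \<sigma>. g \<zeta> - boundary_fun (\<lambda>z. 1 * h z + ?c * k z) \<zeta> = ?u \<zeta> + (- ?c) * boundary_fun k \<zeta>"
        using boundary_lincomb[OF h k, of 1 ?c] by eventually_elim simp
    qed measurable
    also have "\<dots> = sq_norm ?u + 2 * Re (cnj (- ?c) * ?L) + (cmod (- ?c))\<^sup>2 * s"
      unfolding s_def by (rule sq_norm_add_cmult[OF u boundary_sq_integrable[OF k]])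
    also have "Re (cnj (- ?c) * ?L) = - t * (cmod ?L)\<^sup>2"
    proof -
      have "cnj ?L * ?L = of_real ((cmod ?L)\<^sup>2)" by (simp only: complex_norm_square mult.commute)
      then have "cnj (- ?c) * ?L = of_real (- t * (cmod ?L)\<^sup>2)" by (simp add: mult.assoc)
      then show ?thesis by (simp only: Re_complex_of_real)
    qed
    also have "(cmod (- ?c))\<^sup>2 = t\<^sup>2 * (cmod ?L)\<^sup>2" by (simp add: norm_mult power_mult_distrib)
    finally have "0 \<le> - 2 * t * (cmod ?L)\<^sup>2 + t\<^sup>2 * (cmod ?L)\<^sup>2 * s"
      using min[OF kc] by simp
    also have "\<dots> = t * (cmod ?L)\<^sup>2 * (t * s - 2)" by (simp add: power2_eq_square algebra_simps)
    finally have nn: "0 \<le> t * (cmod ?L)\<^sup>2 * (t * s - 2)" .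
    show ?thesis
    proof (rule ccontr)
      assume "?L \<noteq> 0"
      then have "0 < t * (cmod ?L)\<^sup>2" using t by simp
      moreover have "t * s - 2 < 0" using t by simp
      ultimately have "t * (cmod ?L)\<^sup>2 * (t * s - 2) < 0" by (rule mult_pos_neg)
      with nn show False by simp
    qed
  qed
  with h show "\<exists>h. h \<in> Hardy2 \<and> (\<forall>k\<in>Hardy2. L2_inner (\<lambda>\<zeta>. g \<zeta> - boundary_fun h \<zeta>) (boundary_fun k) = 0)" by blast
next
  fix a b
  assume a: "a \<in> Hardy2 \<and> (\<forall>k\<in>Hardy2. L2_inner (\<lambda>\<zeta>. g \<zeta> - boundary_fun a \<zeta>) (boundary_fun k) = 0)"
    and b: "b \<in> Hardy2 \<and> (\<forall>k\<in>Hardy2. L2_inner (\<lambda>\<zeta>. g \<zeta> - boundary_fun b \<zeta>) (boundary_fun k) = 0)"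
  let ?k = "\<lambda>z. a z - b z"
  have aH: "a \<in> Hardy2" and bH: "b \<in> Hardy2" and k: "?k \<in> Hardy2" using a b Hardy2_diff by auto
  note si = boundary_sq_integrable[OF aH] boundary_sq_integrable[OF bH] boundary_sq_integrable[OF k]
  have eq: "L2_inner g (boundary_fun ?k) - L2_inner (boundary_fun x) (boundary_fun ?k) = 0" if "x \<in> {a, b}" for x
    using that a b k L2_inner_diff_left[OF g si(1) si(3)] L2_inner_diff_left[OF g si(2) si(3)] by auto
  have "L2_inner (boundary_fun ?k) (boundary_fun ?k) = L2_inner (\<lambda>\<zeta>. boundary_fun a \<zeta> - boundary_fun b \<zeta>) (boundary_fun ?k)"
    by (rule L2_inner_cong_AE[OF boundary_diff[OF aH bH]])
       (auto intro!: boundary_fun_measurable k aH bH borel_measurable_diff)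
  also have "\<dots> = 0"
    using eq[of a] eq[of b] by (simp add: L2_inner_diff_left[OF si(1,2,3)])
  finally have "(Hardy2_norm ?k)\<^sup>2 = 0" by (simp add: L2_inner_self Hardy2_norm_boundary[OF k])
  then have "?k = (\<lambda>_. 0)" by (intro Hardy2_eq_zero k) simp
  then show "a = b" by (metis (no_types) eq_iff_diff_eq_0 ext)
qed

lemma toeplitz:
  fixes f h k :: "complex ^ 'n \<Rightarrow> complex"
  assumes f: "f \<in> Linfty_sphere" and h: "h \<in> Hardy2"
  shows "toeplitz f h \<in> Hardy2"
    and "k \<in> Hardy2 \<Longrightarrow> L2_inner (boundary_fun (toeplitz f h)) (boundary_fun k) = L2_inner (\<lambda>\<zeta>. f \<zeta> * boundary_fun h \<zeta>) (boundary_fun k)"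
    and "sq_integrable (\<lambda>\<zeta>. f \<zeta> * boundary_fun h \<zeta>)"
proof -
  obtain B where "f \<in> borel_measurable \<sigma>" "AE \<zeta> in \<sigma>. cmod (f \<zeta>) \<le> B" using f unfolding Linfty_sphere_def by blast
  then show g: "sq_integrable (\<lambda>\<zeta>. f \<zeta> * boundary_fun h \<zeta>)"
    by (rule sq_integrable_bounded_mult[OF _ _ boundary_sq_integrable[OF h]])
  from theI'[OF Hardy2_projection_ex1[OF g]]
  have P: "toeplitz f h \<in> Hardy2" "\<And>k. k \<in> Hardy2 \<Longrightarrow> L2_inner (\<lambda>\<zeta>. f \<zeta> * boundary_fun h \<zeta> - boundary_fun (toeplitz f h) \<zeta>) (boundary_fun k) = 0"
    unfolding toeplitz_def Hardy2_proj_def by blast+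
  show "toeplitz f h \<in> Hardy2" by (rule P(1))
  show "L2_inner (boundary_fun (toeplitz f h)) (boundary_fun k) = L2_inner (\<lambda>\<zeta>. f \<zeta> * boundary_fun h \<zeta>) (boundary_fun k)" if k: "k \<in> Hardy2"
    using P(2)[OF k] by (simp add: L2_inner_diff_left[OF g boundary_sq_integrable[OF P(1)] boundary_sq_integrable[OF k]])
qed

section \<open>Compact operators on functions of high vanishing order\<close>

text \<open>
  A growth condition at the origin is convenient here, as it is visibly improved by
  multiplication with a coordinate.  The radius \<open>1 / 2\<close> stands for any radius below \<open>1\<close>.
\<close>

definition vanishes_to_order :: "nat \<Rightarrow> (complex ^ 'n \<Rightarrow> complex) \<Rightarrow> bool" where
  "vanishes_to_order m h \<longleftrightarrow> (\<exists>C. \<forall>z\<in>cball 0 (1 / 2). cmod (h z) \<le> C * norm z ^ m)"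

lemma vanishes_to_order_0:
  fixes h :: "complex ^ 'n \<Rightarrow> complex"
  assumes h: "h \<in> Hardy2"
  shows "vanishes_to_order 0 h"
proof -
  have "compact (h ` cball 0 (1 / 2))"
    by (intro compact_continuous_image continuous_on_subset[OF holomorphic_fun_on_imp_continuous_on[OF Hardy2D(1)[OF h]]]) auto
  then obtain B where "\<forall>x\<in>cball 0 (1 / 2). cmod (h x) \<le> B" using compact_imp_bounded bounded_iff by (metis imageI)
  then show ?thesis by (auto simp: vanishes_to_order_def)
qed

lemma vanishes_to_order_coord_mult:
  assumes "vanishes_to_order m h"
  shows "vanishes_to_order (Suc m) (coord_mult j h)"
proof -
  obtain C where C: "\<And>z. z \<in> cball 0 (1 / 2) \<Longrightarrow> cmod (h z) \<le> C * norm z ^ m"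
    using assms unfolding vanishes_to_order_def by blast
  have "cmod (coord_mult j h z) \<le> C * norm z ^ Suc m" if "z \<in> cball 0 (1 / 2)" for z
  proof -
    have "cmod (z $ j) * cmod (h z) \<le> norm z * (C * norm z ^ m)"
      by (intro mult_mono C that Finite_Cartesian_Product.norm_nth_le) auto
    then show ?thesis by (simp add: coord_mult_def norm_mult mult_ac)
  qed
  then show ?thesis unfolding vanishes_to_order_def by blast
qed

lemma vanishes_to_order_mono:
  assumes "vanishes_to_order p h" "m \<le> p"
  shows "vanishes_to_order m h"
proof -
  obtain C where C: "\<And>z. z \<in> cball 0 (1 / 2) \<Longrightarrow> cmod (h z) \<le> C * norm z ^ p"
    using assms unfolding vanishes_to_order_def by blast
  have "cmod (h z) \<le> \<bar>C\<bar> * norm z ^ m" if "z \<in> cball 0 (1 / 2)" for z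
  proof -
    have "norm z ^ p \<le> norm z ^ m" using that assms(2) by (intro power_decreasing) auto
    then have "\<bar>C\<bar> * norm z ^ p \<le> \<bar>C\<bar> * norm z ^ m" by (intro mult_left_mono) auto
    moreover have "C * norm z ^ p \<le> \<bar>C\<bar> * norm z ^ p" by (intro mult_right_mono) auto
    ultimately show ?thesis using C[OF that] by linarith
  qed
  then show ?thesis unfolding vanishes_to_order_def by blast
qed

lemma vanishes_to_order_cmult: "vanishes_to_order m h \<Longrightarrow> vanishes_to_order m (\<lambda>z. a * h z)"
proof -
  assume "vanishes_to_order m h"
  then obtain C where C: "\<And>z. z \<in> cball 0 (1 / 2) \<Longrightarrow> cmod (h z) \<le> C * norm z ^ m"
    unfolding vanishes_to_order_def by blast
  have "cmod (a * h z) \<le> (cmod a * C) * norm z ^ m" if "z \<in> cball 0 (1 / 2)" for z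
    using mult_left_mono[OF C[OF that], of "cmod a"] by (simp add: norm_mult mult_ac)
  then show ?thesis unfolding vanishes_to_order_def by blast
qed

text \<open>
  Cauchy's estimate on circles whose radius tends to zero.
\<close>

lemma hcoeff_eq_0_if_vanishes:
  fixes h :: "complex ^ 'n \<Rightarrow> complex"
  assumes h: "holomorphic_fun_on h (ball 0 1)" and v: "vanishes_to_order m h" and k: "k < m" and \<zeta>: "norm \<zeta> = 1"
  shows "hcoeff h k \<zeta> = 0"
proof -
  obtain C where C: "\<And>z. z \<in> cball 0 (1 / 2) \<Longrightarrow> cmod (h z) \<le> C * norm z ^ m"
    using v unfolding vanishes_to_order_def by blast
  have "cmod (hcoeff h k \<zeta>) \<le> C * (1 / real (Suc (Suc n))) ^ (m - k)" for n
  proof -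
    let ?r = "1 / real (Suc (Suc n))"
    have r: "0 < ?r" "?r \<le> 1 / 2" by auto
    have "cmod (hcoeff h k \<zeta>) \<le> C * ?r ^ m / ?r ^ k"
    proof (rule hcoeff_bound[OF h r(1)])
      show "cmod (h (l *s \<zeta>)) \<le> C * ?r ^ m" if "cmod l = ?r" for l
        using C[of "l *s \<zeta>"] that r \<zeta> by (simp add: norm_vector_smult)
    qed (use r \<zeta> in simp)
    also have "\<dots> = C * ?r ^ (m - k)" using r k by (simp add: power_diff)
    finally show ?thesis .
  qed
  moreover have "(\<lambda>n. C * (1 / real (Suc (Suc n))) ^ (m - k)) \<longlonglongrightarrow> C * 0 ^ (m - k)"
    by (intro tendsto_intros lim_1_over_n[where 'a = real, THEN LIMSEQ_Suc, THEN LIMSEQ_Suc])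
  ultimately have "cmod (hcoeff h k \<zeta>) \<le> C * 0 ^ (m - k)"
    by (intro LIMSEQ_le_const) auto
  moreover have "(0 :: real) ^ (m - k) = 0" using k by simp
  ultimately show ?thesis by simp
qed

lemma hcoeff_sq_integrable:
  fixes h :: "complex ^ 'n \<Rightarrow> complex"
  assumes h: "holomorphic_fun_on h (ball 0 1)"
  shows "sq_integrable (hcoeff h k)"
proof -
  have m: "hcoeff h k \<in> borel_measurable \<sigma>"
    by (rule borel_measurable_sphere_measureI[OF hcoeff_measurable[OF h]]) simp
  have "0 < (1 / 2 :: real)" "1 / 2 * 1 < (1 :: real)" by simp_all
  from hcoeff_geometric_bound[OF h this]
  obtain B where "B \<ge> 0" and B: "\<And>x k. norm x \<le> 1 \<Longrightarrow> cmod (hcoeff h k x) \<le> B / (1 / 2) ^ k"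
    by blast
  have "integrable \<sigma> (\<lambda>\<zeta>. (cmod (hcoeff h k \<zeta>))\<^sup>2)"
  proof (rule sphere.integrable_const_bound[where B = "(B / (1 / 2) ^ k)\<^sup>2"])
    show "AE \<zeta> in \<sigma>. norm ((cmod (hcoeff h k \<zeta>))\<^sup>2) \<le> (B / (1 / 2) ^ k)\<^sup>2"
    proof (rule AE_I2)
      fix \<zeta> :: "complex ^ 'n" assume "\<zeta> \<in> space \<sigma>"
      then have "cmod (hcoeff h k \<zeta>) \<le> B / (1 / 2) ^ k" by (intro B) simp
      then have "(cmod (hcoeff h k \<zeta>))\<^sup>2 \<le> (B / (1 / 2) ^ k)\<^sup>2" by (intro power_mono) auto
      then show "norm ((cmod (hcoeff h k \<zeta>))\<^sup>2) \<le> (B / (1 / 2) ^ k)\<^sup>2" unfolding real_norm_def by simp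
    qed
  qed (use m in measurable)
  with m show ?thesis by (simp add: sq_integrable_def)
qed

text \<open>
  Weak convergence to zero of bounded functions that vanish to higher and higher order: by
  orthogonality only the components of \<open>w\<close> of degree at least \<open>m\<close> contribute, and these are small.
\<close>

lemma weakly_null_if_vanishing:
  fixes w :: "complex ^ 'n \<Rightarrow> complex"
  assumes w: "w \<in> Hardy2" and e: "e > 0"
  shows "\<exists>M. \<forall>m\<ge>M. \<forall>u\<in>Hardy2. vanishes_to_order m u \<longrightarrow> Hardy2_norm u \<le> 1 \<longrightarrow>
    cmod (L2_inner (boundary_fun w) (boundary_fun u)) \<le> e"
proof -
  let ?A = "coeff_norm2 w"
  define T where "T m = (Hardy2_norm w)\<^sup>2 - (\<Sum>k<m. ?A k)" for m
  have "T \<longlonglongrightarrow> (Hardy2_norm w)\<^sup>2 - (Hardy2_norm w)\<^sup>2"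
    unfolding T_def by (intro tendsto_intros) (use Hardy2_coeff_sums[OF w] in \<open>simp add: sums_def\<close>)
  then have "T \<longlonglongrightarrow> 0" by simp
  then have "eventually (\<lambda>m. T m < e\<^sup>2) sequentially" by (rule order_tendstoD) (use e in simp)
  then obtain M where M: "\<And>m. m \<ge> M \<Longrightarrow> T m < e\<^sup>2" by (auto simp: eventually_sequentially)
  have "cmod (L2_inner (boundary_fun w) (boundary_fun u)) \<le> e"
    if m: "m \<ge> M" and u: "u \<in> Hardy2" "vanishes_to_order m u" "Hardy2_norm u \<le> 1" for m u
  proof (rule tendsto_upperbound)
    show "((\<lambda>r. cmod (L2_inner (\<lambda>\<zeta>. w (r *\<^sub>R \<zeta>)) (\<lambda>\<zeta>. u (r *\<^sub>R \<zeta>)))) \<longlongrightarrow> cmod (L2_inner (boundary_fun w) (boundary_fun u))) (at_left 1)"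
      by (intro tendsto_norm inner_boundary_tendsto w u)
    have le: "cmod (L2_inner (\<lambda>\<zeta>. w (r *\<^sub>R \<zeta>)) (\<lambda>\<zeta>. u (r *\<^sub>R \<zeta>))) \<le> e" if r: "0 < r" "r < 1" for r
    proof -
      let ?B = "coeff_norm2 u"
      let ?x = "\<lambda>k. L2_inner (hcoeff w k) (hcoeff u k)"
      have s1: "(\<lambda>k. of_real (r ^ k) ^ 2 * ?x k) sums L2_inner (\<lambda>\<zeta>. w (r *\<^sub>R \<zeta>)) (\<lambda>\<zeta>. u (r *\<^sub>R \<zeta>))"
        unfolding L2_inner_def by (rule sphere_inner_sums[OF Hardy2D(1)[OF w] Hardy2D(1)[OF u(1)]]) (use r in auto)
      have "(\<lambda>k. if k < m then ?A k else 0) sums (\<Sum>k<m. ?A k)"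
        using sums_If_finite_set[of "{..<m}" ?A] by simp
      from sums_diff[OF Hardy2_coeff_sums[OF w] this]
      have s2: "(\<lambda>k. ?A k - (if k < m then ?A k else 0)) sums T m" by (simp add: T_def)
      have s3: "(\<lambda>k. (?A k - (if k < m then ?A k else 0)) / (2 * e) + ?B k * (e / 2)) sums (T m / (2 * e) + (Hardy2_norm u)\<^sup>2 * (e / 2))"
        by (intro sums_add sums_divide sums_mult2 s2 Hardy2_coeff_sums u)
      have bd: "cmod (of_real (r ^ k) ^ 2 * ?x k) \<le> (?A k - (if k < m then ?A k else 0)) / (2 * e) + ?B k * (e / 2)" for k
      proof (cases "k < m")
        case True
        have "?x k = 0"
          unfolding L2_inner_def
          by (rule integral_eq_zero_AE, rule AE_I2)
             (use hcoeff_eq_0_if_vanishes[OF Hardy2D(1)[OF u(1)] u(2) True] in simp)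
        then show ?thesis using True e coeff_norm2_nonneg[of u k] by simp
      next
        case False
        have "cmod (?x k) \<le> sqrt (?A k * ?B k)"
          by (rule L2_inner_bound[OF hcoeff_sq_integrable[OF Hardy2D(1)[OF w]] hcoeff_sq_integrable[OF Hardy2D(1)[OF u(1)]]])
             (auto simp: sq_norm_def coeff_norm2_def)
        \<comment> \<open>the weight \<open>e\<close> balances the two sums: the first is below \<open>e\<^sup>2\<close>, the second at most \<open>1\<close>\<close>
        also have "\<dots> = sqrt ((?A k / e) * (?B k * e))" using e by simp
        also have "\<dots> \<le> ((?A k / e) + (?B k * e)) / 2"
          by (rule arith_geo_mean_sqrt) (use e coeff_norm2_nonneg[of w k] coeff_norm2_nonneg[of u k] in auto)
        finally have x: "cmod (?x k) \<le> ?A k / (2 * e) + ?B k * (e / 2)" by (simp add: add_divide_distrib)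
        have "(r ^ k)\<^sup>2 \<le> 1" using r by (simp add: power_le_one)
        then have "cmod (of_real (r ^ k) ^ 2 * ?x k) \<le> 1 * cmod (?x k)"
          unfolding norm_mult norm_power norm_of_real power2_abs by (intro mult_right_mono) auto
        then show ?thesis using x False by simp
      qed
      have "cmod (L2_inner (\<lambda>\<zeta>. w (r *\<^sub>R \<zeta>)) (\<lambda>\<zeta>. u (r *\<^sub>R \<zeta>))) \<le> T m / (2 * e) + (Hardy2_norm u)\<^sup>2 * (e / 2)"
        by (rule norm_sums_le[OF s1 s3 bd])
      also have "\<dots> \<le> e\<^sup>2 / (2 * e) + 1 * (e / 2)"
        using M[OF m] e u(3) Hardy2_norm_nonneg[OF u(1)]
        by (intro add_mono divide_right_mono mult_right_mono) (auto simp: power_le_one)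
      also have "\<dots> = e" using e by (simp add: power2_eq_square)
      finally show ?thesis .
    qed
    have "eventually (\<lambda>r. r \<in> {0<..<1}) (at_left (1 :: real))"
      by (rule eventually_at_left_real) simp
    then show "eventually (\<lambda>r. cmod (L2_inner (\<lambda>\<zeta>. w (r *\<^sub>R \<zeta>)) (\<lambda>\<zeta>. u (r *\<^sub>R \<zeta>))) \<le> e) (at_left 1)"
      using le by (auto elim!: eventually_mono)
  qed simp
  then show ?thesis by blast
qed

lemma Hardy2_norm_add_sq:
  fixes g h :: "complex ^ 'n \<Rightarrow> complex"
  assumes g: "g \<in> Hardy2" and h: "h \<in> Hardy2"
  shows "(Hardy2_norm (\<lambda>z. g z + h z))\<^sup>2 = (Hardy2_norm g)\<^sup>2 + 2 * Re (L2_inner (boundary_fun g) (boundary_fun h)) + (Hardy2_norm h)\<^sup>2"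
proof -
  have "sq_norm (boundary_fun (\<lambda>z. g z + h z)) = sq_norm (\<lambda>\<zeta>. boundary_fun g \<zeta> + 1 * boundary_fun h \<zeta>)"
    by (rule sq_norm_cong_AE)
       (use boundary_lincomb[OF g h, of 1 1] in \<open>auto intro!: boundary_fun_measurable Hardy2_add g h borel_measurable_add\<close>)
  then show ?thesis
    unfolding Hardy2_norm_boundary[OF g] Hardy2_norm_boundary[OF h] Hardy2_norm_boundary[OF Hardy2_add[OF g h]]
    by (simp add: sq_norm_add_cmult[OF boundary_sq_integrable[OF g] boundary_sq_integrable[OF h], of 1, simplified])
qed

lemma Hardy2_inner_bound:
  assumes g: "g \<in> Hardy2" and h: "h \<in> Hardy2"
  shows "cmod (L2_inner (boundary_fun g) (boundary_fun h)) \<le> Hardy2_norm g * Hardy2_norm h"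
proof -
  have "cmod (L2_inner (boundary_fun g) (boundary_fun h)) \<le> sqrt ((Hardy2_norm g)\<^sup>2 * (Hardy2_norm h)\<^sup>2)"
    by (rule L2_inner_bound[OF boundary_sq_integrable[OF g] boundary_sq_integrable[OF h]])
       (auto simp: Hardy2_norm_boundary g h)
  then show ?thesis by (simp add: real_sqrt_mult Hardy2_norm_nonneg g h)
qed

lemma Hardy2_norm_triangle:
  assumes g: "g \<in> Hardy2" and h: "h \<in> Hardy2"
  shows "Hardy2_norm (\<lambda>z. g z + h z) \<le> Hardy2_norm g + Hardy2_norm h"
proof (rule power2_le_imp_le)
  show "(Hardy2_norm (\<lambda>z. g z + h z))\<^sup>2 \<le> (Hardy2_norm g + Hardy2_norm h)\<^sup>2"
    unfolding Hardy2_norm_add_sq[OF g h] power2_sum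
    using Hardy2_inner_bound[OF g h] complex_Re_le_cmod[of "L2_inner (boundary_fun g) (boundary_fun h)"] by simp
qed (intro add_nonneg_nonneg Hardy2_norm_nonneg g h)

lemma Hardy2_norm_cmult: "h \<in> Hardy2 \<Longrightarrow> Hardy2_norm (\<lambda>z. a * h z) = cmod a * Hardy2_norm h"
proof -
  assume h: "h \<in> Hardy2"
  have "sq_norm (boundary_fun (\<lambda>z. a * h z)) = sq_norm (\<lambda>\<zeta>. a * boundary_fun h \<zeta>)"
    by (rule sq_norm_cong_AE)
       (use boundary_lincomb[OF h h, of a 0] in \<open>auto intro!: boundary_fun_measurable Hardy2_cmult h borel_measurable_times\<close>)
  then have "(Hardy2_norm (\<lambda>z. a * h z))\<^sup>2 = (cmod a * Hardy2_norm h)\<^sup>2"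
    by (simp add: Hardy2_norm_boundary Hardy2_cmult h sq_norm_cmult power_mult_distrib)
  then show ?thesis
    by (rule power2_eq_imp_eq) (auto simp: Hardy2_norm_nonneg h Hardy2_cmult)
qed

lemma linear_op_Hardy2D:
  assumes "linear_op_Hardy2 T"
  shows "h \<in> Hardy2 \<Longrightarrow> T h \<in> Hardy2"
    "g \<in> Hardy2 \<Longrightarrow> h \<in> Hardy2 \<Longrightarrow> T (\<lambda>z. g z + h z) = (\<lambda>z. T g z + T h z)"
    "h \<in> Hardy2 \<Longrightarrow> T (\<lambda>z. a * h z) = (\<lambda>z. a * T h z)"
proof -
  have lin: "\<And>g h a b. g \<in> Hardy2 \<Longrightarrow> h \<in> Hardy2 \<Longrightarrow> T (\<lambda>z. a * g z + b * h z) = (\<lambda>z. a * T g z + b * T h z)"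
    using assms unfolding linear_op_Hardy2_def by blast
  show "h \<in> Hardy2 \<Longrightarrow> T h \<in> Hardy2" using assms unfolding linear_op_Hardy2_def by blast
  show "g \<in> Hardy2 \<Longrightarrow> h \<in> Hardy2 \<Longrightarrow> T (\<lambda>z. g z + h z) = (\<lambda>z. T g z + T h z)"
    using lin[of g h 1 1] by simp
  show "h \<in> Hardy2 \<Longrightarrow> T (\<lambda>z. a * h z) = (\<lambda>z. a * T h z)"
    using lin[of h h a 0] by simp
qed

text \<open>
  A compact operator is small on functions that vanish to high order.  Otherwise it would send
  unit vectors, of order tending to infinity, close to one vector \<open>g \<noteq> 0\<close>.  As these
  vectors are almost orthogonal, suitable sums of \<open>p\<close> of them have norm of order \<open>sqrt p\<close>, and images
  of norm of order \<open>p\<close>, although a compact operator is bounded.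
\<close>

lemma compact_op_small_on_vanishing:
  fixes K :: "(complex ^ 'n \<Rightarrow> complex) \<Rightarrow> complex ^ 'n \<Rightarrow> complex"
  assumes K: "compact_op_Hardy2 K" and e: "e > 0"
  shows "\<exists>M. \<forall>u\<in>Hardy2. vanishes_to_order M u \<longrightarrow> Hardy2_norm (K u) \<le> e * Hardy2_norm u"
proof (rule ccontr)
  assume contra: "\<not> ?thesis"
  have lin: "linear_op_Hardy2 K" using K by (simp add: compact_op_Hardy2_def)
  have comp: "\<exists>g\<in>Hardy2. \<exists>s. strict_mono s \<and> (\<lambda>m. Hardy2_norm (\<lambda>z. K (u (s m)) z - g z)) \<longlonglongrightarrow> 0"
    if "\<And>m. u m \<in> Hardy2" "\<And>m. Hardy2_norm (u m) \<le> B" for u :: "nat \<Rightarrow> complex ^ 'n \<Rightarrow> complex" and B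
  proof -
    have "(\<forall>m. u m \<in> Hardy2) \<and> bdd_above (range (\<lambda>m. Hardy2_norm (u m)))"
      using that by (auto intro!: bdd_aboveI2[where M = B])
    then show ?thesis using K unfolding compact_op_Hardy2_def by blast
  qed
  note KD = linear_op_Hardy2D[OF lin]
  have "\<exists>v\<in>Hardy2. vanishes_to_order M v \<and> Hardy2_norm v = 1 \<and> e < Hardy2_norm (K v)" for M
  proof -
    obtain u where u: "u \<in> Hardy2" "vanishes_to_order M u" "e * Hardy2_norm u < Hardy2_norm (K u)"
      using contra by (auto simp: not_le)
    have n0: "Hardy2_norm u \<noteq> 0"
    proof
      assume 0: "Hardy2_norm u = 0"
      then have "u = (\<lambda>z. 0 * u z)" using Hardy2_eq_zero[OF u(1)] by simp
      then have "K u = (\<lambda>z. 0 * K u z)" using KD(3)[OF u(1), of 0] by simp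
      then have "Hardy2_norm (K u) = 0" using Hardy2_norm_cmult[OF KD(1)[OF u(1)], of 0] by simp
      with u(3) 0 show False by simp
    qed
    then have pos: "Hardy2_norm u > 0" using Hardy2_norm_nonneg[OF u(1)] by simp
    define c where "c = complex_of_real (1 / Hardy2_norm u)"
    have c: "cmod c = 1 / Hardy2_norm u" unfolding c_def norm_of_real using pos by simp
    have "Hardy2_norm (\<lambda>z. c * u z) = 1" using pos by (simp add: Hardy2_norm_cmult[OF u(1)] c)
    moreover have "Hardy2_norm (K (\<lambda>z. c * u z)) = Hardy2_norm (K u) / Hardy2_norm u"
      by (simp add: KD(3)[OF u(1)] Hardy2_norm_cmult[OF KD(1)[OF u(1)]] c)
    moreover have "e < Hardy2_norm (K u) / Hardy2_norm u" using u(3) pos by (simp add: pos_less_divide_eq)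
    ultimately show ?thesis
      using Hardy2_cmult[OF u(1)] vanishes_to_order_cmult[OF u(2)] by (intro bexI[of _ "\<lambda>z. c * u z"]) auto
  qed
  then obtain v where v: "\<And>m. v m \<in> Hardy2" "\<And>m. vanishes_to_order m (v m)" "\<And>m. Hardy2_norm (v m) = 1" "\<And>m. e < Hardy2_norm (K (v m))"
    by metis
  obtain g s where g: "g \<in> Hardy2" and s: "strict_mono s" and lim: "(\<lambda>m. Hardy2_norm (\<lambda>z. K (v (s m)) z - g z)) \<longlonglongrightarrow> 0"
    using comp[of v 1] v by auto
  have tri: "Hardy2_norm a \<le> Hardy2_norm (\<lambda>z. a z - b z) + Hardy2_norm b" if "a \<in> Hardy2" "b \<in> Hardy2" for a b :: "complex ^ 'n \<Rightarrow> complex"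
    using Hardy2_norm_triangle[OF Hardy2_diff[OF that] that(2)] by simp
  have ge: "e \<le> Hardy2_norm g"
  proof (rule LIMSEQ_le_const[of "\<lambda>m. Hardy2_norm (\<lambda>z. K (v (s m)) z - g z) + Hardy2_norm g"])
    show "(\<lambda>m. Hardy2_norm (\<lambda>z. K (v (s m)) z - g z) + Hardy2_norm g) \<longlonglongrightarrow> Hardy2_norm g"
      using tendsto_add[OF lim tendsto_const, of "Hardy2_norm g"] by simp
    show "\<exists>N. \<forall>n\<ge>N. e \<le> Hardy2_norm (\<lambda>z. K (v (s n)) z - g z) + Hardy2_norm g"
      using tri[OF KD(1)[OF v(1)] g] v(4) by (meson less_imp_le order_trans)
  qed
  \<comment> \<open>each new summand is chosen so far out in the sequence that it is almost orthogonal to the sum of the previous ones\<close>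
  have "\<exists>w\<in>Hardy2. (Hardy2_norm w)\<^sup>2 \<le> 2 * real p \<and> Hardy2_norm (\<lambda>z. K w z - of_nat p * g z) \<le> real p * (e / 2)" for p
  proof (induction p)
    case 0
    have K0: "K (\<lambda>_. 0) = (\<lambda>_. 0)" using KD(3)[OF Hardy2_zero, of 0] by simp
    have "Hardy2_norm (\<lambda>_ :: complex ^ 'n. 0) = 0" using Hardy2_norm_cmult[OF Hardy2_zero, of 0] by simp
    then show ?case by (intro bexI[of _ "\<lambda>_. 0"]) (auto simp: K0 Hardy2_zero)
  next
    case (Suc p)
    then obtain w where w: "w \<in> Hardy2" "(Hardy2_norm w)\<^sup>2 \<le> 2 * real p" "Hardy2_norm (\<lambda>z. K w z - of_nat p * g z) \<le> real p * (e / 2)" by blast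
    obtain M where M: "\<And>m u. m \<ge> M \<Longrightarrow> u \<in> Hardy2 \<Longrightarrow> vanishes_to_order m u \<Longrightarrow> Hardy2_norm u \<le> 1 \<Longrightarrow> cmod (L2_inner (boundary_fun w) (boundary_fun u)) \<le> 1 / 2"
      using weakly_null_if_vanishing[OF w(1), of "1 / 2"] by auto
    have "eventually (\<lambda>m. Hardy2_norm (\<lambda>z. K (v (s m)) z - g z) < e / 2) sequentially"
      by (rule order_tendstoD[OF lim]) (use e in simp)
    moreover have "eventually (\<lambda>m. m \<ge> M) sequentially" by (rule eventually_ge_at_top)
    ultimately have "eventually (\<lambda>m. Hardy2_norm (\<lambda>z. K (v (s m)) z - g z) < e / 2 \<and> m \<ge> M) sequentially" by (rule eventually_conj)
    then obtain m where m: "Hardy2_norm (\<lambda>z. K (v (s m)) z - g z) < e / 2" "m \<ge> M" using eventually_happens by fastforce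
    let ?v = "v (s m)"
    have sm: "s m \<ge> M" using m(2) seq_suble[OF s, of m] by linarith
    have in1: "(\<lambda>z. K w z - of_nat p * g z) \<in> Hardy2" and in2: "(\<lambda>z. K ?v z - g z) \<in> Hardy2"
      by (intro Hardy2_diff Hardy2_cmult KD(1) g w v)+
    have "Re (L2_inner (boundary_fun w) (boundary_fun ?v)) \<le> 1 / 2"
      using M[OF sm v(1) v(2)] v(3) complex_Re_le_cmod[of "L2_inner (boundary_fun w) (boundary_fun ?v)"] by (simp add: order_trans)
    then have "(Hardy2_norm (\<lambda>z. w z + ?v z))\<^sup>2 \<le> 2 * real (Suc p)"
      unfolding Hardy2_norm_add_sq[OF w(1) v(1)] using w(2) v(3) by simp
    moreover have "(\<lambda>z. K (\<lambda>z. w z + ?v z) z - of_nat (Suc p) * g z) = (\<lambda>z. (K w z - of_nat p * g z) + (K ?v z - g z))"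
      by (simp add: KD(2)[OF w(1) v(1)] algebra_simps)
    then have "Hardy2_norm (\<lambda>z. K (\<lambda>z. w z + ?v z) z - of_nat (Suc p) * g z) \<le> real (Suc p) * (e / 2)"
      using Hardy2_norm_triangle[OF in1 in2] w(3) m(1) by (simp add: algebra_simps)
    ultimately show ?case using Hardy2_add[OF w(1) v(1)] by blast
  qed
  then obtain w where w: "\<And>p. w p \<in> Hardy2" "\<And>p. (Hardy2_norm (w p))\<^sup>2 \<le> 2 * real p" "\<And>p. Hardy2_norm (\<lambda>z. K (w p) z - of_nat p * g z) \<le> real p * (e / 2)"
    by metis
  have Kw: "real p * (e / 2) \<le> Hardy2_norm (K (w p))" for p
  proof -
    have pg: "(\<lambda>z. of_nat p * g z) \<in> Hardy2" by (intro Hardy2_cmult g)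
    have "real p * e \<le> real p * Hardy2_norm g" using ge by (intro mult_left_mono) auto
    also have "\<dots> = Hardy2_norm (\<lambda>z. of_nat p * g z)" by (simp add: Hardy2_norm_cmult[OF g])
    also have "\<dots> \<le> Hardy2_norm (\<lambda>z. of_nat p * g z - K (w p) z) + Hardy2_norm (K (w p))" by (rule tri[OF pg KD(1)[OF w(1)]])
    also have "Hardy2_norm (\<lambda>z. of_nat p * g z - K (w p) z) = Hardy2_norm (\<lambda>z. K (w p) z - of_nat p * g z)"
      using Hardy2_norm_cmult[OF Hardy2_diff[OF KD(1)[OF w(1)] pg], of "- 1" p] by simp
    finally show ?thesis using w(3)[of p] by (simp add: field_simps)
  qed
  define y where "y p z = of_real (1 / sqrt (real (Suc p))) * w (Suc p) z" for p z
  have y: "y p \<in> Hardy2" for p unfolding y_def[abs_def] by (rule Hardy2_cmult[OF w(1)])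
  have sq: "(sqrt (real (Suc p)))\<^sup>2 = real (Suc p)" "sqrt (real (Suc p)) > 0" for p by auto
  have yn: "Hardy2_norm (y p) \<le> 2" for p
  proof -
    have "Hardy2_norm (y p) = Hardy2_norm (w (Suc p)) / sqrt (real (Suc p))"
      unfolding y_def[abs_def] Hardy2_norm_cmult[OF w(1)] norm_of_real by simp
    also have "\<dots> \<le> 2"
    proof -
      have "(Hardy2_norm (w (Suc p)))\<^sup>2 \<le> (2 * sqrt (real (Suc p)))\<^sup>2"
        unfolding power_mult_distrib sq using w(2)[of "Suc p"] by simp
      then have "Hardy2_norm (w (Suc p)) \<le> 2 * sqrt (real (Suc p))" by (rule power2_le_imp_le) simp
      then show ?thesis using sq(2)[of p] by (simp add: pos_divide_le_eq)
    qed
    finally show ?thesis .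
  qed
  have Ky: "sqrt (real (Suc p)) * (e / 2) \<le> Hardy2_norm (K (y p))" for p
  proof -
    have "Hardy2_norm (K (y p)) = Hardy2_norm (K (w (Suc p))) / sqrt (real (Suc p))"
      unfolding y_def[abs_def] KD(3)[OF w(1)] Hardy2_norm_cmult[OF KD(1)[OF w(1)]] norm_of_real by simp
    moreover have "sqrt (real (Suc p)) * (e / 2) * sqrt (real (Suc p)) \<le> Hardy2_norm (K (w (Suc p)))"
    proof -
      have eq: "sqrt (real (Suc p)) * (e / 2) * sqrt (real (Suc p)) = (sqrt (real (Suc p)))\<^sup>2 * (e / 2)"
        unfolding power2_eq_square by (simp only: mult_ac)
      show ?thesis unfolding eq sq(1) by (rule Kw)
    qed
    ultimately show ?thesis using sq(2)[of p] by (simp add: pos_le_divide_eq)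
  qed
  obtain b t where b: "b \<in> Hardy2" and t: "strict_mono t" and limb: "(\<lambda>m. Hardy2_norm (\<lambda>z. K (y (t m)) z - b z)) \<longlonglongrightarrow> 0"
    using comp[of y 2] y yn by auto
  have "eventually (\<lambda>m. Hardy2_norm (\<lambda>z. K (y (t m)) z - b z) < 1) sequentially" by (rule order_tendstoD[OF limb]) simp
  then have "eventually (\<lambda>m. sqrt (real (Suc m)) * (e / 2) < 1 + Hardy2_norm b) sequentially"
  proof eventually_elim
    case (elim m)
    have "sqrt (real (Suc m)) * (e / 2) \<le> sqrt (real (Suc (t m))) * (e / 2)"
      using seq_suble[OF t, of m] e by (intro mult_right_mono) auto
    also have "\<dots> \<le> Hardy2_norm (K (y (t m)))" by (rule Ky)
    also have "\<dots> \<le> Hardy2_norm (\<lambda>z. K (y (t m)) z - b z) + Hardy2_norm b" by (rule tri[OF KD(1)[OF y] b])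
    finally show ?case using elim by simp
  qed
  moreover have "eventually (\<lambda>m. 1 + Hardy2_norm b < sqrt (real (Suc m)) * (e / 2)) sequentially"
  proof -
    have "filterlim (\<lambda>m. sqrt (real (Suc m)) * (e / 2)) at_top sequentially"
      by (rule filterlim_at_top_mult_tendsto_pos[OF tendsto_const _
            filterlim_compose[OF sqrt_at_top filterlim_compose[OF filterlim_real_sequentially filterlim_Suc]]])
         (use e in simp)
    then show ?thesis unfolding filterlim_at_top_dense by blast
  qed
  ultimately have "eventually (\<lambda>m :: nat. False) sequentially" by eventually_elim simp
  then show False by simp
qed

section \<open>Uniqueness for bounded functions on the disc\<close>

text \<open>
  A zero can be factored out near \<open>a\<close>; the quotient is holomorphic on all of \<open>S\<close>, because its
  singularity at \<open>a\<close> is removable.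
\<close>

lemma holomorphic_factor_zero_global:
  assumes f: "f holomorphic_on S" "open S" "connected S" and a: "a \<in> S" "f a = 0" and nc: "\<not> f constant_on S"
  shows "\<exists>n G. 0 < n \<and> G holomorphic_on S \<and> G a \<noteq> 0 \<and> (\<forall>z\<in>S. f z = (z - a) ^ n * G z)"
proof -
  have "\<exists>g r n. 0 < n \<and> 0 < r \<and> ball a r \<subseteq> S \<and> g holomorphic_on ball a r \<and>
    (\<forall>w\<in>ball a r. f w = (w - a) ^ n * g w) \<and> (\<forall>w\<in>ball a r. g w \<noteq> 0)"
    by (rule holomorphic_factor_zero_nonconstant[OF f a nc]) metis
  then obtain g r n where g: "0 < n" "0 < r" "ball a r \<subseteq> S" "g holomorphic_on ball a r"
    "\<And>w. w \<in> ball a r \<Longrightarrow> f w = (w - a) ^ n * g w" "\<And>w. w \<in> ball a r \<Longrightarrow> g w \<noteq> 0"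
    by auto
  define G where "G z = (if z = a then g a else f z / (z - a) ^ n)" for z
  have Gg: "G z = g z" if "z \<in> ball a r" for z using g(5)[OF that] by (auto simp: G_def)
  have "(g \<longlongrightarrow> g a) (at a)"
    using holomorphic_on_imp_continuous_on[OF g(4)] g(2) by (simp add: continuous_on_eq_continuous_at isCont_def)
  moreover have "eventually (\<lambda>z. z \<in> ball a r) (at a)" using g(2) by (intro eventually_at_in_open') auto
  then have "eventually (\<lambda>z. g z = G z) (at a)" by eventually_elim (simp add: Gg)
  ultimately have "(G \<longlongrightarrow> g a) (at a)" using Lim_transform_eventually by blast
  then have lim: "(G \<longlongrightarrow> G z) (at z within S)" if "z \<in> {a}" for z
    using that by (auto simp: G_def intro: tendsto_within_subset)
  have "(\<lambda>z. f z / (z - a) ^ n) holomorphic_on S - {a}"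
    by (intro holomorphic_intros holomorphic_on_subset[OF f(1)]) auto
  then have "G holomorphic_on S - {a}" by (rule holomorphic_transform) (auto simp: G_def)
  then have "G holomorphic_on S" by (intro no_isolated_singularity'[OF lim _ f(2)]) auto
  moreover have "f z = (z - a) ^ n * G z" if "z \<in> S" for z
    using a g(1) by (auto simp: G_def)
  moreover have "G a \<noteq> 0" using g(2) g(6)[of a] by (simp add: G_def)
  ultimately show ?thesis using g(1) by blast
qed

lemma mean_value_circle:
  assumes F: "F holomorphic_on ball 0 R" "R > 1"
  shows "((\<lambda>s. F (cis s)) has_integral 2 * of_real pi * F 0) {0..2 * pi}"
  using poisson_formula[OF F, of 0] by (simp add: poisson_def)

text \<open>
  A function without zeros in the disc has a holomorphic \<open>n\<close>-th root there, and the inequality is the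
  mean value property of the root.  As \<open>f\<close> may vanish on the circle itself, it is obtained on smaller
  circles first.
\<close>

lemma root_mean_zero_free:
  assumes f: "f holomorphic_on ball 0 R" "R > 1" and nz: "\<And>z. z \<in> ball 0 1 \<Longrightarrow> f z \<noteq> 0" and n: "n > 0"
  shows "2 * pi * root n (cmod (f 0)) \<le> integral {0..2 * pi} (\<lambda>s. root n (cmod (f (cis s))))"
proof -
  have f1: "f holomorphic_on ball 0 1" by (rule holomorphic_on_subset[OF f(1)]) (use f(2) in auto)
  obtain g where g: "g holomorphic_on ball 0 1" "\<And>x. x \<in> ball 0 1 \<Longrightarrow> exp (g x) = f x"
    by (rule holomorphic_logarithm_exists[OF convex_ball open_ball f1 nz, of 0]) auto
  define w where "w z = exp (g z / of_nat n)" for z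
  have w: "w holomorphic_on ball 0 1" unfolding w_def[abs_def] by (intro holomorphic_intros g) (use n in auto)
  have wr: "cmod (w z) = root n (cmod (f z))" if "z \<in> ball 0 1" for z
  proof -
    have "w z ^ n = f z" using g(2)[OF that] n by (simp add: w_def flip: exp_of_nat_mult)
    then have "root n (cmod (f z)) = root n (cmod (w z) ^ n)" by (simp add: norm_power[symmetric])
    then show ?thesis using n by (simp add: real_root_power_cancel)
  qed
  define I where "I t = integral {0..2 * pi} (\<lambda>s. root n (cmod (f (of_real t * cis s))))" for t :: real
  have le: "2 * pi * root n (cmod (f 0)) \<le> I t" if t: "0 < t" "t < 1" for t
  proof -
    have sub: "of_real t * z \<in> ball 0 1" if "z \<in> ball 0 (1 / t)" for z :: complex
      using that t by (simp add: norm_mult field_simps)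
    have hol: "(\<lambda>z. w (of_real t * z)) holomorphic_on ball 0 (1 / t)"
      by (rule holomorphic_on_compose_gen[OF _ w, unfolded o_def]) (use sub in \<open>auto intro!: holomorphic_intros\<close>)
    have "((\<lambda>s. w (of_real t * cis s)) has_integral 2 * of_real pi * w (of_real t * 0)) {0..2 * pi}"
      by (rule mean_value_circle[OF hol]) (use t in auto)
    then have mv: "((\<lambda>s. w (of_real t * cis s)) has_integral 2 * of_real pi * w 0) {0..2 * pi}" by simp
    have cont: "continuous_on {0..2 * pi} (\<lambda>s. root n (cmod (f (of_real t * cis s))))"
      by (intro continuous_intros continuous_on_compose2[OF holomorphic_on_imp_continuous_on[OF f1]])
         (use t in \<open>auto simp: norm_mult\<close>)
    have "2 * pi * root n (cmod (f 0)) = cmod (2 * of_real pi * w 0)" by (simp add: norm_mult wr)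
    also have "\<dots> = cmod (integral {0..2 * pi} (\<lambda>s. w (of_real t * cis s)))" using integral_unique[OF mv] by simp
    also have "\<dots> \<le> I t"
      unfolding I_def
      by (rule Henstock_Kurzweil_Integration.integral_norm_bound_integral)
         (rule has_integral_integrable[OF mv], rule integrable_continuous_real[OF cont], use t in \<open>simp add: wr norm_mult\<close>)
    finally show ?thesis .
  qed
  have "continuous_on {0..1} I"
  proof -
    have "continuous_on ({0..1} \<times> cbox 0 (2 * pi)) (\<lambda>(t, s). root n (cmod (f (of_real t * cis s))))"
      unfolding split_beta
      by (intro continuous_intros continuous_on_compose2[OF holomorphic_on_imp_continuous_on[OF f(1)]])
         (use f(2) in \<open>auto simp: norm_mult intro: le_less_trans\<close>)
    from integral_continuous_on_param[OF this] show ?thesis unfolding I_def by simp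
  qed
  then have "(\<lambda>i. I (radius_seq i)) \<longlonglongrightarrow> I 1"
    by (rule continuous_on_tendsto_compose[OF _ radius_seq(3)])
       (use radius_seq(1,2) in \<open>auto intro!: always_eventually less_imp_le\<close>)
  then have "2 * pi * root n (cmod (f 0)) \<le> I 1"
    by (rule LIMSEQ_le_const) (use le radius_seq(1,2) in blast)
  then show ?thesis by (simp add: I_def)
qed

text \<open>
  Subharmonicity of \<open>|f|\<^bsup>1/n\<^esup>\<close>.  A zero \<open>a\<close> of order \<open>k\<close> inside the circle is removed by
  replacing the factor \<open>(z - a)\<^sup>k\<close> with \<open>(1 - cnj a z)\<^sup>k\<close>, which has the same absolute
  value on the circle and a larger one at \<open>0\<close>.
\<close>

lemma root_mean_inequality:
  assumes "f holomorphic_on ball 0 R" "R > 1" and "f 0 \<noteq> 0" and n: "n > 0"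
  shows "2 * pi * root n (cmod (f 0)) \<le> integral {0..2 * pi} (\<lambda>s. root n (cmod (f (cis s))))"
  using assms(1,3)
proof (induction "card {z \<in> ball 0 1. f z = 0}" arbitrary: f rule: less_induct)
  case less
  show ?case
  proof (cases "{z \<in> ball 0 1. f z = 0} = {}")
    case True
    then show ?thesis by (intro root_mean_zero_free[OF less.prems(1) assms(2) _ n]) auto
  next
    case False
    then obtain a where a: "cmod a < 1" "f a = 0" by auto
    have aR: "a \<in> ball 0 R" "0 \<in> ball 0 R" using a(1) assms(2) by auto
    have nc: "\<not> f constant_on ball 0 R" using aR a(2) less.prems(2) unfolding constant_on_def by metis
    have "finite {z \<in> cball 0 1. f z = 0}"
      by (rule holomorphic_compact_finite_zeros[OF less.prems(1) open_ball connected_ball compact_cball _ nc]) (use assms(2) in auto)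
    then have fin: "finite {z \<in> ball 0 1. f z = 0}" by (rule rev_finite_subset) auto
    obtain k G where G: "0 < k" "G holomorphic_on ball 0 R" "G a \<noteq> 0" "\<And>z. z \<in> ball 0 R \<Longrightarrow> f z = (z - a) ^ k * G z"
      using holomorphic_factor_zero_global[OF less.prems(1) open_ball connected_ball aR(1) a(2) nc] by blast
    define F where "F z = (1 - cnj a * z) ^ k * G z" for z
    have F: "F holomorphic_on ball 0 R" unfolding F_def[abs_def] by (intro holomorphic_intros G)
    have G0: "G 0 \<noteq> 0" using G(4)[OF aR(2)] less.prems(2) by auto
    have bl: "1 - cnj a * z \<noteq> 0" if "cmod z < 1" for z
    proof
      assume "1 - cnj a * z = 0"
      then have "cmod (cnj a * z) = 1" by (metis norm_one right_minus_eq)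
      moreover have "cmod a * cmod z < 1 * 1" using that a(1) by (intro mult_strict_mono) auto
      ultimately show False by (simp add: norm_mult)
    qed
    have "{z \<in> ball 0 1. F z = 0} \<subset> {z \<in> ball 0 1. f z = 0}"
    proof
      show "{z \<in> ball 0 1. F z = 0} \<subseteq> {z \<in> ball 0 1. f z = 0}"
        using bl G(4) assms(2) by (auto simp: F_def)
      show "{z \<in> ball 0 1. F z = 0} \<noteq> {z \<in> ball 0 1. f z = 0}"
        using a bl[OF a(1)] G(3) by (auto simp: F_def set_eq_iff intro!: exI[of _ a])
    qed
    then have "card {z \<in> ball 0 1. F z = 0} < card {z \<in> ball 0 1. f z = 0}" by (rule psubset_card_mono[OF fin])
    then have IH: "2 * pi * root n (cmod (F 0)) \<le> integral {0..2 * pi} (\<lambda>s. root n (cmod (F (cis s))))"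
      by (rule less.hyps) (use F G0 in \<open>simp_all add: F_def[of 0]\<close>)
    have "cmod (f 0) \<le> cmod (F 0)"
      using G(4)[OF aR(2)] a(1) by (simp add: F_def norm_mult norm_power mult_left_le_one_le power_le_one)
    then have "2 * pi * root n (cmod (f 0)) \<le> 2 * pi * root n (cmod (F 0))"
      using n by (intro mult_left_mono) auto
    also note IH
    also have "(\<lambda>s. root n (cmod (F (cis s)))) = (\<lambda>s. root n (cmod (f (cis s))))"
    proof
      fix s
      have "1 - cnj a * cis s = cis s * cnj (cis s - a)"
        by (simp add: algebra_simps cis_cnj cis_mult)
      then have "cmod (1 - cnj a * cis s) = cmod (cis s - a)" by (simp only: norm_mult complex_mod_cnj norm_cis)
      moreover have "cis s \<in> ball 0 R" using assms(2) by simp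
      ultimately show "root n (cmod (F (cis s))) = root n (cmod (f (cis s)))"
        using G(4) by (simp add: F_def norm_mult norm_power)
    qed
    finally show ?thesis .
  qed
qed

lemma radius_seq_ge_half: "1 / 2 \<le> radius_seq i"
  by (simp add: radius_seq_def field_simps)

text \<open>
  The uniqueness theorem of F. and M. Riesz for bounded functions: if the radial limits vanish on
  a set of measure \<open>\<theta>\<close> and \<open>w\<close> is the function divided by a power of \<open>z\<close> so that
  \<open>w 0 \<noteq> 0\<close>, then \<open>2 pi |w 0|\<^bsup>1/n\<^esup> \<le> (2 pi - \<theta>) B\<^bsup>1/n\<^esup>\<close>, and \<open>n \<longrightarrow> \<infinity>\<close> gives \<open>\<theta> = 0\<close>.
\<close>

lemma bounded_radial_uniqueness:
  assumes v: "v holomorphic_on ball 0 1" and B: "\<And>z. z \<in> ball 0 1 \<Longrightarrow> cmod (v z) \<le> B"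
    and T[measurable]: "T \<in> sets borel" and T_sub: "T \<subseteq> {0..2 * pi}" and T_pos: "emeasure lborel T \<noteq> 0"
    and rad: "\<And>s. s \<in> T \<Longrightarrow> ((\<lambda>r. v (of_real r * cis s)) \<longlongrightarrow> 0) (at_left 1)"
    and z: "z \<in> ball 0 1"
  shows "v z = 0"
proof (rule ccontr)
  assume vz: "v z \<noteq> 0"
  obtain m w where w: "w holomorphic_on ball 0 1" "w 0 \<noteq> 0" "\<And>z. z \<in> ball 0 1 \<Longrightarrow> v z = z ^ m * w z"
  proof (cases "v 0 = 0")
    case False
    then show ?thesis using v that[of v 0] by auto
  next
    case True
    then have nc: "\<not> v constant_on ball 0 1" using vz z unfolding constant_on_def by (metis centre_in_ball zero_less_one)
    obtain n G where "0 < n" "G holomorphic_on ball 0 1" "G 0 \<noteq> 0" "\<And>z. z \<in> ball 0 1 \<Longrightarrow> v z = (z - 0) ^ n * G z"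
      using holomorphic_factor_zero_global[OF v open_ball connected_ball _ True nc] by auto
    then show ?thesis by (intro that[of G n]) auto
  qed
  \<comment> \<open>division by \<open>z ^ m\<close> costs a factor of at most \<open>2 ^ m\<close> where \<open>|z| \<ge> 1 / 2\<close>\<close>
  define C where "C = 2 ^ m * (\<bar>B\<bar> + 1)"
  have C: "C > 0" by (simp add: C_def)
  have wv: "cmod (w (of_real r * cis s)) \<le> 2 ^ m * cmod (v (of_real r * cis s))" if r: "1 / 2 \<le> r" "r < 1" for r s
  proof -
    have "cmod (v (of_real r * cis s)) = r ^ m * cmod (w (of_real r * cis s))"
      using w(3)[of "of_real r * cis s"] r by (simp add: norm_mult norm_power)
    then have "2 ^ m * cmod (v (of_real r * cis s)) = (2 * r) ^ m * cmod (w (of_real r * cis s))"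
      by (simp add: power_mult_distrib)
    moreover have "1 * cmod (w (of_real r * cis s)) \<le> (2 * r) ^ m * cmod (w (of_real r * cis s))"
      using r by (intro mult_right_mono one_le_power) auto
    ultimately show ?thesis by simp
  qed
  have wC: "cmod (w (of_real r * cis s)) \<le> C" if r: "1 / 2 \<le> r" "r < 1" for r s
  proof -
    have "cmod (v (of_real r * cis s)) \<le> \<bar>B\<bar> + 1" using B[of "of_real r * cis s"] r by (simp add: norm_mult)
    then have "2 ^ m * cmod (v (of_real r * cis s)) \<le> C" unfolding C_def by (intro mult_left_mono) auto
    with wv[OF r, of s] show ?thesis by linarith
  qed
  have Tfin: "emeasure lborel T \<noteq> \<infinity>"
    using emeasure_mono[OF T_sub, of lborel] by (auto simp: top_unique)
  define \<theta> where "\<theta> = measure lborel T"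
  have \<theta>: "\<theta> > 0" using T_pos Tfin by (simp add: \<theta>_def measure_def zero_less_iff_neq_zero enn2real_positive_iff less_top)
  have "2 * pi * root n (cmod (w 0)) \<le> (2 * pi - \<theta>) * root n C" if n: "n > 0" for n
  proof -
    define F where "F i s = root n (cmod (w (of_real (radius_seq i) * cis s)))" for i s
    have F_cont: "continuous_on A (F i)" for A i
      unfolding F_def[abs_def]
      by (intro continuous_intros continuous_on_compose2[OF holomorphic_on_imp_continuous_on[OF w(1)]])
         (use radius_seq(1,2)[of i] in \<open>auto simp: norm_mult\<close>)
    have Fm[measurable]: "F i \<in> borel_measurable borel" for i by (intro borel_measurable_continuous_onI F_cont)
    have F0: "0 \<le> F i s" for i s using n by (simp add: F_def)
    have FC: "F i s \<le> root n C" for i s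
      unfolding F_def using n wC[OF radius_seq_ge_half radius_seq(2)] by simp
    have iT: "integrable lborel (indicator T :: real \<Rightarrow> real)"
      using Tfin by (intro integrable_real_indicator) (auto simp: less_top)
    have iTF: "integrable lborel (\<lambda>s. indicator T s * F i s)" for i
    proof (rule Bochner_Integration.integrable_bound[OF integrable_mult_right[OF iT, of "root n C"]])
      show "AE s in lborel. norm (indicator T s * F i s) \<le> norm (root n C * indicator T s)"
      proof (rule AE_I2)
        fix s
        have "\<bar>F i s\<bar> \<le> \<bar>root n C\<bar>" using F0[of i s] FC[of i s] by linarith
        then show "norm (indicator T s * F i s) \<le> norm (root n C * indicator T s)" by (simp add: indicator_def)
      qed
    qed measurable
    have le: "2 * pi * root n (cmod (w 0)) \<le> (2 * pi - \<theta>) * root n C + (\<integral>s. indicator T s * F i s \<partial>lborel)" for i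
    proof -
      let ?r = "radius_seq i"
      have sub: "of_real ?r * z \<in> ball 0 1" if "z \<in> ball 0 (1 / ?r)" for z :: complex
        using that radius_seq(1,2)[of i] by (simp add: norm_mult field_simps)
      have hol: "(\<lambda>z. w (of_real ?r * z)) holomorphic_on ball 0 (1 / ?r)"
        by (rule holomorphic_on_compose_gen[OF _ w(1), unfolded o_def]) (use sub in \<open>auto intro!: holomorphic_intros\<close>)
      have "2 * pi * root n (cmod (w (of_real ?r * 0))) \<le> integral {0..2 * pi} (\<lambda>s. root n (cmod (w (of_real ?r * cis s))))"
        by (rule root_mean_inequality[OF hol _ _ n]) (use w(2) radius_seq(1,2)[of i] in auto)
      then have "2 * pi * root n (cmod (w 0)) \<le> integral {0..2 * pi} (F i)" by (simp add: F_def[abs_def])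
      also have "integral {0..2 * pi} (F i) = (\<integral>s. indicator {0..2 * pi} s *\<^sub>R F i s \<partial>lborel)"
        using set_borel_integral_eq_integral(2)[OF borel_integrable_atLeastAtMost'[OF F_cont], of 0 "2 * pi" i]
        unfolding set_lebesgue_integral_def by simp
      also have "\<dots> \<le> (\<integral>s. root n C * indicator ({0..2 * pi} - T) s + indicator T s * F i s \<partial>lborel)"
      proof (rule integral_mono)
        show "integrable lborel (\<lambda>s. indicator {0..2 * pi} s *\<^sub>R F i s)"
          using borel_integrable_atLeastAtMost'[OF F_cont, of 0 "2 * pi" i] by (simp add: set_integrable_def)
        show "integrable lborel (\<lambda>s. root n C * indicator ({0..2 * pi} - T) s + indicator T s * F i s)"
        proof (intro Bochner_Integration.integrable_add integrable_mult_right)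
          show "integrable lborel (indicator ({0..2 * pi} - T) :: real \<Rightarrow> real)"
            by (rule integrable_real_indicator) (auto intro: le_less_trans[OF emeasure_mono[of _ "{0..2 * pi}"]])
          show "integrable lborel (\<lambda>s. indicator T s * F i s)" by (rule iTF)
        qed
        show "indicator {0..2 * pi} s *\<^sub>R F i s \<le> root n C * indicator ({0..2 * pi} - T) s + indicator T s * F i s" for s
          using T_sub FC[of i s] by (auto simp: indicator_def)
      qed
      also have "\<dots> = root n C * measure lborel ({0..2 * pi} - T) + (\<integral>s. indicator T s * F i s \<partial>lborel)"
      proof (subst Bochner_Integration.integral_add)
        show "integrable lborel (\<lambda>s. root n C * indicator ({0..2 * pi} - T) s)"
          by (intro integrable_mult_right integrable_real_indicator) (auto intro: le_less_trans[OF emeasure_mono[of _ "{0..2 * pi}"]])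
        show "integrable lborel (\<lambda>s. indicator T s * F i s)" by (rule iTF)
      qed simp
      also have "measure lborel ({0..2 * pi} - T) = 2 * pi - \<theta>"
        unfolding \<theta>_def using measure_Diff[of lborel "{0..2 * pi}" T] T_sub by simp
      finally show ?thesis by (simp add: mult.commute)
    qed
    have "(\<lambda>i. \<integral>s. indicator T s * F i s \<partial>lborel) \<longlonglongrightarrow> (\<integral>s. 0 \<partial>(lborel :: real measure))"
    proof (rule integral_dominated_convergence[where w = "\<lambda>s. root n C * indicator T s"])
      show "integrable lborel (\<lambda>s. root n C * indicator T s)"
        by (rule integrable_mult_right[OF iT])
      show "AE s in lborel. (\<lambda>i. indicator T s * F i s) \<longlonglongrightarrow> 0"
      proof (rule AE_I2)
        fix s
        show "(\<lambda>i. indicator T s * F i s) \<longlonglongrightarrow> 0"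
        proof (cases "s \<in> T")
          case True
          have "(\<lambda>i. v (of_real (radius_seq i) * cis s)) \<longlonglongrightarrow> 0"
            by (rule filterlim_compose[OF rad[OF True] radius_seq_at_left])
          then have "(\<lambda>i. 2 ^ m * cmod (v (of_real (radius_seq i) * cis s))) \<longlonglongrightarrow> 0"
            by (intro tendsto_mult_right_zero tendsto_norm_zero)
          then have "(\<lambda>i. cmod (w (of_real (radius_seq i) * cis s))) \<longlonglongrightarrow> 0"
            by (rule tendsto_sandwich[OF _ _ tendsto_const, rotated 2])
               (auto intro!: always_eventually wv radius_seq_ge_half radius_seq(2))
          then have "(\<lambda>i. F i s) \<longlonglongrightarrow> root n 0" unfolding F_def by (intro tendsto_real_root)
          then show ?thesis using True by simp
        qed simp
      qed
      show "AE s in lborel. norm (indicator T s * F i s) \<le> root n C * indicator T s" for i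
        by (rule AE_I2) (use F0 FC in \<open>auto simp: indicator_def\<close>)
    qed auto
    then have "(\<lambda>i. (2 * pi - \<theta>) * root n C + (\<integral>s. indicator T s * F i s \<partial>lborel)) \<longlonglongrightarrow> (2 * pi - \<theta>) * root n C + 0"
      by (intro tendsto_intros) simp
    then show ?thesis using le by (intro LIMSEQ_le_const[where X = "\<lambda>i. (2 * pi - \<theta>) * root n C + (\<integral>s. indicator T s * F i s \<partial>lborel)"]) auto
  qed
  moreover have "(\<lambda>n. 2 * pi * root n (cmod (w 0))) \<longlonglongrightarrow> 2 * pi * 1"
    by (intro tendsto_intros LIMSEQ_root_const) (use w(2) in simp)
  moreover have "(\<lambda>n. (2 * pi - \<theta>) * root n C) \<longlonglongrightarrow> (2 * pi - \<theta>) * 1"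
    by (intro tendsto_intros LIMSEQ_root_const C)
  ultimately have "2 * pi * 1 \<le> (2 * pi - \<theta>) * 1"
    by (intro LIMSEQ_le[of "\<lambda>n. 2 * pi * root n (cmod (w 0))" _ "\<lambda>n. (2 * pi - \<theta>) * root n C"]) (auto intro!: exI[of _ 1])
  then show False using \<theta> by simp
qed

section \<open>Uniqueness for bounded functions on the ball\<close>

text \<open>
  The zero set of a holomorphic function that does not vanish at \<open>w\<close> meets every segment
  starting at \<open>w\<close> in a finite set.  By Tonelli's theorem almost all of the images of the ball
  under the contractions towards \<open>w\<close> meet it in a null set.
\<close>

lemma holomorphic_zero_set_null:
  fixes u :: "complex ^ 'n \<Rightarrow> complex"
  assumes u: "holomorphic_fun_on u (ball 0 1)" and w: "w \<in> ball 0 1" "u w \<noteq> 0"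
  shows "{z \<in> ball 0 1. u z = 0} \<in> null_sets lborel"
proof -
  define B where "B = ball (0 :: complex ^ 'n) 1"
  have [measurable]: "B \<in> sets borel" by (simp add: B_def)
  define Z where "Z = {z \<in> B. u z = 0}"
  have Z[measurable]: "Z \<in> sets borel"
  proof -
    have "(\<lambda>z. if z \<in> B then u z else 1) \<in> borel_measurable borel"
      by (rule borel_measurable_continuous_on_if) (use holomorphic_fun_on_imp_continuous_on[OF u] in \<open>auto simp: B_def\<close>)
    from measurable_sets[OF this, of "{0}"] have "(\<lambda>z. if z \<in> B then u z else 1) -` {0} \<in> sets borel" by simp
    also have "(\<lambda>z. if z \<in> B then u z else 1) -` {0} = Z" by (auto simp: Z_def split: if_splits)
    finally show ?thesis .
  qed
  let ?T = "\<lambda>(t :: real) x. (1 - t) *\<^sub>R w + t *\<^sub>R x"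
  have seg: "finite {t \<in> {0..1}. ?T t x \<in> Z}" if x: "x \<in> B" for x
  proof -
    define V where "V = {l :: complex. w + l *s (x - w) \<in> ball 0 1}"
    define F where "F l = u (w + l *s (x - w))" for l
    have V: "open V" "convex V"
    proof -
      show "open V" unfolding V_def by (rule open_slice[OF open_ball])
      show "convex V"
      proof (rule convexI)
        fix l m :: complex and a b :: real assume lm: "l \<in> V" "m \<in> V" and ab: "0 \<le> a" "0 \<le> b" "a + b = 1"
        have "a *\<^sub>R (w + l *s (x - w)) + b *\<^sub>R (w + m *s (x - w)) \<in> ball 0 1"
          using convexD[OF convex_ball, of "w + l *s (x - w)" 0 1 "w + m *s (x - w)" a b] lm ab by (simp add: V_def)
        moreover have "a *\<^sub>R (w + l *s (x - w)) + b *\<^sub>R (w + m *s (x - w)) = w + (a *\<^sub>R l + b *\<^sub>R m) *s (x - w)"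
        proof -
          have "w = a *\<^sub>R w + b *\<^sub>R w" using ab(3) by (metis scaleR_left_distrib scaleR_one)
          then show ?thesis
            by (simp add: scaleR_add_right vec_eq_iff algebra_simps)
        qed
        ultimately show "a *\<^sub>R l + b *\<^sub>R m \<in> V" by (simp add: V_def)
      qed
    qed
    have F: "F holomorphic_on V" unfolding F_def[abs_def] V_def by (rule slice_holomorphic[OF u open_ball])
    have T_eq: "w + of_real t *s (x - w) = ?T t x" for t
      by (simp add: vector_smult_of_real algebra_simps)
    then have FT: "F (of_real t) = u (?T t x)" for t unfolding F_def by simp
    have K: "of_real ` {0..1} \<subseteq> V"
    proof
      fix l :: complex assume "l \<in> of_real ` {0..1}"
      then obtain t where t: "l = of_real t" "0 \<le> t" "t \<le> 1" by auto
      have "?T t x \<in> ball 0 1"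
        using convexD[OF convex_ball, of w 0 1 x "1 - t" t] w(1) x t by (simp add: B_def)
      then show "l \<in> V" unfolding V_def t(1) mem_Collect_eq T_eq .
    qed
    have "finite {l \<in> of_real ` {0..1}. F l = 0}"
    proof (cases "F constant_on V")
      case True
      have "(0 :: complex) \<in> of_real ` {0..1}" by (auto intro!: image_eqI[of _ _ 0])
      then have "0 \<in> V" using K by blast
      moreover have "F 0 \<noteq> 0" using w(2) by (simp add: F_def)
      ultimately have "F l \<noteq> 0" if "l \<in> V" for l using True that unfolding constant_on_def by metis
      then have none: "{l \<in> of_real ` {0..1}. F l = 0} = {}" using K by blast
      show ?thesis unfolding none by (rule finite.emptyI)
    next
      case False
      have "compact (complex_of_real ` {0..1})" by (intro compact_continuous_image continuous_intros) auto
      then show ?thesis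
        by (rule holomorphic_compact_finite_zeros[OF F V(1) convex_connected[OF V(2)] _ K False])
    qed
    moreover have "of_real ` {t \<in> {0..1}. ?T t x \<in> Z} \<subseteq> {l \<in> of_real ` {0..1}. F l = 0}"
      by (auto simp: FT Z_def)
    ultimately have "finite (complex_of_real ` {t \<in> {0..1}. ?T t x \<in> Z})" by (rule rev_finite_subset)
    then show ?thesis by (rule finite_imageD) (auto simp: inj_on_def)
  qed
  define N where "N t = (\<integral>\<^sup>+x. indicator B x * indicator Z (?T t x) \<partial>lborel)" for t
  have "(\<integral>\<^sup>+t. indicator {0..1} t * N t \<partial>lborel) = (\<integral>\<^sup>+t. \<integral>\<^sup>+x. indicator {0..1} t * (indicator B x * indicator Z (?T t x)) \<partial>lborel \<partial>lborel)"
    unfolding N_def by (intro nn_integral_cong nn_integral_cmult[symmetric]) measurable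
  also have "\<dots> = (\<integral>\<^sup>+x. \<integral>\<^sup>+t. indicator {0..1} t * (indicator B x * indicator Z (?T t x)) \<partial>lborel \<partial>lborel)"
    by (rule lborel_pair.Fubini') measurable
  also have "\<dots> = (\<integral>\<^sup>+(x :: complex ^ 'n). 0 \<partial>lborel)"
  proof (rule nn_integral_cong)
    fix x :: "complex ^ 'n"
    show "(\<integral>\<^sup>+t. indicator {0..1} t * (indicator B x * indicator Z (?T t x)) \<partial>lborel) = 0"
    proof (cases "x \<in> B")
      case True
      have "emeasure lborel {t \<in> {0..1}. ?T t x \<in> Z} = 0"
        by (rule emeasure_lborel_countable[OF countable_finite[OF seg[OF True]]])
      moreover have "(\<lambda>t. indicator {0..1} t * (indicator B x * indicator Z (?T t x)) :: ennreal) = indicator {t \<in> {0..1}. ?T t x \<in> Z}"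
        using True by (auto simp: indicator_def)
      moreover have "{t \<in> {0..1}. ?T t x \<in> Z} \<in> sets lborel"
        using finite_imp_closed[OF seg[OF True]] by (simp add: borel_closed)
      ultimately show ?thesis by (simp only: nn_integral_indicator)
    qed simp
  qed
  finally have "(\<integral>\<^sup>+t. indicator {0..1} t * N t \<partial>lborel) = 0" by simp
  moreover have Nm: "N \<in> borel_measurable borel" unfolding N_def by measurable
  ultimately have AE_N: "AE t in lborel. indicator {0..1} t * N t = 0"
    by (subst (asm) nn_integral_0_iff_AE) auto
  have ex: "\<exists>t. radius_seq i < t \<and> t < 1 \<and> N t = 0" for i
  proof (rule ccontr)
    assume "\<not> ?thesis"
    then have nz: "N t \<noteq> 0" if "t \<in> {radius_seq i<..<1}" for t using that by auto
    have "AE t in lborel. t \<notin> {radius_seq i<..<1}"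
      using AE_N
    proof eventually_elim
      case (elim t)
      then show ?case using nz[of t] radius_seq(1)[of i] by (auto simp: indicator_def split: if_splits)
    qed
    then have "{radius_seq i<..<1} \<in> null_sets lborel" by (subst AE_iff_null_sets) auto
    then show False using radius_seq(2)[of i] by (auto simp: null_sets_def)
  qed
  then obtain t where t: "\<And>i. radius_seq i < t i" "\<And>i. t i < 1" "\<And>i. N (t i) = 0" by metis
  have t_pos: "0 < t i" for i using radius_seq(1)[of i] t(1)[of i] by linarith
  have t_lim: "t \<longlonglongrightarrow> 1"
    by (rule tendsto_sandwich[OF _ _ radius_seq(3) tendsto_const]) (use t in \<open>auto intro!: always_eventually less_imp_le\<close>)
  \<comment> \<open>the part of the zero set that lies in the image of the ball under the contraction with factor \<open>t i\<close>\<close>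
  define Y where "Y i = {y \<in> Z. (1 / t i) *\<^sub>R (y - (1 - t i) *\<^sub>R w) \<in> B}" for i
  have Ym: "Y i \<in> sets lborel" for i unfolding Y_def by measurable
  have "emeasure lborel (Y i) = 0" for i
  proof -
    have "emeasure lborel (Y i) = (\<integral>\<^sup>+y. indicator (Y i) y \<partial>lborel)" using Ym by simp
    also have "\<dots> = ennreal (\<bar>t i\<bar> ^ DIM(complex ^ 'n)) * (\<integral>\<^sup>+x. indicator (Y i) (?T (t i) x) \<partial>lborel)"
      by (rule nn_integral_lborel_affine) (use Ym t_pos[of i] in auto)
    also have "(\<integral>\<^sup>+x. indicator (Y i) (?T (t i) x) \<partial>lborel) = N (t i)"
      unfolding N_def using t_pos[of i] by (intro nn_integral_cong) (auto simp: Y_def indicator_def)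
    finally show ?thesis using t(3) by simp
  qed
  then have "(\<Union>i. Y i) \<in> null_sets lborel" using Ym by (intro null_sets_UN) auto
  moreover have "Z \<subseteq> (\<Union>i. Y i)"
  proof
    fix y assume y: "y \<in> Z"
    have "(\<lambda>i. (1 / t i) *\<^sub>R (y - (1 - t i) *\<^sub>R w)) \<longlonglongrightarrow> (1 / 1) *\<^sub>R (y - (1 - 1) *\<^sub>R w)"
      by (intro tendsto_intros t_lim) simp
    then have "(\<lambda>i. norm ((1 / t i) *\<^sub>R (y - (1 - t i) *\<^sub>R w))) \<longlonglongrightarrow> norm y" using tendsto_norm by fastforce
    then have "eventually (\<lambda>i. norm ((1 / t i) *\<^sub>R (y - (1 - t i) *\<^sub>R w)) < 1) sequentially"
      by (rule order_tendstoD) (use y in \<open>simp add: Z_def B_def\<close>)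
    then obtain i where "norm ((1 / t i) *\<^sub>R (y - (1 - t i) *\<^sub>R w)) < 1" using eventually_happens by fastforce
    then show "y \<in> (\<Union>i. Y i)" using y by (auto simp: Y_def B_def)
  qed
  ultimately have "Z \<in> null_sets lborel" using Z by (metis null_sets_subset sets_lborel)
  then show ?thesis by (simp add: Z_def B_def)
qed

text \<open>
  By Tonelli's theorem for the circle action there is a set \<open>A\<close> of positive measure such that the
  circles through its points meet \<open>E\<close> in sets of positive length.  The uniqueness theorem on the discs
  bounded by these circles shows that \<open>u\<close> vanishes on the cone over \<open>A\<close>, which has positive volume.
\<close>

lemma bounded_radial_uniqueness_ball:
  fixes u :: "complex ^ 'n \<Rightarrow> complex"
  assumes u: "holomorphic_fun_on u (ball 0 1)" and B: "\<And>z. z \<in> ball 0 1 \<Longrightarrow> cmod (u z) \<le> B"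
    and E: "E \<in> sets \<sigma>" "emeasure \<sigma> E \<noteq> 0"
    and rad: "\<And>\<zeta>. \<zeta> \<in> E \<Longrightarrow> ((\<lambda>r. u (r *\<^sub>R \<zeta>)) \<longlongrightarrow> 0) (at_left 1)"
    and z: "z \<in> ball 0 1"
  shows "u z = 0"
proof (rule ccontr)
  assume "u z \<noteq> 0"
  then have null: "{z \<in> ball 0 1. u z = 0} \<in> null_sets lborel" by (rule holomorphic_zero_set_null[OF u z])
  interpret pair_sigma_finite \<sigma> "lborel :: real measure" ..
  have Eb[measurable]: "E \<in> sets borel" using E(1) unfolding sets_sphere_measure_iff by simp
  note [measurable] = E(1)
  have "(\<lambda>p :: (complex ^ 'n) \<times> real. cis (snd p) *s fst p) \<in> \<sigma> \<Otimes>\<^sub>M lborel \<rightarrow>\<^sub>M \<sigma>"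
    using rotation_measurable_pair[of 1] by simp
  from measurable_compose[OF this borel_measurable_indicator[OF E(1)]]
  have [measurable]: "(\<lambda>p. indicator E (cis (snd p) *s fst p) :: ennreal) \<in> borel_measurable (\<sigma> \<Otimes>\<^sub>M lborel)" .
  define g where "g \<zeta> = (\<integral>\<^sup>+s. indicator E (cis s *s \<zeta>) * indicator {0..2 * pi} s \<partial>lborel)" for \<zeta>
  have gm[measurable]: "g \<in> borel_measurable \<sigma>"
    unfolding g_def by (rule lborel.borel_measurable_nn_integral) (simp add: split_beta)
  have "(\<integral>\<^sup>+\<zeta>. g \<zeta> \<partial>\<sigma>) = (\<integral>\<^sup>+s. (\<integral>\<^sup>+\<zeta>. indicator E (cis s *s \<zeta>) * indicator {0..2 * pi} s \<partial>\<sigma>) \<partial>lborel)"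
    unfolding g_def by (rule Fubini'[symmetric]) (simp add: split_beta)
  also have "\<dots> = (\<integral>\<^sup>+s. emeasure \<sigma> E * indicator {0..2 * pi} s \<partial>lborel)"
  proof (intro nn_integral_cong)
    fix s :: real
    have "(\<integral>\<^sup>+\<zeta>. indicator E (cis s *s \<zeta>) * indicator {0..2 * pi} s \<partial>\<sigma>) = (\<integral>\<^sup>+\<zeta>. indicator E \<zeta> * indicator {0..2 * pi} s \<partial>\<sigma>)"
      by (rule circle_invariant_nn_integral[OF circle_invariant_sphere_measure, of "cis s" "\<lambda>\<zeta>. indicator E \<zeta> * indicator {0..2 * pi} s"]) auto
    also have "\<dots> = emeasure \<sigma> E * indicator {0..2 * pi} s"
      using E(1) by (subst nn_integral_multc) auto
    finally show "(\<integral>\<^sup>+\<zeta>. indicator E (cis s *s \<zeta>) * indicator {0..2 * pi} s \<partial>\<sigma>) = emeasure \<sigma> E * indicator {0..2 * pi} s" .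
  qed
  also have "\<dots> = emeasure \<sigma> E * ennreal (2 * pi)" by (simp add: nn_integral_cmult)
  finally have "(\<integral>\<^sup>+\<zeta>. g \<zeta> \<partial>\<sigma>) \<noteq> 0" using E(2) by simp
  then have nAE: "\<not> (AE \<zeta> in \<sigma>. g \<zeta> = 0)" using nn_integral_0_iff_AE[OF gm] by simp
  define A where "A = {\<zeta> \<in> space \<sigma>. g \<zeta> \<noteq> 0}"
  have A: "A \<in> sets \<sigma>" unfolding A_def by measurable
  have A_pos: "emeasure \<sigma> A \<noteq> 0"
  proof
    assume "emeasure \<sigma> A = 0"
    then have "AE \<zeta> in \<sigma>. \<zeta> \<notin> A" using A by (subst AE_iff_null_sets[symmetric]) auto
    then have "AE \<zeta> in \<sigma>. g \<zeta> = 0" using AE_space by eventually_elim (auto simp: A_def)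
    with nAE show False by simp
  qed
  have slice0: "u (l *s \<zeta>) = 0" if \<zeta>: "\<zeta> \<in> A" and l: "cmod l < 1" for \<zeta> l
  proof -
    have n1: "norm \<zeta> = 1" using \<zeta> by (simp add: A_def)
    define T where "T = {s \<in> {0..2 * pi}. cis s *s \<zeta> \<in> E}"
    have T: "T \<in> sets borel"
    proof -
      have "(\<lambda>s. cis s *s \<zeta>) \<in> borel_measurable borel" by (intro borel_measurable_continuous_onI continuous_intros)
      from measurable_sets[OF this Eb] have "(\<lambda>s. cis s *s \<zeta>) -` E \<in> sets borel" by simp
      moreover have "T = {0..2 * pi} \<inter> (\<lambda>s. cis s *s \<zeta>) -` E" by (auto simp: T_def)
      ultimately show ?thesis by auto
    qed
    have "g \<zeta> = emeasure lborel T"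
    proof -
      have "(\<lambda>s. indicator E (cis s *s \<zeta>) * indicator {0..2 * pi} s :: ennreal) = indicator T" by (auto simp: T_def indicator_def)
      then show ?thesis unfolding g_def using T by simp
    qed
    then have T_pos: "emeasure lborel T \<noteq> 0" using \<zeta> by (simp add: A_def)
    have "{l. l *s \<zeta> \<in> ball 0 1} = ball 0 1" using n1 by (auto simp: norm_vector_smult)
    then have hol: "(\<lambda>l. u (l *s \<zeta>)) holomorphic_on ball 0 1"
      using central_slice_holomorphic[OF u, of \<zeta>] by simp
    show ?thesis
    proof (rule bounded_radial_uniqueness[OF hol _ T _ T_pos])
      show "cmod (u (l *s \<zeta>)) \<le> B" if "l \<in> ball 0 1" for l using that n1 by (intro B) (simp add: norm_vector_smult)
      show "((\<lambda>r. u ((of_real r * cis s) *s \<zeta>)) \<longlongrightarrow> 0) (at_left 1)" if "s \<in> T" for s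
        using rad[of "cis s *s \<zeta>"] that by (simp add: T_def vector_smult_of_real[symmetric] vector_smult_assoc_complex)
    qed (use l in \<open>auto simp: T_def\<close>)
  qed
  have Ab: "A \<in> sets borel" "A \<subseteq> sphere 0 1" using A unfolding sets_sphere_measure_iff by simp_all
  have "{x \<in> ball 0 1. sgn x \<in> A} \<subseteq> {z \<in> ball 0 1. u z = 0}"
  proof
    fix x assume x: "x \<in> {x \<in> ball 0 1. sgn x \<in> A}"
    have "norm x *\<^sub>R sgn x = x" by (cases "x = 0") (auto simp: sgn_div_norm)
    then show "x \<in> {z \<in> ball 0 1. u z = 0}"
      using slice0[of "sgn x" "of_real (norm x)"] x by (simp add: vector_smult_of_real)
  qed
  moreover have "{x \<in> ball 0 1. sgn x \<in> A} \<in> sets lborel"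
  proof -
    have "{x \<in> ball 0 1. sgn x \<in> A} = ball 0 1 \<inter> sgn -` A" by auto
    then show ?thesis using measurable_sets[OF borel_measurable_sgn_vec Ab(1)] by auto
  qed
  ultimately have "emeasure lborel {x \<in> ball 0 1. sgn x \<in> A} = 0"
    using null_sets_subset[OF null] by blast
  then have "emeasure \<sigma> A = 0" unfolding emeasure_sphere_measure[OF Ab] by simp
  with A_pos show False by simp
qed

section \<open>Iterated sums over the coordinate functions\<close>

lemma Hardy2_bounded:
  fixes b :: "complex ^ 'n \<Rightarrow> complex"
  assumes b: "holomorphic_fun_on b (ball 0 1)" "\<And>z. z \<in> ball 0 1 \<Longrightarrow> cmod (b z) \<le> 1"
  shows "(\<lambda>z. if z \<in> ball 0 1 then b z else 0) \<in> Hardy2"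
proof (rule Hardy2I)
  show "holomorphic_fun_on (\<lambda>z. if z \<in> ball 0 1 then b z else 0) (ball 0 1)"
    by (rule holomorphic_fun_on_cong[OF b(1) open_ball]) simp
  fix r :: real assume r: "0 < r" "r < 1"
  have "(\<integral>\<zeta>. (cmod (if r *\<^sub>R \<zeta> \<in> ball 0 1 then b (r *\<^sub>R \<zeta>) else 0))\<^sup>2 \<partial>\<sigma>) \<le> (\<integral>\<zeta>. 1 \<partial>(\<sigma> :: (complex ^ 'n) measure))"
  proof (rule integral_mono_AE')
    show "AE \<zeta> in \<sigma>. (cmod (if r *\<^sub>R \<zeta> \<in> ball 0 1 then b (r *\<^sub>R \<zeta>) else 0))\<^sup>2 \<le> 1"
      by (rule AE_I2) (use b(2) in \<open>auto intro!: power_le_one\<close>)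
  qed auto
  then show "(\<integral>\<zeta>. (cmod (if r *\<^sub>R \<zeta> \<in> ball 0 1 then b (r *\<^sub>R \<zeta>) else 0))\<^sup>2 \<partial>\<sigma>) \<le> measure \<sigma> (sphere (0 :: complex ^ 'n) 1)"
    by simp
qed auto

text \<open>
  The \<open>m\<close>-th iterate of the map described at the beginning.  For the form of an operator \<open>T\<close> it
  corresponds to the map \<open>T \<mapsto> \<Sum>j. M\<^sub>j\<^sup>* T M\<^sub>j\<close>, where \<open>M\<^sub>j\<close> is multiplication by \<open>z\<^sub>j\<close>; forms do without the
  adjoints.
\<close>

fun iterated_form :: "((complex ^ 'n \<Rightarrow> complex) \<Rightarrow> (complex ^ 'n \<Rightarrow> complex) \<Rightarrow> complex) \<Rightarrow> nat \<Rightarrow>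
    (complex ^ 'n \<Rightarrow> complex) \<Rightarrow> (complex ^ 'n \<Rightarrow> complex) \<Rightarrow> complex" where
  "iterated_form S 0 h k = S h k"
| "iterated_form S (Suc m) h k = (\<Sum>j\<in>UNIV. iterated_form S m (coord_mult j h) (coord_mult j k))"

lemma iterated_form_add:
  assumes "\<And>h k. h \<in> Hardy2 \<Longrightarrow> k \<in> Hardy2 \<Longrightarrow> S h k = S1 h k + S2 h k" and "h \<in> Hardy2" "k \<in> Hardy2"
  shows "iterated_form S m h k = iterated_form S1 m h k + iterated_form S2 m h k"
  using assms(2,3) by (induction m arbitrary: h k) (auto simp: assms(1) sum.distrib Hardy2_coord_mult)

lemma sum_norm_nth_sq: "norm (x :: complex ^ 'n) = 1 \<Longrightarrow> (\<Sum>j\<in>UNIV. (cmod (x $ j))\<^sup>2) = 1"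
  by (simp add: norm_vec_def L2_set_def real_sqrt_eq_1_iff)

lemma sum_coord_mult_norm:
  fixes h :: "complex ^ 'n \<Rightarrow> complex"
  assumes h: "h \<in> Hardy2"
  shows "(\<Sum>j\<in>UNIV. (Hardy2_norm (coord_mult j h))\<^sup>2) = (Hardy2_norm h)\<^sup>2"
proof -
  have "(\<Sum>j\<in>UNIV. (Hardy2_norm (coord_mult j h))\<^sup>2) = (\<Sum>j\<in>UNIV. sq_norm (boundary_fun (coord_mult j h)))"
    by (simp add: Hardy2_norm_boundary Hardy2_coord_mult h)
  also have "\<dots> = (\<integral>\<zeta>. (\<Sum>j\<in>UNIV. (cmod (boundary_fun (coord_mult j h) \<zeta>))\<^sup>2) \<partial>\<sigma>)"
    unfolding sq_norm_def
    by (rule Bochner_Integration.integral_sum[symmetric])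
       (use boundary_sq_integrable[OF Hardy2_coord_mult[OF h]] in \<open>simp add: sq_integrable_def\<close>)
  also have "\<dots> = sq_norm (boundary_fun h)"
    unfolding sq_norm_def
  proof (rule integral_cong_AE)
    have "AE \<zeta> in \<sigma>. \<forall>j\<in>UNIV. boundary_fun (coord_mult j h) \<zeta> = \<zeta> $ j * boundary_fun h \<zeta>"
      by (rule AE_finite_allI) (auto intro: boundary_coord_mult[OF h])
    then show "AE \<zeta> in \<sigma>. (\<Sum>j\<in>UNIV. (cmod (boundary_fun (coord_mult j h) \<zeta>))\<^sup>2) = (cmod (boundary_fun h \<zeta>))\<^sup>2"
      using AE_space
    proof eventually_elim
      case (elim \<zeta>)
      then have "norm \<zeta> = 1" by simp
      then show ?case using elim(1) by (simp add: norm_mult power_mult_distrib sum_norm_nth_sq flip: sum_distrib_right)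
    qed
  qed (use boundary_fun_measurable[OF Hardy2_coord_mult[OF h]] boundary_fun_measurable[OF h] in measurable)
  finally show ?thesis by (simp add: Hardy2_norm_boundary h)
qed

text \<open>
  Each multiplication by a coordinate raises the order of vanishing by one, and
  \<open>sum_coord_mult_norm\<close> keeps the sum of the squared norms constant while the number of terms grows.
\<close>

lemma iterated_form_small:
  fixes K :: "(complex ^ 'n \<Rightarrow> complex) \<Rightarrow> complex ^ 'n \<Rightarrow> complex"
  assumes K: "\<And>u. u \<in> Hardy2 \<Longrightarrow> K u \<in> Hardy2" and e: "0 \<le> e"
    and small: "\<And>u. u \<in> Hardy2 \<Longrightarrow> vanishes_to_order M u \<Longrightarrow> Hardy2_norm (K u) \<le> e * Hardy2_norm u"
    and "h \<in> Hardy2" "k \<in> Hardy2" "vanishes_to_order p h" "M \<le> p + m"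
  shows "cmod (iterated_form (\<lambda>h k. L2_inner (boundary_fun (K h)) (boundary_fun k)) m h k)
    \<le> e * ((Hardy2_norm h)\<^sup>2 + (Hardy2_norm k)\<^sup>2)"
  using assms(4-)
proof (induction m arbitrary: h k p)
  case 0
  note h = 0(1) and k = 0(2)
  have "vanishes_to_order M h" using vanishes_to_order_mono[OF 0(3)] 0(4) by simp
  have "cmod (L2_inner (boundary_fun (K h)) (boundary_fun k)) \<le> Hardy2_norm (K h) * Hardy2_norm k"
    by (rule Hardy2_inner_bound[OF K[OF h] k])
  also have "\<dots> \<le> (e * Hardy2_norm h) * Hardy2_norm k"
    by (intro mult_right_mono small h Hardy2_norm_nonneg k) fact
  also have "\<dots> = e * (Hardy2_norm h * Hardy2_norm k)" by simp
  also have "\<dots> \<le> e * ((Hardy2_norm h)\<^sup>2 + (Hardy2_norm k)\<^sup>2)"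
  proof (rule mult_left_mono[OF _ e])
    have "0 \<le> Hardy2_norm h * Hardy2_norm k" by (intro mult_nonneg_nonneg Hardy2_norm_nonneg h k)
    then show "Hardy2_norm h * Hardy2_norm k \<le> (Hardy2_norm h)\<^sup>2 + (Hardy2_norm k)\<^sup>2"
      using sum_squares_bound[of "Hardy2_norm h" "Hardy2_norm k"] by linarith
  qed
  finally show ?case by simp
next
  case (Suc m)
  note h = Suc.prems(1) and k = Suc.prems(2)
  let ?S = "\<lambda>h k. L2_inner (boundary_fun (K h)) (boundary_fun k)"
  have "cmod (iterated_form ?S (Suc m) h k) \<le> (\<Sum>j\<in>UNIV. cmod (iterated_form ?S m (coord_mult j h) (coord_mult j k)))"
    unfolding iterated_form.simps by (rule norm_sum)
  also have "\<dots> \<le> (\<Sum>j\<in>UNIV. e * ((Hardy2_norm (coord_mult j h))\<^sup>2 + (Hardy2_norm (coord_mult j k))\<^sup>2))"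
    using Suc.prems by (intro sum_mono Suc.IH[where p = "Suc p"] Hardy2_coord_mult vanishes_to_order_coord_mult) auto
  also have "\<dots> = e * ((Hardy2_norm h)\<^sup>2 + (Hardy2_norm k)\<^sup>2)"
    by (simp add: sum.distrib sum_coord_mult_norm[OF h] sum_coord_mult_norm[OF k] flip: sum_distrib_left)
  finally show ?case .
qed

lemma coordinate_measurable: "(\<lambda>\<zeta> :: complex ^ 'n. \<zeta> $ j) \<in> borel_measurable \<sigma>"
  by (rule borel_measurable_sphere_measureI) (simp add: borel_measurable_continuous_onI continuous_on_component)

text \<open>
  If \<open>A\<close> turns multiplication by \<open>z\<^sub>j\<close> into multiplication by a function \<open>b\<^sub>j\<close> on the sphere, then each
  step contributes \<open>b\<^sub>j\<close> from the first argument and \<open>cnj \<zeta>\<^sub>j\<close> from the second.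
\<close>

lemma iterated_form_multiplier:
  fixes A :: "(complex ^ 'n \<Rightarrow> complex) \<Rightarrow> complex ^ 'n \<Rightarrow> complex" and b :: "'n \<Rightarrow> complex ^ 'n \<Rightarrow> complex"
  assumes A: "\<And>h. h \<in> Hardy2 \<Longrightarrow> sq_integrable (A h)"
    and b: "\<And>j. b j \<in> borel_measurable \<sigma>" "AE \<zeta> in \<sigma>. \<forall>j. cmod (b j \<zeta>) \<le> 1"
    and mult: "\<And>h j. h \<in> Hardy2 \<Longrightarrow> AE \<zeta> in \<sigma>. A (coord_mult j h) \<zeta> = b j \<zeta> * A h \<zeta>"
    and q: "AE \<zeta> in \<sigma>. cmod (\<Sum>j\<in>UNIV. b j \<zeta> * cnj (\<zeta> $ j)) \<le> 1"
    and "h \<in> Hardy2" "k \<in> Hardy2"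
  shows "iterated_form (\<lambda>h k. L2_inner (A h) (boundary_fun k)) m h k =
    (\<integral>\<zeta>. (\<Sum>j\<in>UNIV. b j \<zeta> * cnj (\<zeta> $ j)) ^ m * (A h \<zeta> * cnj (boundary_fun k \<zeta>)) \<partial>\<sigma>)"
  using assms(6-)
proof (induction m arbitrary: h k)
  case 0
  then show ?case by (simp add: L2_inner_def)
next
  case (Suc m)
  note h = Suc.prems(1) and k = Suc.prems(2)
  let ?q = "\<lambda>\<zeta>. \<Sum>j\<in>UNIV. b j \<zeta> * cnj (\<zeta> $ j)"
  note [measurable] = coordinate_measurable b(1) sq_integrable_measurable[OF A[OF h]] boundary_fun_measurable[OF k]
    sq_integrable_measurable[OF A[OF Hardy2_coord_mult[OF h]]] boundary_fun_measurable[OF Hardy2_coord_mult[OF k]]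
  have Akint: "integrable \<sigma> (\<lambda>\<zeta>. A h \<zeta> * cnj (boundary_fun k \<zeta>))"
    by (rule integrable_inner[OF A[OF h] boundary_sq_integrable[OF k]])
  have int: "integrable \<sigma> (\<lambda>\<zeta>. ?q \<zeta> ^ m * (b j \<zeta> * cnj (\<zeta> $ j)) * (A h \<zeta> * cnj (boundary_fun k \<zeta>)))" for j
  proof (rule Bochner_Integration.integrable_bound[OF Akint])
    show "AE \<zeta> in \<sigma>. norm (?q \<zeta> ^ m * (b j \<zeta> * cnj (\<zeta> $ j)) * (A h \<zeta> * cnj (boundary_fun k \<zeta>))) \<le> norm (A h \<zeta> * cnj (boundary_fun k \<zeta>))"
      using q b(2) AE_space
    proof eventually_elim
      case (elim \<zeta>)
      have "cmod (\<zeta> $ j) \<le> 1" using elim(3) Finite_Cartesian_Product.norm_nth_le[of \<zeta> j] by simp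
      then have "cmod (?q \<zeta> ^ m * (b j \<zeta> * cnj (\<zeta> $ j))) \<le> 1"
        unfolding norm_mult norm_power complex_mod_cnj using elim(1,2) by (intro mult_le_one power_le_one) auto
      then show ?case by (subst norm_mult) (rule mult_left_le_one_le, auto)
    qed
  qed measurable
  have "iterated_form (\<lambda>h k. L2_inner (A h) (boundary_fun k)) (Suc m) h k =
    (\<Sum>j\<in>UNIV. \<integral>\<zeta>. ?q \<zeta> ^ m * (A (coord_mult j h) \<zeta> * cnj (boundary_fun (coord_mult j k) \<zeta>)) \<partial>\<sigma>)"
    by (simp add: Suc.IH Hardy2_coord_mult h k)
  also have "\<dots> = (\<Sum>j\<in>UNIV. \<integral>\<zeta>. ?q \<zeta> ^ m * (b j \<zeta> * cnj (\<zeta> $ j)) * (A h \<zeta> * cnj (boundary_fun k \<zeta>)) \<partial>\<sigma>)"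
  proof (intro sum.cong refl integral_cong_AE)
    fix j
    show "AE \<zeta> in \<sigma>. ?q \<zeta> ^ m * (A (coord_mult j h) \<zeta> * cnj (boundary_fun (coord_mult j k) \<zeta>)) =
      ?q \<zeta> ^ m * (b j \<zeta> * cnj (\<zeta> $ j)) * (A h \<zeta> * cnj (boundary_fun k \<zeta>))"
      using mult[OF h, of j] boundary_coord_mult[OF k, of j] by eventually_elim simp
  qed measurable
  also have "\<dots> = (\<integral>\<zeta>. (\<Sum>j\<in>UNIV. ?q \<zeta> ^ m * (b j \<zeta> * cnj (\<zeta> $ j)) * (A h \<zeta> * cnj (boundary_fun k \<zeta>))) \<partial>\<sigma>)"
    by (rule Bochner_Integration.integral_sum[symmetric]) (rule int)
  also have "\<dots> = (\<integral>\<zeta>. ?q \<zeta> ^ Suc m * (A h \<zeta> * cnj (boundary_fun k \<zeta>)) \<partial>\<sigma>)"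
    unfolding sum_distrib_right[symmetric] sum_distrib_left[symmetric] power_Suc2 ..
  finally show ?case .
qed

text \<open>
  The Cauchy-Schwarz inequality and its case of equality.  After a rotation of \<open>V\<close> the hermitian
  inner product is real, and thus equal to the real inner product.
\<close>

lemma inner_coordinates:
  fixes V z :: "complex ^ 'n"
  assumes V: "norm V \<le> 1" and z: "norm z = 1"
  shows "cmod (\<Sum>j\<in>UNIV. V $ j * cnj (z $ j)) \<le> 1"
    and "(\<Sum>j\<in>UNIV. V $ j * cnj (z $ j)) = 1 \<Longrightarrow> V = z"
proof -
  let ?q = "\<lambda>V. \<Sum>j\<in>UNIV. V $ j * cnj (z $ j)"
  have re: "Re (?q W) = W \<bullet> z" for W :: "complex ^ 'n"
    by (simp add: inner_vec_def inner_complex_def)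
  show "cmod (?q V) \<le> 1"
  proof (cases "?q V = 0")
    case False
    define Q where "Q = ?q V"
    define c where "c = cnj Q / of_real (cmod Q)"
    have c: "cmod c = 1" using False by (simp add: c_def Q_def[symmetric] norm_divide)
    have "cnj Q * Q = of_real (cmod Q) * of_real (cmod Q)"
      by (metis complex_norm_square mult.commute of_real_mult power2_eq_square)
    then have "c * ?q V = of_real (cmod (?q V))"
      using False by (simp add: c_def Q_def[symmetric])
    then have "cmod (?q V) = Re (c * ?q V)" by simp
    also have "c * ?q V = ?q (c *s V)" by (simp add: sum_distrib_left mult.assoc)
    also have "Re (?q (c *s V)) = (c *s V) \<bullet> z" by (rule re)
    also have "\<dots> \<le> norm (c *s V) * norm z" by (rule norm_cauchy_schwarz)
    also have "\<dots> \<le> 1" using V z c by (simp add: norm_vector_smult)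
    finally show ?thesis .
  qed simp
  assume "?q V = 1"
  then have "V \<bullet> z = 1" using re[of V] by simp
  moreover have "(norm (V - z))\<^sup>2 = V \<bullet> V - 2 * (V \<bullet> z) + z \<bullet> z"
    unfolding power2_norm_eq_inner by (simp add: inner_diff_left inner_diff_right inner_commute)
  moreover have "V \<bullet> V = (norm V)\<^sup>2" "z \<bullet> z = (norm z)\<^sup>2"
    by (simp_all only: power2_norm_eq_inner)
  moreover have "(norm V)\<^sup>2 \<le> 1" using V by (simp add: power_le_one)
  ultimately have "(norm (V - z))\<^sup>2 \<le> 0" using z by simp
  then show "V = z" by simp
qed

lemma geometric_means_tendsto_0:
  fixes x :: complex
  assumes "cmod x \<le> 1" "x \<noteq> 1"
  shows "(\<lambda>N. (\<Sum>i<N. x ^ i) / of_nat N) \<longlonglongrightarrow> 0"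
proof (rule Lim_null_comparison)
  show "(\<lambda>N. (2 / cmod (1 - x)) * (1 / real N)) \<longlonglongrightarrow> 0"
    by (rule tendsto_mult_right_zero[OF lim_1_over_n])
  have "norm ((\<Sum>i<N. x ^ i) / of_nat N) \<le> (2 / cmod (1 - x)) * (1 / real N)" for N
  proof -
    have "(\<Sum>i<N. x ^ i) = (1 - x ^ N) / (1 - x)" using assms(2) by (simp add: sum_gp_strict)
    moreover have "cmod (1 - x ^ N) \<le> 2"
      using norm_triangle_ineq4[of 1 "x ^ N"] assms(1) power_le_one[of "cmod x" N] by (simp add: norm_power)
    ultimately have "cmod (\<Sum>i<N. x ^ i) \<le> 2 / cmod (1 - x)" by (simp add: norm_divide divide_right_mono)
    from divide_right_mono[OF this, of "real N"] show ?thesis by (simp add: norm_divide)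
  qed
  then show "eventually (\<lambda>N. norm ((\<Sum>i<N. x ^ i) / of_nat N) \<le> (2 / cmod (1 - x)) * (1 / real N)) sequentially"
    by (intro always_eventually allI)
qed

lemma geometric_sum_norm_le:
  fixes x :: complex
  assumes "cmod x \<le> 1"
  shows "cmod ((\<Sum>i<N. x ^ i) / of_nat N) \<le> 1"
proof (cases "N = 0")
  case False
  have "cmod (\<Sum>i<N. x ^ i) \<le> (\<Sum>i<N. 1)"
    by (rule sum_norm_le) (use assms in \<open>simp add: norm_power power_le_one\<close>)
  then show ?thesis using False by (simp add: norm_divide divide_le_eq)
qed simp

text \<open>
  If \<open>q \<noteq> 1\<close> almost everywhere and \<open>\<integral> q\<^sup>m G\<close> stays close to \<open>c\<close> for all large \<open>m\<close>, then \<open>c\<close> is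
  small, because the arithmetic means of the powers of \<open>q\<close> tend to zero.
\<close>

lemma power_integral_limit_small:
  fixes q G :: "complex ^ 'n \<Rightarrow> complex"
  assumes q: "q \<in> borel_measurable \<sigma>" "AE \<zeta> in \<sigma>. cmod (q \<zeta>) \<le> 1 \<and> q \<zeta> \<noteq> 1"
    and G: "integrable \<sigma> G"
    and close: "\<And>m. M \<le> m \<Longrightarrow> cmod ((\<integral>\<zeta>. q \<zeta> ^ m * G \<zeta> \<partial>\<sigma>) - c) \<le> e"
  shows "cmod c \<le> e"
proof -
  note [measurable] = q(1) borel_measurable_integrable[OF G]
  define s where "s N \<zeta> = (\<Sum>i<N. q \<zeta> ^ i) / of_nat N" for N \<zeta>
  have sm[measurable]: "s N \<in> borel_measurable \<sigma>" for N unfolding s_def by measurable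
  have int: "integrable \<sigma> (\<lambda>\<zeta>. q \<zeta> ^ m * G \<zeta>)" for m
  proof (rule Bochner_Integration.integrable_bound[OF G])
    show "AE \<zeta> in \<sigma>. norm (q \<zeta> ^ m * G \<zeta>) \<le> norm (G \<zeta>)"
      using q(2) by eventually_elim (simp add: norm_mult norm_power mult_left_le_one_le power_le_one)
  qed measurable
  have lim: "(\<lambda>N. \<integral>\<zeta>. s N \<zeta> * (q \<zeta> ^ M * G \<zeta>) \<partial>\<sigma>) \<longlonglongrightarrow> (\<integral>\<zeta>. 0 \<partial>(\<sigma> :: (complex ^ 'n) measure))"
  proof (rule integral_dominated_convergence[where w = "\<lambda>\<zeta>. norm (q \<zeta> ^ M * G \<zeta>)"])
    show "AE \<zeta> in \<sigma>. (\<lambda>N. s N \<zeta> * (q \<zeta> ^ M * G \<zeta>)) \<longlonglongrightarrow> 0"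
      using q(2) by eventually_elim (unfold s_def, intro tendsto_mult_left_zero geometric_means_tendsto_0, auto)
    show "AE \<zeta> in \<sigma>. norm (s N \<zeta> * (q \<zeta> ^ M * G \<zeta>)) \<le> norm (q \<zeta> ^ M * G \<zeta>)" for N
      using q(2)
    proof eventually_elim
      case (elim \<zeta>)
      then have "cmod (s N \<zeta>) \<le> 1" unfolding s_def by (intro geometric_sum_norm_le) simp
      then show ?case by (subst norm_mult) (rule mult_left_le_one_le, auto)
    qed
  qed (use int in auto)
  have mean: "(\<integral>\<zeta>. s N \<zeta> * (q \<zeta> ^ M * G \<zeta>) \<partial>\<sigma>) = (\<Sum>i<N. \<integral>\<zeta>. q \<zeta> ^ (M + i) * G \<zeta> \<partial>\<sigma>) / of_nat N" for N
  proof -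
    have "(\<integral>\<zeta>. s N \<zeta> * (q \<zeta> ^ M * G \<zeta>) \<partial>\<sigma>) = (\<integral>\<zeta>. (\<Sum>i<N. q \<zeta> ^ (M + i) * G \<zeta>) / of_nat N \<partial>\<sigma>)"
      by (rule Bochner_Integration.integral_cong) (simp, unfold s_def times_divide_eq_left sum_distrib_right power_add, simp add: mult_ac)
    also have "\<dots> = (\<integral>\<zeta>. (\<Sum>i<N. q \<zeta> ^ (M + i) * G \<zeta>) \<partial>\<sigma>) / of_nat N" by simp
    also have "(\<integral>\<zeta>. (\<Sum>i<N. q \<zeta> ^ (M + i) * G \<zeta>) \<partial>\<sigma>) = (\<Sum>i<N. \<integral>\<zeta>. q \<zeta> ^ (M + i) * G \<zeta> \<partial>\<sigma>)"
      by (rule Bochner_Integration.integral_sum) (rule int)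
    finally show ?thesis .
  qed
  have "cmod ((\<integral>\<zeta>. s N \<zeta> * (q \<zeta> ^ M * G \<zeta>) \<partial>\<sigma>) - c) \<le> e" if N: "N \<ge> 1" for N
  proof -
    have "(\<integral>\<zeta>. s N \<zeta> * (q \<zeta> ^ M * G \<zeta>) \<partial>\<sigma>) - c = (\<Sum>i<N. (\<integral>\<zeta>. q \<zeta> ^ (M + i) * G \<zeta> \<partial>\<sigma>) - c) / of_nat N"
      using N by (simp add: mean sum_subtractf diff_divide_distrib)
    also have "cmod \<dots> \<le> (\<Sum>i<N. e) / real N"
      unfolding norm_divide norm_of_nat by (intro divide_right_mono sum_norm_le close) auto
    also have "\<dots> = e" using N by simp
    finally show ?thesis .
  qed
  moreover have "(\<lambda>N. cmod ((\<integral>\<zeta>. s N \<zeta> * (q \<zeta> ^ M * G \<zeta>) \<partial>\<sigma>) - c)) \<longlonglongrightarrow> cmod ((\<integral>\<zeta>. 0 \<partial>(\<sigma> :: (complex ^ 'n) measure)) - c)"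
    by (intro tendsto_intros lim)
  ultimately have "cmod ((\<integral>\<zeta>. 0 \<partial>(\<sigma> :: (complex ^ 'n) measure)) - c) \<le> e" by (intro LIMSEQ_le_const2) blast+
  then show ?thesis by simp
qed

section \<open>Composition operators of the form Toeplitz plus compact\<close>

text \<open>
  Extended by zero off the ball, the components are elements of the Hardy space.
\<close>

definition component_fun :: "(complex ^ 'n \<Rightarrow> complex ^ 'n) \<Rightarrow> 'n \<Rightarrow> complex ^ 'n \<Rightarrow> complex" where
  "component_fun \<phi> j z = (if z \<in> ball 0 1 then \<phi> z $ j else 0)"

lemma analytic_selfmap_norm: "analytic_selfmap \<phi> \<Longrightarrow> z \<in> ball 0 1 \<Longrightarrow> norm (\<phi> z) < 1"
  unfolding analytic_selfmap_def by force

lemma component_Hardy2: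
  fixes \<phi> :: "complex ^ 'n \<Rightarrow> complex ^ 'n"
  assumes \<phi>: "analytic_selfmap \<phi>"
  shows "component_fun \<phi> j \<in> Hardy2"
  unfolding component_fun_def[abs_def]
proof (rule Hardy2_bounded)
  show "holomorphic_fun_on (\<lambda>z. \<phi> z $ j) (ball 0 1)" using \<phi> by (simp add: analytic_selfmap_def)
  fix z :: "complex ^ 'n" assume "z \<in> ball 0 1"
  then show "cmod (\<phi> z $ j) \<le> 1"
    using analytic_selfmap_norm[OF \<phi>, of z] Finite_Cartesian_Product.norm_nth_le[of "\<phi> z" j] by linarith
qed

definition boundary_map :: "(complex ^ 'n \<Rightarrow> complex ^ 'n) \<Rightarrow> complex ^ 'n \<Rightarrow> complex ^ 'n" where
  "boundary_map \<phi> \<zeta> = (\<chi> j. boundary_fun (component_fun \<phi> j) \<zeta>)"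

lemma boundary_map_tendsto:
  fixes \<phi> :: "complex ^ 'n \<Rightarrow> complex ^ 'n"
  assumes \<phi>: "analytic_selfmap \<phi>"
  shows "AE \<zeta> in \<sigma>. ((\<lambda>r. \<phi> (r *\<^sub>R \<zeta>)) \<longlongrightarrow> boundary_map \<phi> \<zeta>) (at_left 1) \<and> norm (boundary_map \<phi> \<zeta>) \<le> 1"
proof -
  have "AE \<zeta> in \<sigma>. \<forall>j\<in>UNIV. ((\<lambda>r. component_fun \<phi> j (r *\<^sub>R \<zeta>)) \<longlongrightarrow> boundary_fun (component_fun \<phi> j) \<zeta>) (at_left 1)"
    by (rule AE_finite_allI) (auto intro: AE_boundary_tendsto component_Hardy2[OF \<phi>])
  then show ?thesis using AE_space
  proof eventually_elim
    case (elim \<zeta>)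
    then have n1: "norm \<zeta> = 1" by simp
    have ev: "eventually (\<lambda>r. r \<in> {0<..<1}) (at_left (1 :: real))"
      by (rule eventually_at_left_real) simp
    have lim: "((\<lambda>r. \<phi> (r *\<^sub>R \<zeta>)) \<longlongrightarrow> boundary_map \<phi> \<zeta>) (at_left 1)"
    proof (rule vec_tendstoI)
      fix j
      have "((\<lambda>r. component_fun \<phi> j (r *\<^sub>R \<zeta>)) \<longlongrightarrow> boundary_map \<phi> \<zeta> $ j) (at_left 1)"
        using elim(1) by (simp add: boundary_map_def)
      moreover have "eventually (\<lambda>r. component_fun \<phi> j (r *\<^sub>R \<zeta>) = \<phi> (r *\<^sub>R \<zeta>) $ j) (at_left 1)"
        using ev by eventually_elim (use n1 in \<open>simp add: component_fun_def\<close>)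
      ultimately show "((\<lambda>r. \<phi> (r *\<^sub>R \<zeta>) $ j) \<longlongrightarrow> boundary_map \<phi> \<zeta> $ j) (at_left 1)"
        by (rule Lim_transform_eventually)
    qed
    moreover have "norm (boundary_map \<phi> \<zeta>) \<le> 1"
    proof (rule tendsto_upperbound[OF tendsto_norm[OF lim]])
      show "eventually (\<lambda>r. norm (\<phi> (r *\<^sub>R \<zeta>)) \<le> 1) (at_left 1)"
        using ev by eventually_elim (use n1 in \<open>auto intro!: less_imp_le analytic_selfmap_norm[OF \<phi>]\<close>)
    qed simp
    ultimately show ?case by simp
  qed
qed

text \<open>
  The hermitian inner product of \<open>\<phi>*(\<zeta>)\<close> and \<open>\<zeta>\<close>; where \<open>|\<phi>*(\<zeta>)| \<le> 1\<close>, it equals \<open>1\<close> only if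
  \<open>\<phi>*(\<zeta>) = \<zeta>\<close>.
\<close>

definition radial_product :: "(complex ^ 'n \<Rightarrow> complex ^ 'n) \<Rightarrow> complex ^ 'n \<Rightarrow> complex" where
  "radial_product \<phi> \<zeta> = (\<Sum>j\<in>UNIV. boundary_map \<phi> \<zeta> $ j * cnj (\<zeta> $ j))"

lemma boundary_map_measurable:
  fixes \<phi> :: "complex ^ 'n \<Rightarrow> complex ^ 'n"
  assumes "analytic_selfmap \<phi>"
  shows "(\<lambda>\<zeta>. boundary_map \<phi> \<zeta> $ j) \<in> borel_measurable \<sigma>"
  unfolding boundary_map_def using boundary_fun_measurable[OF component_Hardy2[OF assms]] by simp

lemma radial_product_measurable:
  fixes \<phi> :: "complex ^ 'n \<Rightarrow> complex ^ 'n"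
  assumes "analytic_selfmap \<phi>"
  shows "radial_product \<phi> \<in> borel_measurable \<sigma>"
proof -
  note [measurable] = boundary_map_measurable[OF assms] coordinate_measurable
  show ?thesis unfolding radial_product_def[abs_def] by measurable
qed

lemma radial_product_le_1:
  fixes \<phi> :: "complex ^ 'n \<Rightarrow> complex ^ 'n"
  assumes "analytic_selfmap \<phi>"
  shows "AE \<zeta> in \<sigma>. cmod (radial_product \<phi> \<zeta>) \<le> 1"
  using boundary_map_tendsto[OF assms] AE_space
  by eventually_elim (unfold radial_product_def, rule inner_coordinates(1), auto)

text \<open>
  Composition is multiplicative, \<open>C\<^sub>\<phi> (z\<^sub>j h) = \<phi>\<^sub>j C\<^sub>\<phi> h\<close>, so the multiplier is the boundary value of
  \<open>\<phi>\<^sub>j\<close>.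
\<close>

lemma composition_form:
  fixes \<phi> :: "complex ^ 'n \<Rightarrow> complex ^ 'n"
  assumes \<phi>: "analytic_selfmap \<phi>" and C: "linear_op_Hardy2 (comp_op \<phi>)" and hk: "h \<in> Hardy2" "k \<in> Hardy2"
  shows "iterated_form (\<lambda>h k. L2_inner (boundary_fun (comp_op \<phi> h)) (boundary_fun k)) m h k =
    (\<integral>\<zeta>. radial_product \<phi> \<zeta> ^ m * (boundary_fun (comp_op \<phi> h) \<zeta> * cnj (boundary_fun k \<zeta>)) \<partial>\<sigma>)"
  unfolding radial_product_def
proof (rule iterated_form_multiplier)
  show "sq_integrable (boundary_fun (comp_op \<phi> h))" if "h \<in> Hardy2" for h
    by (rule boundary_sq_integrable[OF linear_op_Hardy2D(1)[OF C that]])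
  show "AE \<zeta> in \<sigma>. \<forall>j. cmod (boundary_map \<phi> \<zeta> $ j) \<le> 1"
    using boundary_map_tendsto[OF \<phi>] by eventually_elim (meson Finite_Cartesian_Product.norm_nth_le order_trans)
  show "AE \<zeta> in \<sigma>. boundary_fun (comp_op \<phi> (coord_mult j h)) \<zeta> = boundary_map \<phi> \<zeta> $ j * boundary_fun (comp_op \<phi> h) \<zeta>"
    if h: "h \<in> Hardy2" for h j
    using AE_boundary_tendsto[OF component_Hardy2[OF \<phi>, of j]] AE_boundary_tendsto[OF linear_op_Hardy2D(1)[OF C h]]
  proof eventually_elim
    case (elim \<zeta>)
    have "comp_op \<phi> (coord_mult j h) = (\<lambda>z. component_fun \<phi> j z * comp_op \<phi> h z)"
      by (auto simp: comp_op_def coord_mult_def component_fun_def)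
    then show ?case
      unfolding boundary_map_def vec_lambda_beta using elim by (intro boundary_fun_eqI) (simp add: tendsto_mult)
  qed
  show "AE \<zeta> in \<sigma>. cmod (\<Sum>j\<in>UNIV. boundary_map \<phi> \<zeta> $ j * cnj (\<zeta> $ j)) \<le> 1"
    using radial_product_le_1[OF \<phi>] unfolding radial_product_def .
qed (rule boundary_map_measurable[OF \<phi>] hk)+

text \<open>
  The multiplier is \<open>\<zeta>\<^sub>j\<close> itself, and \<open>\<Sum>j. \<zeta>\<^sub>j cnj \<zeta>\<^sub>j = 1\<close> on the sphere.
\<close>

lemma toeplitz_form:
  fixes f :: "complex ^ 'n \<Rightarrow> complex"
  assumes f: "f \<in> Linfty_sphere" and hk: "h \<in> Hardy2" "k \<in> Hardy2"
  shows "iterated_form (\<lambda>h k. L2_inner (\<lambda>\<zeta>. f \<zeta> * boundary_fun h \<zeta>) (boundary_fun k)) m h k =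
    L2_inner (\<lambda>\<zeta>. f \<zeta> * boundary_fun h \<zeta>) (boundary_fun k)"
proof -
  have one: "(\<Sum>j\<in>UNIV. \<zeta> $ j * cnj (\<zeta> $ j)) = 1" if "\<zeta> \<in> space \<sigma>" for \<zeta> :: "complex ^ 'n"
  proof -
    have eq: "(\<Sum>j\<in>UNIV. \<zeta> $ j * cnj (\<zeta> $ j)) = of_real (\<Sum>j\<in>UNIV. (cmod (\<zeta> $ j))\<^sup>2)"
      unfolding of_real_sum complex_norm_square ..
    have "norm \<zeta> = 1" using that by simp
    then show ?thesis by (simp only: eq sum_norm_nth_sq of_real_1)
  qed
  have "iterated_form (\<lambda>h k. L2_inner (\<lambda>\<zeta>. f \<zeta> * boundary_fun h \<zeta>) (boundary_fun k)) m h k =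
    (\<integral>\<zeta>. (\<Sum>j\<in>UNIV. \<zeta> $ j * cnj (\<zeta> $ j)) ^ m * ((f \<zeta> * boundary_fun h \<zeta>) * cnj (boundary_fun k \<zeta>)) \<partial>\<sigma>)"
  proof (rule iterated_form_multiplier)
    show "sq_integrable (\<lambda>\<zeta>. f \<zeta> * boundary_fun h \<zeta>)" if "h \<in> Hardy2" for h by (rule toeplitz(3)[OF f that])
    show "AE \<zeta> in (\<sigma> :: (complex ^ 'n) measure). \<forall>j. cmod (\<zeta> $ j) \<le> 1"
      by (rule AE_I2) (use Finite_Cartesian_Product.norm_nth_le in \<open>metis mem_sphere_0 space_sphere_measure\<close>)
    show "AE \<zeta> in \<sigma>. f \<zeta> * boundary_fun (coord_mult j h) \<zeta> = \<zeta> $ j * (f \<zeta> * boundary_fun h \<zeta>)" if "h \<in> Hardy2" for h j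
      using boundary_coord_mult[OF that, of j] by eventually_elim simp
    show "AE \<zeta> in (\<sigma> :: (complex ^ 'n) measure). cmod (\<Sum>j\<in>UNIV. \<zeta> $ j * cnj (\<zeta> $ j)) \<le> 1"
      by (rule AE_I2) (simp only: one norm_one order_refl)
  qed (rule coordinate_measurable hk)+
  also have "\<dots> = L2_inner (\<lambda>\<zeta>. f \<zeta> * boundary_fun h \<zeta>) (boundary_fun k)"
    unfolding L2_inner_def by (rule Bochner_Integration.integral_cong) (simp_all add: one del: space_sphere_measure)
  finally show ?thesis .
qed

lemma compact_op_Hardy2_cong:
  fixes K T :: "(complex ^ 'n \<Rightarrow> complex) \<Rightarrow> complex ^ 'n \<Rightarrow> complex"
  assumes K: "compact_op_Hardy2 K" and T: "linear_op_Hardy2 T" and eq: "\<And>h. h \<in> Hardy2 \<Longrightarrow> T h = K h"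
  shows "compact_op_Hardy2 T"
  unfolding compact_op_Hardy2_def
proof (intro conjI T allI impI)
  fix u :: "nat \<Rightarrow> complex ^ 'n \<Rightarrow> complex" assume u: "(\<forall>m. u m \<in> Hardy2) \<and> bdd_above (range (\<lambda>m. Hardy2_norm (u m)))"
  then have "T (u m) = K (u m)" for m using eq by blast
  then show "\<exists>g\<in>Hardy2. \<exists>s. strict_mono s \<and> (\<lambda>m. Hardy2_norm (\<lambda>z. T (u (s m)) z - g z)) \<longlonglongrightarrow> 0"
    using K u unfolding compact_op_Hardy2_def by presburger
qed

text \<open>
  For large \<open>m\<close> the integrals with the factor \<open>q\<^sup>m\<close> differ from the form of \<open>T\<^sub>f\<close> by at most a small
  multiple of the norms, and they tend to zero in the mean.  Hence the form of \<open>T\<^sub>f\<close> vanishes.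
\<close>

lemma toeplitz_eq_0_if_no_fixed_points:
  fixes \<phi> :: "complex ^ 'n \<Rightarrow> complex ^ 'n"
  assumes \<phi>: "analytic_selfmap \<phi>" and C: "linear_op_Hardy2 (comp_op \<phi>)" and f: "f \<in> Linfty_sphere"
    and K: "compact_op_Hardy2 K"
    and eq: "\<And>h. h \<in> Hardy2 \<Longrightarrow> comp_op \<phi> h = (\<lambda>z. toeplitz f h z + K h z)"
    and ne1: "AE \<zeta> in \<sigma>. radial_product \<phi> \<zeta> \<noteq> 1" and h: "h \<in> Hardy2"
  shows "toeplitz f h = (\<lambda>_. 0)"
proof -
  have K_lin: "linear_op_Hardy2 K" using K by (simp add: compact_op_Hardy2_def)
  note KH = linear_op_Hardy2D(1)[OF K_lin] and CH = linear_op_Hardy2D(1)[OF C]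
  let ?SC = "\<lambda>h k. L2_inner (boundary_fun (comp_op \<phi> h)) (boundary_fun k)"
  let ?SF = "\<lambda>h k. L2_inner (\<lambda>\<zeta>. f \<zeta> * boundary_fun h \<zeta>) (boundary_fun k)"
  let ?SK = "\<lambda>h k. L2_inner (boundary_fun (K h)) (boundary_fun k)"
  have split: "?SC h k = ?SF h k + ?SK h k" if h: "h \<in> Hardy2" and k: "k \<in> Hardy2" for h k
  proof -
    note TH = toeplitz(1)[OF f h]
    have "?SC h k = L2_inner (\<lambda>\<zeta>. boundary_fun (toeplitz f h) \<zeta> + boundary_fun (K h) \<zeta>) (boundary_fun k)"
    proof (rule L2_inner_cong_AE)
      show "AE \<zeta> in \<sigma>. boundary_fun (comp_op \<phi> h) \<zeta> = boundary_fun (toeplitz f h) \<zeta> + boundary_fun (K h) \<zeta>"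
        using boundary_lincomb[OF TH KH[OF h], of 1 1] by (simp add: eq[OF h])
    qed (auto intro!: boundary_fun_measurable CH KH h k TH borel_measurable_add)
    also have "\<dots> = L2_inner (boundary_fun (toeplitz f h)) (boundary_fun k) + ?SK h k"
      by (rule L2_inner_add_left) (intro boundary_sq_integrable TH KH h k)+
    finally show ?thesis by (simp add: toeplitz(2)[OF f h k])
  qed
  have zero: "?SF h k = 0" if k: "k \<in> Hardy2" for k
  proof -
    let ?X = "(Hardy2_norm h)\<^sup>2 + (Hardy2_norm k)\<^sup>2"
    have "cmod (?SF h k) \<le> e * ?X" if e: "e > 0" for e
    proof -
      obtain M where M: "\<And>u. u \<in> Hardy2 \<Longrightarrow> vanishes_to_order M u \<Longrightarrow> Hardy2_norm (K u) \<le> e * Hardy2_norm u"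
        using compact_op_small_on_vanishing[OF K e] by blast
      show ?thesis
      proof (rule power_integral_limit_small[OF radial_product_measurable[OF \<phi>]])
        show "AE \<zeta> in \<sigma>. cmod (radial_product \<phi> \<zeta>) \<le> 1 \<and> radial_product \<phi> \<zeta> \<noteq> 1"
          using radial_product_le_1[OF \<phi>] ne1 by eventually_elim simp
        show "integrable \<sigma> (\<lambda>\<zeta>. boundary_fun (comp_op \<phi> h) \<zeta> * cnj (boundary_fun k \<zeta>))"
          by (rule integrable_inner) (intro boundary_sq_integrable CH h k)+
        fix m assume m: "M \<le> m"
        have "(\<integral>\<zeta>. radial_product \<phi> \<zeta> ^ m * (boundary_fun (comp_op \<phi> h) \<zeta> * cnj (boundary_fun k \<zeta>)) \<partial>\<sigma>) = iterated_form ?SC m h k"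
          by (rule composition_form[OF \<phi> C h k, symmetric])
        also have "\<dots> = iterated_form ?SF m h k + iterated_form ?SK m h k"
          by (rule iterated_form_add[OF split h k])
        also have "iterated_form ?SF m h k = ?SF h k" by (rule toeplitz_form[OF f h k])
        finally show "cmod ((\<integral>\<zeta>. radial_product \<phi> \<zeta> ^ m * (boundary_fun (comp_op \<phi> h) \<zeta> * cnj (boundary_fun k \<zeta>)) \<partial>\<sigma>) - ?SF h k) \<le> e * ?X"
          using iterated_form_small[where M = M and p = 0 and m = m and K = K, OF KH less_imp_le[OF e] M h k vanishes_to_order_0[OF h]] m by simp
      qed
    qed
    note small = this
    have X: "0 \<le> ?X" by simp
    show ?thesis
    proof (rule ccontr)
      assume "?SF h k \<noteq> 0"
      then have pos: "0 < cmod (?SF h k)" by simp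
      have "cmod (?SF h k) \<le> cmod (?SF h k) / (2 * (?X + 1)) * ?X"
        by (rule small) (use pos X in \<open>simp add: add_nonneg_pos\<close>)
      also have "\<dots> < cmod (?SF h k)" using pos X by (simp add: divide_less_eq add_nonneg_pos)
      finally show False by simp
    qed
  qed
  note TH = toeplitz(1)[OF f h]
  have "(Hardy2_norm (toeplitz f h))\<^sup>2 = 0"
    using zero[OF TH] toeplitz(2)[OF f h TH] by (simp add: L2_inner_self Hardy2_norm_boundary[OF TH])
  then show ?thesis by (intro Hardy2_eq_zero TH) simp
qed

text \<open>
  The uniqueness theorem for the functions \<open>\<phi>\<^sub>j - z\<^sub>j\<close>, on the set of points where the radial limit of
  \<open>\<phi>\<close> is the point itself.
\<close>

lemma selfmap_eq_id_if_fixed_points: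
  fixes \<phi> :: "complex ^ 'n \<Rightarrow> complex ^ 'n"
  assumes \<phi>: "analytic_selfmap \<phi>" and fixed: "\<not> (AE \<zeta> in \<sigma>. radial_product \<phi> \<zeta> \<noteq> 1)" and z: "z \<in> ball 0 1"
  shows "\<phi> z = z"
proof -
  note [measurable] = radial_product_measurable[OF \<phi>]
  define N where "N = {\<zeta> \<in> space \<sigma>. radial_product \<phi> \<zeta> = 1}"
  have N: "N \<in> sets \<sigma>" unfolding N_def by measurable
  have N_pos: "emeasure \<sigma> N \<noteq> 0"
  proof
    assume "emeasure \<sigma> N = 0"
    then have "AE \<zeta> in \<sigma>. \<zeta> \<notin> N" using N by (subst AE_iff_null_sets[symmetric]) auto
    then have "AE \<zeta> in \<sigma>. radial_product \<phi> \<zeta> \<noteq> 1" using AE_space by eventually_elim (auto simp: N_def)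
    with fixed show False by simp
  qed
  from boundary_map_tendsto[OF \<phi>] obtain N0 where
    N0: "{\<zeta> \<in> space \<sigma>. \<not> (((\<lambda>r. \<phi> (r *\<^sub>R \<zeta>)) \<longlongrightarrow> boundary_map \<phi> \<zeta>) (at_left 1) \<and> norm (boundary_map \<phi> \<zeta>) \<le> 1)} \<subseteq> N0"
    "emeasure \<sigma> N0 = 0" "N0 \<in> sets \<sigma>"
    by (rule AE_E)
  have lim: "((\<lambda>r. \<phi> (r *\<^sub>R \<zeta>)) \<longlongrightarrow> \<zeta>) (at_left 1)" if "\<zeta> \<in> N - N0" for \<zeta>
  proof -
    have sp: "\<zeta> \<in> space \<sigma>" and q1: "radial_product \<phi> \<zeta> = 1" using that by (auto simp: N_def)
    have b: "((\<lambda>r. \<phi> (r *\<^sub>R \<zeta>)) \<longlongrightarrow> boundary_map \<phi> \<zeta>) (at_left 1)" "norm (boundary_map \<phi> \<zeta>) \<le> 1"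
      using N0(1) that sp by blast+
    have "boundary_map \<phi> \<zeta> = \<zeta>"
      by (rule inner_coordinates(2)[OF b(2)]) (use sp q1 in \<open>simp_all add: radial_product_def\<close>)
    with b(1) show ?thesis by simp
  qed
  have "\<phi> z $ j - z $ j = 0" for j
  proof (rule bounded_radial_uniqueness_ball[where B = 2 and E = "N - N0" and u = "\<lambda>z. \<phi> z $ j - z $ j"])
    have "holomorphic_fun_on (\<lambda>z. 1 * \<phi> z $ j + (- 1) * z $ j) (ball 0 1)"
      using \<phi> by (intro holomorphic_fun_on_lincomb holomorphic_fun_on_nth) (simp add: analytic_selfmap_def)
    then show "holomorphic_fun_on (\<lambda>z. \<phi> z $ j - z $ j) (ball 0 1)" by simp
    show "cmod (\<phi> w $ j - w $ j) \<le> 2" if "w \<in> ball 0 1" for w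
      using norm_triangle_ineq4[of "\<phi> w $ j" "w $ j"] analytic_selfmap_norm[OF \<phi> that] that
        Finite_Cartesian_Product.norm_nth_le[of "\<phi> w" j] Finite_Cartesian_Product.norm_nth_le[of w j] by simp
    show "N - N0 \<in> sets \<sigma>" using N N0 by auto
    have "emeasure \<sigma> (N - N0) = emeasure \<sigma> N"
      by (rule emeasure_Diff_null_set) (use N N0 in auto)
    then show "emeasure \<sigma> (N - N0) \<noteq> 0" using N_pos by simp
    show "((\<lambda>r. \<phi> (r *\<^sub>R \<zeta>) $ j - (r *\<^sub>R \<zeta>) $ j) \<longlongrightarrow> 0) (at_left 1)" if "\<zeta> \<in> N - N0" for \<zeta>
    proof -
      have "((\<lambda>r. \<phi> (r *\<^sub>R \<zeta>) $ j - (r *\<^sub>R \<zeta>) $ j) \<longlongrightarrow> \<zeta> $ j - (1 *\<^sub>R \<zeta>) $ j) (at_left 1)"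
        by (intro tendsto_diff tendsto_vec_nth lim that tendsto_scaleR tendsto_const) (rule tendsto_ident_at)
      then show ?thesis by simp
    qed
  qed (rule z)
  then show ?thesis by (simp add: vec_eq_iff)
qed

theorem theorem3p2:
  fixes \<phi> :: "complex ^ 'n \<Rightarrow> complex ^ 'n"
    and f :: "complex ^ 'n \<Rightarrow> complex"
    and K :: "(complex ^ 'n \<Rightarrow> complex) \<Rightarrow> (complex ^ 'n \<Rightarrow> complex)"
  assumes "analytic_selfmap \<phi>"
    and "bounded_op_Hardy2 (comp_op \<phi>)"
    and "f \<in> Linfty_sphere"
    and "compact_op_Hardy2 K"
    and "\<forall>h\<in>Hardy2. comp_op \<phi> h = (\<lambda>z. toeplitz f h z + K h z)"
  shows "compact_op_Hardy2 (comp_op \<phi>) \<or> (\<forall>h\<in>Hardy2. comp_op \<phi> h = h)"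
proof (cases "AE \<zeta> in \<sigma>. radial_product \<phi> \<zeta> \<noteq> 1")
  case True
  have C: "linear_op_Hardy2 (comp_op \<phi>)" using assms(2) by (simp add: bounded_op_Hardy2_def)
  have "comp_op \<phi> h = K h" if "h \<in> Hardy2" for h
    using toeplitz_eq_0_if_no_fixed_points[OF assms(1) C assms(3,4) _ True that] assms(5) that by simp
  then have "compact_op_Hardy2 (comp_op \<phi>)" by (rule compact_op_Hardy2_cong[OF assms(4) C])
  then show ?thesis ..
next
  case False
  have "comp_op \<phi> h = h" if "h \<in> Hardy2" for h
    using selfmap_eq_id_if_fixed_points[OF assms(1) False] Hardy2D(2)[OF that] by (auto simp: comp_op_def)
  then show ?thesis by blast
qed

end
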